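(* Let $(G,F)$ be a sorted profinite group. Then there is a universal SEP-cover $p:(H,F_H)\to(G,F)$. Furthermore, if $G$ is (topologically) finitely generated, then $p$ is the unique universal SEP-cover of $(G,F)$ up to isomorphism.
   Context: Fix a set $\mathcal J$ (of "sorts"). $\mathbb N$ is the set of positive integers and $\mathcal J^{<\mathbb N}=\bigcup_{n\in\mathbb N}\mathcal J^n$. For $J=(j_1,\dots,j_n)$ put $\|J\|=\{j_1,\dots,j_n\}$ and $\sqrt J=\{J'\in\mathcal J^{<\mathbb N}:\|J\|\subseteq\|J'\|\}$; $J^\frown J'$ is concatenation. Fix an arbitrary function $J^*_\subseteq:\mathbb N\times\mathcal J^{<\mathbb N}\to\mathcal J^{<\mathbb N}$ and put $J^*_\cap(J,J')=J^\frown J'$. For a profinite group $G$, $\mathcal N(G)$ is the set of open normal subgroups. A sorting data on $G$ is a family $F=\{F(N):N\in\mathcal N(G)\}$ of non-empty subsets of $\mathcal J^{<\mathbb N}$ such that: (i) $F(G)=\mathcal J^{<\mathbb N}$; (ii) $J\in F(N)\Leftrightarrow\sqrt J\subseteq F(N)$; (iii) if $N_1\subseteq N_2$, $[G:N_1]\le k$ and $J\in F(N_1)$, then $J^*_\subseteq(k,J)\in F(N_2)$; (iv) if $J_1\in F(N_1)$, $J_2\in F(N_2)$, then $J^*_\cap(J_1,J_2)\in F(N_1\cap N_2)$. The pair $(G,F)$ is a sorted profinite group. A morphism $(G_1,F_1)\to(G_2,F_2)$ is a continuous surjective homomorphism $f:G_1\to G_2$ with $F_2(N)\subseteq F_1(f^{-1}[N])$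 for all $N\in\mathcal N(G_2)$. This defines the category of sorted profinite groups; isomorphisms are isomorphisms in this category. $(A,F_A)$ is a quotient of $(G,F)$ if there is a morphism $(G,F)\to(A,F_A)$; $\mathrm{SIm}(G,F)$ is the set of isomorphism classes of finite quotients of $(G,F)$. $(G,F)$ has the sorted embedding property (SEP) if for all $(A,F_A),(B,F_B)\in\mathrm{SIm}(G,F)$ and all morphisms $\Pi:(A,F_A)\to(B,F_B)$, $\varphi:(G,F)\to(B,F_B)$ there is a morphism $\psi:(G,F)\to(A,F_A)$ with $\Pi\circ\psi=\varphi$. A SEP-cover of $(G,F)$ is a morphism $p:(H,F_H)\to(G,F)$ where $(H,F_H)$ has SEP. It is universal if for every SEP-cover $r:(H',F_{H'})\to(G,F)$ there is a morphism $q:(H',F_{H'})\to(H,F_H)$ with $p\circ q=r$. Uniqueness up to isomorphism of a universal SEP-cover $p$ means: for every universal SEP-cover $p':(H',F_{H'})\to(G,F)$ there is an isomorphism $q:(H',F_{H'})\to(H,F_H)$ with $p'=p\circ q$. *)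

theory Defs
  imports "HOL-Analysis.Analysis" "HOL-Algebra.Generated_Groups"
begin

record 'a tgroup = "'a monoid" +
  gtop :: "'a topology"

definition profinite_group :: "'a tgroup \<Rightarrow> bool" where
  "profinite_group G \<longleftrightarrow>
     group G \<and> topspace (gtop G) = carrier G \<and>
     continuous_map (prod_topology (gtop G) (gtop G)) (gtop G) (\<lambda>(x, y). x \<otimes>\<^bsub>G\<^esub> y) \<and>
     continuous_map (gtop G) (gtop G) (\<lambda>x. inv\<^bsub>G\<^esub> x) \<and>
     compact_space (gtop G) \<and> Hausdorff_space (gtop G) \<and>
     (\<forall>x\<in>carrier G. connected_component_of_set (gtop G) x = {x})"

definition open_normal :: "'a tgroup \<Rightarrow> 'a set set" where
  "open_normal G = {N. N \<lhd> G \<and> openin (gtop G) N}"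

definition topologically_fg :: "'a tgroup \<Rightarrow> bool" where
  "topologically_fg G \<longleftrightarrow>
     (\<exists>S. finite S \<and> S \<subseteq> carrier G \<and> gtop G closure_of (generate G S) = carrier G)"

text \<open>
  The set of sorts is the type \<open>'j\<close>; a finite sequence of sorts of positive length is a
  non-empty list.
\<close>

definition sort_seqs :: "'j list set" where
  "sort_seqs = {J. J \<noteq> []}"

definition sqrt_seq :: "'j list \<Rightarrow> 'j list set" where
  "sqrt_seq J = {J' \<in> sort_seqs. set J \<subseteq> set J'}"

definition Jcap :: "'j list \<Rightarrow> 'j list \<Rightarrow> 'j list" where
  "Jcap J J' = J @ J'"

text \<open>
  The parameter \<open>Jsub\<close> is the fixed function of a positive integer \<open>k\<close> and a sequence of sorts.
  A family \<open>F\<close> is a function on all subsets; only its values on open normal subgroups matter.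
  Open subgroups of a profinite group have finite index, so the cardinality of the set of
  cosets is the index.
\<close>

definition sorting_data ::
    "(nat \<Rightarrow> 'j list \<Rightarrow> 'j list) \<Rightarrow> 'a tgroup \<Rightarrow> ('a set \<Rightarrow> 'j list set) \<Rightarrow> bool" where
  "sorting_data Jsub G F \<longleftrightarrow>
     (\<forall>N\<in>open_normal G. F N \<noteq> {} \<and> F N \<subseteq> sort_seqs) \<and>
     F (carrier G) = sort_seqs \<and>
     (\<forall>N\<in>open_normal G. \<forall>J\<in>sort_seqs. J \<in> F N \<longleftrightarrow> sqrt_seq J \<subseteq> F N) \<and>
     (\<forall>N1\<in>open_normal G. \<forall>N2\<in>open_normal G. \<forall>k\<ge>1. \<forall>J.
        N1 \<subseteq> N2 \<and> card (rcosets\<^bsub>G\<^esub> N1) \<le> k \<and> J \<in> F N1 \<longrightarrow> Jsub k J \<in> F N2) \<and>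
     (\<forall>N1\<in>open_normal G. \<forall>N2\<in>open_normal G. \<forall>J1\<in>F N1. \<forall>J2\<in>F N2.
        Jcap J1 J2 \<in> F (N1 \<inter> N2))"

definition sorted_profinite ::
    "(nat \<Rightarrow> 'j list \<Rightarrow> 'j list) \<Rightarrow> 'a tgroup \<Rightarrow> ('a set \<Rightarrow> 'j list set) \<Rightarrow> bool" where
  "sorted_profinite Jsub G F \<longleftrightarrow> profinite_group G \<and> sorting_data Jsub G F"

text \<open>
  Morphisms and isomorphisms are only used between sorted profinite groups. Maps matter only on
  carriers, so equality of composites is stated pointwise on the carrier.
\<close>

definition sorted_morphism ::
    "'a tgroup \<Rightarrow> ('a set \<Rightarrow> 'j list set) \<Rightarrow> 'b tgroup \<Rightarrow> ('b set \<Rightarrow> 'j list set)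
      \<Rightarrow> ('a \<Rightarrow> 'b) \<Rightarrow> bool" where
  "sorted_morphism G1 F1 G2 F2 f \<longleftrightarrow>
     f \<in> hom G1 G2 \<and> continuous_map (gtop G1) (gtop G2) f \<and> f ` carrier G1 = carrier G2 \<and>
     (\<forall>N\<in>open_normal G2. F2 N \<subseteq> F1 (f -` N \<inter> carrier G1))"

definition sorted_isomorphism ::
    "'a tgroup \<Rightarrow> ('a set \<Rightarrow> 'j list set) \<Rightarrow> 'b tgroup \<Rightarrow> ('b set \<Rightarrow> 'j list set)
      \<Rightarrow> ('a \<Rightarrow> 'b) \<Rightarrow> bool" where
  "sorted_isomorphism G1 F1 G2 F2 f \<longleftrightarrow>
     sorted_morphism G1 F1 G2 F2 f \<and>
     (\<exists>g. sorted_morphism G2 F2 G1 F1 g \<and>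
        (\<forall>x\<in>carrier G1. g (f x) = x) \<and> (\<forall>y\<in>carrier G2. f (g y) = y))"

text \<open>
  The isomorphism classes of finite quotients are given by all their representatives whose
  elements are natural numbers: every finite sorted profinite group is isomorphic to one of those.
\<close>

definition SIm ::
    "(nat \<Rightarrow> 'j list \<Rightarrow> 'j list) \<Rightarrow> 'a tgroup \<Rightarrow> ('a set \<Rightarrow> 'j list set)
      \<Rightarrow> (nat tgroup \<times> (nat set \<Rightarrow> 'j list set)) set" where
  "SIm Jsub G F =
     {(A, FA). sorted_profinite Jsub A FA \<and> finite (carrier A) \<and>
        (\<exists>f. sorted_morphism G F A FA f)}"

definition SEP ::
    "(nat \<Rightarrow> 'j list \<Rightarrow> 'j list) \<Rightarrow> 'a tgroup \<Rightarrow> ('a set \<Rightarrow> 'j list set) \<Rightarrow> bool" where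
  "SEP Jsub G F \<longleftrightarrow>
     (\<forall>(A, FA)\<in>SIm Jsub G F. \<forall>(B, FB)\<in>SIm Jsub G F. \<forall>\<pi> \<phi>.
        sorted_morphism A FA B FB \<pi> \<and> sorted_morphism G F B FB \<phi> \<longrightarrow>
        (\<exists>\<psi>. sorted_morphism G F A FA \<psi> \<and> (\<forall>x\<in>carrier G. \<pi> (\<psi> x) = \<phi> x)))"

definition SEP_cover ::
    "(nat \<Rightarrow> 'j list \<Rightarrow> 'j list) \<Rightarrow> 'a tgroup \<Rightarrow> ('a set \<Rightarrow> 'j list set)
      \<Rightarrow> 'b tgroup \<Rightarrow> ('b set \<Rightarrow> 'j list set) \<Rightarrow> ('b \<Rightarrow> 'a) \<Rightarrow> bool" where
  "SEP_cover Jsub G F H FH p \<longleftrightarrow>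
     sorted_profinite Jsub H FH \<and> SEP Jsub H FH \<and> sorted_morphism H FH G F p"

text \<open>
  Universality among the SEP-covers whose underlying set lies in the type \<open>'c\<close>. A definition
  cannot quantify over types, so this type is a parameter.
\<close>

definition universal_SEP_cover ::
    "'c itself \<Rightarrow> (nat \<Rightarrow> 'j list \<Rightarrow> 'j list) \<Rightarrow> 'a tgroup \<Rightarrow> ('a set \<Rightarrow> 'j list set)
      \<Rightarrow> 'b tgroup \<Rightarrow> ('b set \<Rightarrow> 'j list set) \<Rightarrow> ('b \<Rightarrow> 'a) \<Rightarrow> bool" where
  "universal_SEP_cover (U :: 'c itself) Jsub G F H FH p \<longleftrightarrow>
     SEP_cover Jsub G F H FH p \<and>
     (\<forall>(H' :: 'c tgroup) FH' r. SEP_cover Jsub G F H' FH' r \<longrightarrow>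
        (\<exists>q. sorted_morphism H' FH' H FH q \<and> (\<forall>x\<in>carrier H'. p (q x) = r x)))"

text \<open>
  A type that depends only on the type \<open>'a\<close> of elements of the group \<open>G\<close> and is large enough to
  contain a copy of every profinite group with at most \<open>max |N(G)| aleph_0\<close> open normal
  subgroups, \<open>N(G)\<close> being the set of open normal subgroups of \<open>G\<close>: such a group embeds into a
  product of that many finite groups. Closing the open normal subgroups pulled back from \<open>G\<close>
  under solutions of embedding problems shows that every SEP-cover of \<open>(G, F)\<close>, of whatever size,
  factors through one of this kind.
\<close>

type_synonym 'a cover_type = "('a set + nat) set"

end

(*
Let P be a free profinite group, generated by the elements of G together with countably many
elements converging to 1, with the largest sorting data. It has SEP and covers G. Quotients P/K
between P and G, each with its own sorting data, are refined as follows. If P/K does not have SEP,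
choose an unsolvable embedding problem A -> B <- P/K with the smallest kernel. By Goursat's lemma
and minimality, every solution of the problem over a SEP-group E above P/K maps E onto the fibre
product of P/K and A over B. Over E = P this shows that the fibre product is again a quotient P/K';
for general E it shows that every morphism from E to P/K lifts to P/K'. A Bourbaki-Witt tower of
such steps, with intersections of chains, ends in a quotient that has SEP. Lifts from a SEP-cover E
of G extend along the tower by Zorn's lemma and compactness, so that this quotient is universal.

If G is generated by n elements, then the free profinite group of rank n is a SEP-cover of G by
Gaschuetz' lemma, so that a universal cover H is a quotient of it and has finitely many open normal
subgroups of each index. The composite H -> H' -> H of two universal covers permutes them, and is
therefore an isomorphism that respects the sorting data.
*)
theory Submission
  imports Defs "HOL-Library.Bourbaki_Witt_Fixpoint" "HOL-Algebra.Product_Groups" "HOL-Algebra.SndIsomorphismGrp"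
begin

section \<open>Profinite groups\<close>

text \<open>The tower has to be fixed before any SEP-cover \<open>E\<close> is given, yet every
  \<open>E\<close> must be able to follow each of its steps. The image of an arbitrary solution in
  the fibre product would depend on \<open>E\<close>; smallest kernels remove this dependence, so
  that one step serves all \<open>E\<close>. The sorting data of a step are the smallest for which
  both projections are morphisms, since larger data could block the lift of some \<open>E\<close>.

  All quotients stay inside one group \<open>P\<close>. A quotient is a pair of a closed normal
  subgroup and a function on the open normal subgroups of \<open>P\<close>, so the tower is a
  partial order on a single type; a morphism into a quotient takes cosets as values, so limits of
  morphisms are intersections. Among these quotients only the last one gets a carrier, by an
  injection of \<open>P\<close> into \<open>'a cover_type\<close>.

  The generators of \<open>P\<close> that converge to 1 make room for the kernel of a finite
  embedding problem: a continuous map to a finite group kills all but finitely many of them, and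
  some of the killed ones can be sent onto the kernel.\<close>

lemma compact_space_directed:
  assumes "compact_space X" "\<C> \<noteq> {}" "\<And>C. C \<in> \<C> \<Longrightarrow> closedin X C"
    and dir: "\<And>A B. A \<in> \<C> \<Longrightarrow> B \<in> \<C> \<Longrightarrow> \<exists>C\<in>\<C>. C \<subseteq> A \<inter> B"
    and "openin X U" "\<Inter>\<C> \<subseteq> U"
  shows "\<exists>C\<in>\<C>. C \<subseteq> U"
proof (rule ccontr)
  assume neg: "\<not> ?thesis"
  \<comment> \<open>The finite intersection property is applied to the sets \<open>C - U\<close>: by
    directedness a finite intersection of them contains another set of this form.\<close>
  let ?D = "(\<lambda>C. C - U) ` \<C>"
  have "\<exists>C\<in>\<C>. C - U \<subseteq> \<Inter>\<F>" if "finite \<F>" "\<F> \<subseteq> ?D" for \<F>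
    using that
  proof (induction \<F> rule: finite_induct)
    case empty
    then show ?case using assms(2) by auto
  next
    case (insert D \<F>)
    then obtain C A where C: "C \<in> \<C>" "C - U \<subseteq> \<Inter>\<F>" and A: "A \<in> \<C>" "D = A - U" by auto
    then obtain B where "B \<in> \<C>" "B \<subseteq> C \<inter> A" using dir by meson
    then have "B - U \<subseteq> \<Inter>(insert D \<F>)" using C A by auto
    then show ?case using \<open>B \<in> \<C>\<close> by blast
  qed
  then have "\<Inter>\<F> \<noteq> {}" if "finite \<F>" "\<F> \<subseteq> ?D" for \<F>
    using that neg by (metis Diff_eq_empty_iff subset_empty)
  moreover have "\<forall>C\<in>?D. closedin X C"
    using assms(3,5) by (auto intro: closedin_diff)
  ultimately have "\<Inter>?D \<noteq> {}"
    using assms(1)[unfolded compact_space_fip, rule_format, of ?D] by blast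
  then show False using assms(2,6) by auto
qed

lemma (in group) rcos_eq_iff:
  assumes "subgroup N G" "x \<in> carrier G" "y \<in> carrier G"
  shows "N #> x = N #> y \<longleftrightarrow> x \<otimes> inv y \<in> N"
proof -
  have "N #> x = N #> y \<longleftrightarrow> x \<in> N #> y"
    using assms by (metis rcos_self repr_independence)
  also have "\<dots> \<longleftrightarrow> x \<otimes> inv y \<in> N"
    using subgroup.rcos_module[OF assms(1) group_axioms assms(3,2)] .
  finally show ?thesis .
qed

lemma (in group) mem_rcos_iff:
  assumes "subgroup N G" "x \<in> carrier G"
  shows "y \<in> N #> x \<longleftrightarrow> y \<in> carrier G \<and> y \<otimes> inv x \<in> N"
  using assms
  by (metis group_axioms subgroup.elemrcos_carrier subgroup.rcos_module)

lemma (in group) r_coset_eq_vimage: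
  assumes "U \<subseteq> carrier G" "y \<in> carrier G"
  shows "U #> y = {x \<in> carrier G. x \<otimes> inv y \<in> U}"
proof -
  have "x = (x \<otimes> inv y) \<otimes> y" if "x \<in> carrier G" for x
    using that assms by (simp add: m_assoc)
  then show ?thesis
    using assms unfolding r_coset_def by (force simp: m_assoc)
qed

lemma (in group) normalD:
  assumes "N \<lhd> G"
  shows "subgroup N G" "N \<subseteq> carrier G" "\<one> \<in> N"
    "\<And>x y. x \<in> N \<Longrightarrow> y \<in> N \<Longrightarrow> x \<otimes> y \<in> N" "\<And>x. x \<in> N \<Longrightarrow> inv x \<in> N"
    "\<And>x g. x \<in> N \<Longrightarrow> g \<in> carrier G \<Longrightarrow> g \<otimes> x \<otimes> inv g \<in> N"
    "\<And>x g. x \<in> N \<Longrightarrow> g \<in> carrier G \<Longrightarrow> inv g \<otimes> x \<otimes> g \<in> N"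
proof -
  show s: "subgroup N G" using assms normal_imp_subgroup by blast
  show "N \<subseteq> carrier G" "\<one> \<in> N" "\<And>x y. x \<in> N \<Longrightarrow> y \<in> N \<Longrightarrow> x \<otimes> y \<in> N" "\<And>x. x \<in> N \<Longrightarrow> inv x \<in> N"
    using s subgroup.subset subgroup.one_closed subgroup.m_closed subgroup.m_inv_closed by metis+
  show "\<And>x g. x \<in> N \<Longrightarrow> g \<in> carrier G \<Longrightarrow> g \<otimes> x \<otimes> inv g \<in> N"
    by (rule normal.inv_op_closed2[OF assms])
  show "\<And>x g. x \<in> N \<Longrightarrow> g \<in> carrier G \<Longrightarrow> inv g \<otimes> x \<otimes> g \<in> N"
    by (rule normal.inv_op_closed1[OF assms])
qed

section \<open>Open subgroups and the base of open normal subgroups\<close>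

locale profinite = group G for G :: "'a tgroup" (structure) +
  assumes profin: "profinite_group G"
begin

lemma topspace [simp]: "topspace (gtop G) = carrier G"
  and compact: "compact_space (gtop G)"
  and Hausdorff: "Hausdorff_space (gtop G)"
  and cont_mult: "continuous_map (prod_topology (gtop G) (gtop G)) (gtop G) (\<lambda>(x, y). x \<otimes> y)"
  and cont_inv: "continuous_map (gtop G) (gtop G) (\<lambda>x. inv x)"
  using profin by (auto simp: profinite_group_def)

lemma open_subset: "openin (gtop G) U \<Longrightarrow> U \<subseteq> carrier G"
  using openin_subset by fastforce

lemma cont_mult2:
  assumes "continuous_map X (gtop G) f" "continuous_map X (gtop G) g"
  shows "continuous_map X (gtop G) (\<lambda>x. f x \<otimes> g x)"
proof -
  have "continuous_map X (prod_topology (gtop G) (gtop G)) (\<lambda>x. (f x, g x))"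
    using assms by (simp add: continuous_map_paired)
  from continuous_map_compose[OF this cont_mult] show ?thesis
    by (simp add: o_def)
qed

lemma cont_inv2:
  "continuous_map X (gtop G) f \<Longrightarrow> continuous_map X (gtop G) (\<lambda>x. inv (f x))"
  using continuous_map_compose[OF _ cont_inv, of X f] by (simp add: o_def)

lemma open_vimage:
  "continuous_map X (gtop G) f \<Longrightarrow> openin (gtop G) U \<Longrightarrow> openin X {x \<in> topspace X. f x \<in> U}"
  using openin_continuous_map_preimage by blast

lemma open_rcos:
  assumes "openin (gtop G) U" "y \<in> carrier G"
  shows "openin (gtop G) (U #> y)"
proof -
  have "continuous_map (gtop G) (gtop G) (\<lambda>x. x \<otimes> inv y)"
    using assms by (intro cont_mult2) auto
  from open_vimage[OF this assms(1)] show ?thesis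
    using assms open_subset by (simp add: r_coset_eq_vimage)
qed

text \<open>For \<open>n\<close> in \<open>N\<close>, each \<open>h\<close> in \<open>H\<close> has
  the open neighbourhood \<open>N #> (inv n \<otimes> h)\<close>, which stays in the subgroup
  \<open>H\<close>.\<close>

lemma open_subgroupI:
  assumes H: "subgroup H G" and N: "openin (gtop G) N" "N \<noteq> {}" "N \<subseteq> H"
  shows "openin (gtop G) H"
proof (subst openin_subopen, rule ballI)
  fix h assume h: "h \<in> H"
  obtain n where n: "n \<in> N" using N by auto
  have Hc: "H \<subseteq> carrier G" using H subgroup.subset by blast
  let ?U = "N #> (inv n \<otimes> h)"
  have c: "inv n \<otimes> h \<in> H" 
    using n h N by (intro subgroup.m_closed[OF H] subgroup.m_inv_closed[OF H]) auto
  have "openin (gtop G) ?U" using N c Hc by (intro open_rcos) auto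
  moreover have "h \<in> ?U"
  proof -
    have "n \<in> carrier G" "h \<in> carrier G" using n N h Hc by auto
    then have "h = n \<otimes> (inv n \<otimes> h)" by (simp add: m_assoc[symmetric])
    then show ?thesis using n unfolding r_coset_def by blast
  qed
  moreover have "?U \<subseteq> H" using H N c by (auto simp: r_coset_def subgroup.m_closed subset_iff)
  ultimately show "\<exists>T. openin (gtop G) T \<and> h \<in> T \<and> T \<subseteq> H" by blast
qed

text \<open>The complement of \<open>H\<close> is a union of cosets, which are open as translates of
  \<open>H\<close>.\<close>

lemma open_subgroup_closed:
  assumes H: "subgroup H G" and o: "openin (gtop G) H"
  shows "closedin (gtop G) H"
proof -
  have "carrier G - H = \<Union>((#>) H ` (carrier G - H))"
  proof -
    have "y \<notin> H" if "x \<in> carrier G - H" "y \<in> H #> x" for x y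
    proof
      assume "y \<in> H"
      have yx: "y \<otimes> inv x \<in> H" using that H by (simp add: mem_rcos_iff)
      then have "inv (y \<otimes> inv x) \<otimes> y \<in> H" using H \<open>y \<in> H\<close>
        by (meson subgroup.m_closed subgroup.m_inv_closed)
      moreover have "inv (y \<otimes> inv x) \<otimes> y = x"
        using that H \<open>y \<in> H\<close> subgroup.subset[OF H]
        by (auto simp: inv_mult_group m_assoc subset_iff)
      ultimately show False using that by auto
    qed
    moreover have "x \<in> H #> x" "H #> x \<subseteq> carrier G" if "x \<in> carrier G - H" for x
      using that H rcos_self r_coset_subset_G[OF subgroup.subset[OF H]] by auto
    ultimately show ?thesis by blast
  qed
  moreover have "openin (gtop G) (\<Union>((#>) H ` (carrier G - H)))"
    using open_rcos[OF o] by auto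
  ultimately have "openin (gtop G) (carrier G - H)" by metis
  then show ?thesis using subgroup.subset[OF H] by (auto simp: closedin_def)
qed

text \<open>The cosets are disjoint non-empty open sets, so a finite subcover must contain all of
  them.\<close>

lemma finite_rcosets:
  assumes H: "subgroup H G" and o: "openin (gtop G) H"
  shows "finite (rcosets H)"
proof -
  have "\<forall>C\<in>rcosets H. openin (gtop G) C"
    using open_rcos[OF o] by (auto simp: RCOSETS_def)
  moreover have "topspace (gtop G) \<subseteq> \<Union>(rcosets H)"
    using rcosets_part_G[OF H] by simp
  ultimately obtain \<F> where F: "finite \<F>" "\<F> \<subseteq> rcosets H" "topspace (gtop G) \<subseteq> \<Union>\<F>"
    using compact unfolding compact_space_alt by meson
  have "C \<in> \<F>" if C: "C \<in> rcosets H" for C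
  proof -
    obtain x where x: "x \<in> C" "x \<in> carrier G"
      using subgroup.rcosets_non_empty[OF H C] subgroup.rcosets_carrier[OF H group_axioms C] by blast
    then obtain D where D: "D \<in> \<F>" "x \<in> D" using F by auto
    then have "C = D" using rcos_disjoint[OF H] C F x by (auto simp: pairwise_def disjnt_def)
    then show ?thesis using D by simp
  qed
  then show ?thesis using finite_subset[OF subsetI F(1)] by simp
qed

lemma open_normalI:
  assumes "N \<lhd> G" "openin (gtop G) U" "U \<noteq> {}" "U \<subseteq> N"
  shows "N \<in> open_normal G"
  using assms open_subgroupI by (auto simp: open_normal_def normal_imp_subgroup)

lemma carrier_open_normal: "carrier G \<in> open_normal G"
  using normal_self openin_topspace[of "gtop G"] by (simp add: open_normal_def)

lemma Int_open_normal: "N \<in> open_normal G \<Longrightarrow> M \<in> open_normal G \<Longrightarrow> N \<inter> M \<in> open_normal G"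
  by (auto simp: open_normal_def normal_subgroup_intersect)

text \<open>Components and quasi-components agree in a compact Hausdorff space, so the clopen
  neighbourhoods of 1 intersect in 1 and one of them, \<open>V\<close>, lies in \<open>U\<close>.
  The stabiliser of \<open>V\<close> under right translation is an open subgroup inside
  \<open>V\<close>, and its normal core is still open.\<close>

lemma open_normal_basis:
  assumes U: "openin (gtop G) U" "\<one> \<in> U"
  shows "\<exists>N\<in>open_normal G. N \<subseteq> U"
proof -
  let ?T = "gtop G"
  let ?C = "{C. \<one> \<in> C \<and> closedin ?T C \<and> openin ?T C}"
  have q: "quasi_component_of ?T \<one> y \<longleftrightarrow> y = \<one>" for y
  proof -
    have "quasi_component_of ?T \<one> = connected_component_of ?T \<one>"
      using compact Hausdorff by (intro quasi_eq_connected_component_of) auto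
    moreover have "connected_component_of_set ?T \<one> = {\<one>}"
      using profin by (auto simp: profinite_group_def)
    ultimately show ?thesis by auto
  qed
  have "\<exists>C\<in>?C. C \<subseteq> U"
  proof (rule compact_space_directed[OF compact])
    have cl: "carrier G \<in> ?C"
      using closedin_topspace[of ?T] openin_topspace[of ?T] by (auto simp del: closedin_topspace openin_topspace)
    then show "?C \<noteq> {}" by blast
    show "\<Inter>?C \<subseteq> U"
    proof
      fix y assume "y \<in> \<Inter>?C"
      then have "quasi_component_of ?T \<one> y"
        using cl by (auto simp: quasi_component_of)
      then show "y \<in> U" using q U by simp
    qed
  qed (use U in auto)
  then obtain V where V: "\<one> \<in> V" "closedin ?T V" "openin ?T V" "V \<subseteq> U" by auto
  have Vc: "V \<subseteq> carrier G" using V open_subset by auto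
  \<comment> \<open>Tube lemma over the compact set \<open>V\<close>: a single neighbourhood
    \<open>W\<close> of 1 multiplies \<open>V\<close> into itself.\<close>
  obtain W where W: "openin ?T W" "\<one> \<in> W" "\<And>v w. v \<in> V \<Longrightarrow> w \<in> W \<Longrightarrow> v \<otimes> w \<in> V"
  proof -
    let ?W = "{x \<in> topspace (prod_topology ?T ?T). (case x of (x,y) \<Rightarrow> x \<otimes> y) \<in> V}"
    have "openin (prod_topology ?T ?T) ?W" using V cont_mult openin_continuous_map_preimage by blast
    moreover have "compactin ?T V" using V compact closedin_compact_space by blast
    moreover have "V \<times> {\<one>} \<subseteq> ?W" using Vc by auto
    ultimately obtain A B where AB: "openin ?T A" "openin ?T B" "V \<subseteq> A" "\<one> \<in> B" "A \<times> B \<subseteq> ?W"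
      using tube_lemma_left[of ?T ?T ?W V \<one>] by auto
    have "v \<otimes> w \<in> V" if "v \<in> V" "w \<in> B" for v w
    proof -
      have "(v, w) \<in> A \<times> B" using AB(3) that by auto
      then have "(v, w) \<in> ?W" using AB(5) by (rule subsetD[rotated])
      then show ?thesis by simp
    qed
    then show ?thesis using AB that by blast
  qed
  \<comment> \<open>The condition on \<open>inv g\<close> builds in closure under inverses. As 1
    lies in \<open>V\<close>, the stabiliser is contained in \<open>V\<close>.\<close>
  define H where "H = {g \<in> carrier G. (\<forall>v\<in>V. v \<otimes> g \<in> V \<and> v \<otimes> inv g \<in> V)}"
  have H: "subgroup H G"
  proof (rule subgroupI)
    show "H \<subseteq> carrier G" by (auto simp: H_def)
    show "H \<noteq> {}" using Vc by (auto simp: H_def intro!: exI[of _ \<one>])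
    show "inv a \<in> H" if "a \<in> H" for a using that by (auto simp: H_def)
    fix a b assume ab: "a \<in> H" "b \<in> H"
    have "v \<otimes> (a \<otimes> b) \<in> V" "v \<otimes> inv (a \<otimes> b) \<in> V" if "v \<in> V" for v
    proof -
      have "v \<otimes> (a \<otimes> b) = (v \<otimes> a) \<otimes> b" "v \<otimes> inv (a \<otimes> b) = (v \<otimes> inv b) \<otimes> inv a"
        using ab that Vc by (auto simp: H_def m_assoc inv_mult_group subset_iff)
      then show "v \<otimes> (a \<otimes> b) \<in> V" "v \<otimes> inv (a \<otimes> b) \<in> V" using ab that by (auto simp: H_def)
    qed
    then show "a \<otimes> b \<in> H" using ab by (auto simp: H_def)
  qed
  have HV: "H \<subseteq> V"
  proof
    fix h assume "h \<in> H"
    then have "\<one> \<otimes> h \<in> V" "h \<in> carrier G" using V by (auto simp: H_def)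
    then show "h \<in> V" by simp
  qed
  let ?W' = "W \<inter> {x \<in> topspace ?T. inv x \<in> W}"
  have "openin ?T ?W'"
    using W open_vimage[OF cont_inv] by (intro openin_Int) auto
  moreover have "\<one> \<in> ?W'" using W by simp
  moreover have "?W' \<subseteq> H" using W Vc by (auto simp: H_def)
  ultimately have Ho: "openin ?T H" using open_subgroupI[OF H] by blast
  \<comment> \<open>Tube lemma over the whole compact group: one neighbourhood \<open>B\<close> of 1
    has all its conjugates in \<open>H\<close>, so the core \<open>N\<close> contains
    \<open>B\<close> and is open.\<close>
  let ?X = "{x \<in> topspace (prod_topology ?T ?T). fst x \<otimes> snd x \<otimes> inv (fst x) \<in> H}"
  have "continuous_map (prod_topology ?T ?T) ?T (\<lambda>x. fst x \<otimes> snd x \<otimes> inv (fst x))"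
    by (intro cont_mult2 cont_inv2 continuous_map_fst continuous_map_snd)
  then have "openin (prod_topology ?T ?T) ?X" using Ho openin_continuous_map_preimage by blast
  moreover have "compactin ?T (carrier G)" using compact by (simp add: compact_space_def)
  moreover have "carrier G \<times> {\<one>} \<subseteq> ?X" using subgroup.one_closed[OF H] by auto
  ultimately obtain A B where AB: "openin ?T A" "openin ?T B" "carrier G \<subseteq> A" "\<one> \<in> B" "A \<times> B \<subseteq> ?X"
    using tube_lemma_left[of ?T ?T ?X "carrier G" \<one>] by auto
  define N where "N = {x \<in> carrier G. \<forall>g\<in>carrier G. g \<otimes> x \<otimes> inv g \<in> H}"
  have BN: "B \<subseteq> N"
  proof
    fix b assume b: "b \<in> B"
    have "(g, b) \<in> ?X" if "g \<in> carrier G" for g using AB b that by blast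
    then show "b \<in> N" using AB b open_subset by (auto simp: N_def)
  qed
  have "N \<lhd> G"
    unfolding normal_inv_iff
  proof (intro conjI ballI)
    show "subgroup N G"
    proof (rule subgroupI)
      show "N \<subseteq> carrier G" by (auto simp: N_def)
      show "N \<noteq> {}" using BN AB by auto
      show "inv a \<in> N" if "a \<in> N" for a
      proof -
        have "g \<otimes> inv a \<otimes> inv g = inv (g \<otimes> a \<otimes> inv g)" if "g \<in> carrier G" for g
          using that \<open>a \<in> N\<close> by (auto simp: N_def inv_mult_group m_assoc)
        then show ?thesis using that subgroup.m_inv_closed[OF H] by (auto simp: N_def)
      qed
      fix a b assume ab: "a \<in> N" "b \<in> N"
      have "g \<otimes> (a \<otimes> b) \<otimes> inv g = (g \<otimes> a \<otimes> inv g) \<otimes> (g \<otimes> b \<otimes> inv g)" if "g \<in> carrier G" for g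
        using ab that by (simp add: N_def m_assoc inv_solve_left)
      then show "a \<otimes> b \<in> N" using ab subgroup.m_closed[OF H] by (auto simp: N_def)
    qed
    fix x h assume x: "x \<in> carrier G" "h \<in> N"
    have "g \<otimes> (x \<otimes> h \<otimes> inv x) \<otimes> inv g = (g \<otimes> x) \<otimes> h \<otimes> inv (g \<otimes> x)" if "g \<in> carrier G" for g
      using that x by (auto simp: N_def inv_mult_group m_assoc)
    then show "x \<otimes> h \<otimes> inv x \<in> N" using x by (auto simp: N_def)
  qed
  moreover have "N \<subseteq> H"
  proof
    fix x assume "x \<in> N"
    then have "x \<in> carrier G" "\<one> \<otimes> x \<otimes> inv \<one> \<in> H" unfolding N_def by blast+
    then show "x \<in> H" by simp
  qed
  moreover have "B \<noteq> {}" using AB by auto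
  ultimately have "N \<in> open_normal G" "N \<subseteq> U"
    using open_normalI[OF _ AB(2) _ BN] HV V by simp_all
  then show ?thesis by (rule bexI[rotated])
qed

lemma open_normal_basis_at:
  assumes U: "openin (gtop G) U" "x \<in> U"
  shows "\<exists>N\<in>open_normal G. N #> x \<subseteq> U"
proof -
  have x: "x \<in> carrier G" using U open_subset by blast
  have "openin (gtop G) (U #> inv x)" using U x open_rcos by auto
  moreover have "\<one> \<in> U #> inv x" using U x open_subset by (subst r_coset_eq_vimage) auto
  ultimately obtain N where N: "N \<in> open_normal G" "N \<subseteq> U #> inv x" using open_normal_basis by blast
  have "N #> x \<subseteq> U"
  proof
    fix y assume "y \<in> N #> x"
    then obtain n where n: "n \<in> N" "y = n \<otimes> x" by (auto simp: r_coset_def)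
    then obtain u where "u \<in> U" "n = u \<otimes> inv x" using N by (auto simp: r_coset_def)
    then show "y \<in> U" using n x U open_subset by (auto simp: m_assoc subset_iff)
  qed
  then show ?thesis using N by blast
qed

end

section \<open>Recognising profinite groups by a base of cosets\<close>

text \<open>Multiplication is continuous since normality puts the product of the cosets of
  \<open>a\<close> and \<open>b\<close> into the coset of \<open>a \<otimes> b\<close>. A coset and
  the union of the other cosets are complementary open sets, which yields both Hausdorff separation
  and trivial components. The criterion serves quotients as well as closed subgroups of
  products.\<close>

lemma profinite_group_of_base:
  fixes G :: "'a tgroup" (structure)
  assumes grp: "group G" and ts: "topspace (gtop G) = carrier G" and cpt: "compact_space (gtop G)"
    and base: "\<And>U x. openin (gtop G) U \<Longrightarrow> x \<in> U \<Longrightarrow> \<exists>N. N \<lhd> G \<and> openin (gtop G) N \<and> N #> x \<subseteq> U"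
    and tr: "\<And>N x. N \<lhd> G \<Longrightarrow> openin (gtop G) N \<Longrightarrow> x \<in> carrier G \<Longrightarrow> openin (gtop G) (N #> x)"
    and sep: "\<And>x. x \<in> carrier G \<Longrightarrow> x \<noteq> \<one> \<Longrightarrow> \<exists>N. N \<lhd> G \<and> openin (gtop G) N \<and> x \<notin> N"
  shows "profinite_group G"
proof -
  interpret group G by fact
  let ?T = "gtop G"
  have sub: "U \<subseteq> carrier G" if "openin ?T U" for U using openin_subset[OF that] ts by simp
  have mult: "continuous_map (prod_topology ?T ?T) ?T (\<lambda>(x, y). x \<otimes> y)"
    unfolding continuous_map_def
  proof (intro conjI allI impI)
    show "(\<lambda>(x, y). x \<otimes> y) \<in> topspace (prod_topology ?T ?T) \<rightarrow> topspace ?T" by (auto simp: ts)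
    fix U assume U: "openin ?T U"
    let ?W = "{x \<in> topspace (prod_topology ?T ?T). (case x of (x, y) \<Rightarrow> x \<otimes> y) \<in> U}"
    show "openin (prod_topology ?T ?T) ?W"
    proof (subst openin_subopen, rule ballI)
      fix z assume z: "z \<in> ?W"
      obtain a b where ab: "z = (a, b)" "a \<in> carrier G" "b \<in> carrier G" "a \<otimes> b \<in> U" using z ts by auto
      obtain N where N: "N \<lhd> G" "openin ?T N" "N #> (a \<otimes> b) \<subseteq> U" using base[OF U ab(4)] by blast
      have "x \<otimes> y \<in> U" if xy: "x \<in> N #> a" "y \<in> N #> b" for x y
      proof -
        obtain n m where nm: "n \<in> N" "m \<in> N" "x = n \<otimes> a" "y = m \<otimes> b" using xy unfolding r_coset_def by blast
        have c: "n \<in> carrier G" "m \<in> carrier G" using nm normalD[OF N(1)] by auto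
        have "x \<otimes> y = (n \<otimes> (a \<otimes> m \<otimes> inv a)) \<otimes> (a \<otimes> b)"
          using nm c ab by (simp add: m_assoc inv_solve_left)
        moreover have "n \<otimes> (a \<otimes> m \<otimes> inv a) \<in> N"
          using nm ab by (intro normalD(4)[OF N(1)] normalD(6)[OF N(1)])
        ultimately show ?thesis using N(3) by (auto simp: r_coset_def)
      qed
      then have "(N #> a) \<times> (N #> b) \<subseteq> ?W"
        using sub[OF tr[OF N(1,2) ab(2)]] sub[OF tr[OF N(1,2) ab(3)]] ts by auto
      moreover have "openin (prod_topology ?T ?T) ((N #> a) \<times> (N #> b))"
        using tr[OF N(1,2)] ab by (auto simp: openin_prod_Times_iff)
      moreover have "z \<in> (N #> a) \<times> (N #> b)" using ab rcos_self normalD(1)[OF N(1)] by auto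
      ultimately show "\<exists>V. openin (prod_topology ?T ?T) V \<and> z \<in> V \<and> V \<subseteq> ?W" by blast
    qed
  qed
  have inv: "continuous_map ?T ?T (\<lambda>x. inv x)"
    unfolding continuous_map_def
  proof (intro conjI allI impI)
    show "(\<lambda>x. inv x) \<in> topspace ?T \<rightarrow> topspace ?T" by (auto simp: ts)
    fix U assume U: "openin ?T U"
    show "openin ?T {x \<in> topspace ?T. inv x \<in> U}"
    proof (subst openin_subopen, rule ballI)
      fix a assume "a \<in> {x \<in> topspace ?T. inv x \<in> U}"
      then have a: "a \<in> carrier G" "inv a \<in> U" using ts by auto
      obtain N where N: "N \<lhd> G" "openin ?T N" "N #> inv a \<subseteq> U" using base[OF U a(2)] by blast
      have "inv x \<in> U" if xN: "x \<in> N #> a" for x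
      proof -
        obtain n where n: "n \<in> N" "x = n \<otimes> a" using xN by (auto simp: r_coset_def)
        have c: "n \<in> carrier G" using n normalD[OF N(1)] by auto
        have "inv x = (inv a \<otimes> inv n \<otimes> a) \<otimes> inv a"
          using n c a by (simp add: m_assoc inv_mult_group)
        moreover have "inv a \<otimes> inv n \<otimes> a \<in> N"
          using n a by (intro normalD(7)[OF N(1)] normalD(5)[OF N(1)])
        ultimately show ?thesis using N(3) by (auto simp: r_coset_def)
      qed
      then have "N #> a \<subseteq> {x \<in> topspace ?T. inv x \<in> U}"
        using sub[OF tr[OF N(1,2) a(1)]] ts by auto
      moreover have "a \<in> N #> a" using a rcos_self normalD(1)[OF N(1)] by auto
      ultimately show "\<exists>V. openin ?T V \<and> a \<in> V \<and> V \<subseteq> {x \<in> topspace ?T. inv x \<in> U}"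
        using tr[OF N(1,2) a(1)] by blast
    qed
  qed
  have sep2: "\<exists>A B. openin ?T A \<and> openin ?T B \<and> x \<in> A \<and> y \<in> B \<and> A \<inter> B = {} \<and> A \<union> B = carrier G"
    if xy: "x \<in> carrier G" "y \<in> carrier G" "x \<noteq> y" for x y
  proof -
    have "y \<otimes> inv x \<noteq> \<one>" using xy by (metis inv_closed inv_equality inv_inv)
    then obtain N where N: "N \<lhd> G" "openin ?T N" "y \<otimes> inv x \<notin> N" using sep xy by blast
    note s = normalD(1)[OF N(1)]
    let ?B = "\<Union>((#>) N ` {z \<in> carrier G. N #> z \<noteq> N #> x})"
    have "y \<in> ?B" using xy N s rcos_self[OF _ s] by (auto simp: rcos_eq_iff)
    moreover have "(N #> x) \<inter> ?B = {}" using xy rcos_disjoint[OF s] 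
      by (auto simp: pairwise_def disjnt_def RCOSETS_def)
    moreover have "(N #> x) \<union> ?B = carrier G"
    proof
      show "(N #> x) \<union> ?B \<subseteq> carrier G" using xy r_coset_subset_G[OF subgroup.subset[OF s]] by auto
      show "carrier G \<subseteq> (N #> x) \<union> ?B"
      proof
        fix z assume "z \<in> carrier G"
        then have "z \<in> N #> z" using rcos_self[OF _ s] by simp
        then show "z \<in> (N #> x) \<union> ?B" using \<open>z \<in> carrier G\<close> by (cases "N #> z = N #> x") auto
      qed
    qed
    moreover have "openin ?T ?B" using tr[OF N(1,2)] by auto
    ultimately show ?thesis using tr[OF N(1,2) xy(1)] xy rcos_self[OF _ s] by blast
  qed
  have "connected_component_of_set ?T x = {x}" if "x \<in> carrier G" for x
  proof -
    have "y = x" if "connected_component_of ?T x y" for y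
    proof (rule ccontr)
      assume "y \<noteq> x"
      have q: "quasi_component_of ?T x y" using that by (rule connected_imp_quasi_component_of)
      then have "y \<in> carrier G" using ts by (simp add: quasi_component_of)
      then obtain A B where AB: "openin ?T A" "openin ?T B" "x \<in> A" "y \<in> B" "A \<inter> B = {}" "A \<union> B = carrier G"
        using sep2 \<open>x \<in> carrier G\<close> \<open>y \<noteq> x\<close> by metis
      moreover have "carrier G - A = B" using AB by auto
      ultimately have "closedin ?T A" using ts by (simp add: closedin_def) auto
      then show False using q AB by (auto simp: quasi_component_of)
    qed
    then show ?thesis using \<open>x \<in> carrier G\<close> ts by (auto simp: connected_component_of_refl)
  qed
  moreover have "Hausdorff_space ?T"
    unfolding Hausdorff_space_def using sep2 ts by (metis disjnt_def)
  ultimately show ?thesis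
    unfolding profinite_group_def using grp ts cpt mult inv by blast
qed

section \<open>Open normal subgroups over a closed normal subgroup\<close>

text \<open>These correspond to the open normal subgroups of the quotient by \<open>K\<close>, so
  data on the quotient can be indexed by subgroups of \<open>G\<close>.\<close>

definition open_normal_over :: "'a tgroup \<Rightarrow> 'a set \<Rightarrow> 'a set set" where
  "open_normal_over G K = {N \<in> open_normal G. K \<subseteq> N}"

lemma profiniteI: "profinite_group G \<Longrightarrow> profinite G"
  by (simp add: profinite_def profinite_axioms_def profinite_group_def)

context profinite
begin

lemma open_normalD:
  assumes "N \<in> open_normal G"
  shows "N \<lhd> G" "openin (gtop G) N" "closedin (gtop G) N"
  using assms open_subgroup_closed[of N] by (auto simp: open_normal_def normalD)

text \<open>Choose an open normal \<open>U\<close> whose coset \<open>U #> x\<close> misses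
  \<open>K\<close>, and take \<open>N = K <#> U\<close>. If \<open>x = k \<otimes> u\<close>, then
  \<open>k = x \<otimes> inv u\<close> would lie in \<open>U #> x\<close> by normality of
  \<open>U\<close>.\<close>

lemma open_normal_over_separates:
  assumes K: "K \<lhd> G" "closedin (gtop G) K" and x: "x \<in> carrier G" "x \<notin> K"
  shows "\<exists>N\<in>open_normal_over G K. x \<notin> N"
proof -
  have "openin (gtop G) (carrier G - K)" using K by (simp add: closedin_def)
  then obtain U where U: "U \<in> open_normal G" "U #> x \<subseteq> carrier G - K"
    using open_normal_basis_at[of "carrier G - K" x] x by auto
  note Un = open_normalD(1)[OF U(1)]
  let ?N = "K <#> U"
  have "?N \<lhd> G" using normal_subgroup_set_mult_closed[OF K(1) Un] .
  moreover have "U \<subseteq> ?N" "K \<subseteq> ?N"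
  proof -
    have "\<one> \<otimes> u \<in> ?N" "u \<in> carrier G" if "u \<in> U" for u
      using that normalD(3)[OF K(1)] normalD(2)[OF Un] by (auto simp: set_mult_def)
    then show "U \<subseteq> ?N" by force
    have "k \<otimes> \<one> \<in> ?N" "k \<in> carrier G" if "k \<in> K" for k
      using that normalD(3)[OF Un] normalD(2)[OF K(1)] unfolding set_mult_def by blast+
    then show "K \<subseteq> ?N" by force
  qed
  ultimately have N: "?N \<in> open_normal_over G K"
    using open_normalI[of ?N U] open_normalD[OF U(1)] normalD(3)[OF Un] by (auto simp: open_normal_over_def)
  have "x \<notin> ?N"
  proof
    assume "x \<in> ?N"
    then obtain k u where ku: "k \<in> K" "u \<in> U" "x = k \<otimes> u" by (auto simp: set_mult_def)
    have c: "k \<in> carrier G" "u \<in> carrier G" using ku normalD(2)[OF Un] normalD(2)[OF K(1)] by auto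
    have "k = (x \<otimes> inv u \<otimes> inv x) \<otimes> x" using ku c x by (simp add: m_assoc)
    moreover have "x \<otimes> inv u \<otimes> inv x \<in> U"
      using ku x by (intro normalD(6)[OF Un] normalD(5)[OF Un])
    ultimately have "k \<in> U #> x" by (auto simp: r_coset_def)
    then show False using U ku by auto
  qed
  then show ?thesis using N by blast
qed

lemma open_normal_over_Int:
  "N \<in> open_normal_over G K \<Longrightarrow> M \<in> open_normal_over G K \<Longrightarrow> N \<inter> M \<in> open_normal_over G K"
  by (auto simp: open_normal_over_def Int_open_normal)

lemma carrier_open_normal_over: "K \<lhd> G \<Longrightarrow> carrier G \<in> open_normal_over G K"
  using carrier_open_normal normalD(2) by (auto simp: open_normal_over_def)

text \<open>\<open>K\<close> is the intersection of the directed family of open normal subgroups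
  over it, so compactness applies to their traces on \<open>L\<close>. Later \<open>L\<close> is the
  kernel of a map to a finite group, and the open normal subgroups over \<open>K \<inter> L\<close>
  are described in this way.\<close>

lemma open_normal_over_within:
  assumes K: "K \<lhd> G" "closedin (gtop G) K" and L: "closedin (gtop G) L"
    and U: "openin (gtop G) U" "K \<inter> L \<subseteq> U"
  shows "\<exists>N\<in>open_normal_over G K. N \<inter> L \<subseteq> U"
proof -
  let ?C = "(\<lambda>N. N \<inter> L) ` open_normal_over G K"
  have "\<exists>C\<in>?C. C \<subseteq> U"
  proof (rule compact_space_directed[OF compact])
    show "?C \<noteq> {}" using carrier_open_normal_over[OF K(1)] by auto
    show "closedin (gtop G) C" if "C \<in> ?C" for C
      using that open_normalD(3) L by (auto simp: open_normal_over_def)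
    show "\<exists>C\<in>?C. C \<subseteq> A \<inter> B" if AB: "A \<in> ?C" "B \<in> ?C" for A B
    proof -
      obtain N M where "N \<in> open_normal_over G K" "M \<in> open_normal_over G K" "A = N \<inter> L" "B = M \<inter> L"
        using AB by blast
      then show ?thesis using open_normal_over_Int by (intro bexI[of _ "N \<inter> M \<inter> L"]) auto
    qed
    have "\<Inter>?C \<subseteq> K \<inter> L"
    proof
      fix x assume x: "x \<in> \<Inter>?C"
      then have "x \<in> carrier G \<inter> L" using carrier_open_normal_over[OF K(1)] by blast
      moreover have "x \<in> K"
      proof (rule ccontr)
        assume "x \<notin> K"
        then show False using open_normal_over_separates[OF K, of x] x \<open>x \<in> carrier G \<inter> L\<close> by blast
      qed
      ultimately show "x \<in> K \<inter> L" by blast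
    qed
    then show "\<Inter>?C \<subseteq> U" using U by blast
  qed (use U in auto)
  then show ?thesis by auto
qed

lemma one_closed_set: "closedin (gtop G) {\<one>}"
  using Hausdorff by (simp add: closedin_Hausdorff_singleton)

end

section \<open>Continuous homomorphisms and indices\<close>

lemma continuous_homI:
  fixes G :: "'a tgroup" and H :: "'b tgroup"
  assumes G: "profinite G" and H: "profinite H" and f: "f \<in> hom G H"
    and o: "\<And>M. M \<in> open_normal H \<Longrightarrow> openin (gtop G) (f -` M \<inter> carrier G)"
  shows "continuous_map (gtop G) (gtop H) f"
  unfolding continuous_map_def
proof (intro conjI allI impI)
  interpret G: profinite G by fact
  interpret H: profinite H by fact
  interpret group_hom G H f using f by unfold_locales
  show "f \<in> topspace (gtop G) \<rightarrow> topspace (gtop H)" by auto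
  fix U assume U: "openin (gtop H) U"
  show "openin (gtop G) {x \<in> topspace (gtop G). f x \<in> U}"
  proof (subst openin_subopen, rule ballI)
    fix x assume x: "x \<in> {x \<in> topspace (gtop G). f x \<in> U}"
    obtain M where M: "M \<in> open_normal H" "M #>\<^bsub>H\<^esub> f x \<subseteq> U" using H.open_normal_basis_at[OF U, of "f x"] x by auto
    note Mn = H.normalD[OF H.open_normalD(1)[OF M(1)]]
    let ?V = "(f -` M \<inter> carrier G) #>\<^bsub>G\<^esub> x"
    have "openin (gtop G) ?V" using o[OF M(1)] x by (intro G.open_rcos) auto
    moreover have "x \<in> ?V" using x Mn(3) by (subst G.r_coset_eq_vimage) auto
    moreover have "?V \<subseteq> {x \<in> topspace (gtop G). f x \<in> U}"
    proof
      fix y assume "y \<in> ?V"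
      then obtain n where "n \<in> carrier G" "f n \<in> M" "y = n \<otimes>\<^bsub>G\<^esub> x" by (auto simp: r_coset_def)
      then show "y \<in> {x \<in> topspace (gtop G). f x \<in> U}" using x M by (auto simp: r_coset_def)
    qed
    ultimately show "\<exists>T. openin (gtop G) T \<and> x \<in> T \<and> T \<subseteq> {x \<in> topspace (gtop G). f x \<in> U}" by blast
  qed
qed

lemma subgroup_vimage:
  assumes "group_hom G H f" "subgroup M H"
  shows "subgroup (f -` M \<inter> carrier G) G"
proof -
  interpret group_hom G H f by fact
  show ?thesis
    by (rule subgroup.intro)
      (auto simp: subgroup.one_closed[OF assms(2)] subgroup.m_closed[OF assms(2)] subgroup.m_inv_closed[OF assms(2)])
qed

lemma vimage_normal:
  assumes "group_hom G H f" "M \<lhd> H"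
  shows "f -` M \<inter> carrier G \<lhd> G"
proof -
  interpret group_hom G H f by fact
  note Mn = H.normalD[OF assms(2)]
  have "subgroup (f -` M \<inter> carrier G) G"
    using subgroup_vimage[OF assms(1)] Mn(1) .
  then show ?thesis using Mn(6) by (auto simp: G.normal_inv_iff)
qed

lemma vimage_open_normal:
  assumes "profinite G" "profinite H" "f \<in> hom G H" "continuous_map (gtop G) (gtop H) f" "M \<in> open_normal H"
  shows "f -` M \<inter> carrier G \<in> open_normal G"
proof -
  interpret G: profinite G by fact
  interpret H: profinite H by fact
  interpret group_hom G H f using assms by unfold_locales
  have "{x \<in> topspace (gtop G). f x \<in> M} = f -` M \<inter> carrier G" by auto
  then show ?thesis
    using vimage_normal[OF group_hom_axioms] openin_continuous_map_preimage[OF assms(4), of M] assms(5)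
    by (simp add: open_normal_def)
qed

text \<open>A continuous surjection from a compact space to a Hausdorff space is a quotient map. The
  preimage of the image of \<open>N\<close> is a subgroup that contains the open set
  \<open>N\<close>, hence is open.\<close>

lemma image_open_normal:
  assumes "profinite G" "profinite H" "f \<in> hom G H" "continuous_map (gtop G) (gtop H) f"
    and onto: "f ` carrier G = carrier H" and N: "N \<in> open_normal G"
  shows "f ` N \<in> open_normal H"
proof -
  interpret G: profinite G by fact
  interpret H: profinite H by fact
  interpret group_hom G H f using assms by unfold_locales
  note Nn = G.open_normalD[OF N]
  interpret N: normal N G by (rule Nn)
  have im: "f ` N \<lhd> H" using N.surj_hom_normal_subgroup[OF group_hom_axioms onto] .
  have "quotient_map (gtop G) (gtop H) f"
    using assms G.compact H.Hausdorff onto by (intro continuous_imp_quotient_map) auto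
  moreover have "openin (gtop G) (f -` (f ` N) \<inter> carrier G)"
  proof (rule G.open_subgroupI[OF _ Nn(2)])
    show "subgroup (f -` (f ` N) \<inter> carrier G) G"
      using vimage_normal[OF group_hom_axioms im] G.normalD by blast
    show "N \<noteq> {}" using N.one_closed by blast
    show "N \<subseteq> f -` (f ` N) \<inter> carrier G" using N.subset by auto
  qed
  moreover have "{x \<in> topspace (gtop G). f x \<in> f ` N} = f -` (f ` N) \<inter> carrier G" by auto
  moreover have "f ` N \<subseteq> topspace (gtop H)" using N.subset by auto
  ultimately have "openin (gtop H) (f ` N)"
    unfolding quotient_map_def by metis
  then show ?thesis using im by (simp add: open_normal_def)
qed

lemma card_image_cong_kernel:
  assumes "\<And>x y. x \<in> A \<Longrightarrow> y \<in> A \<Longrightarrow> g x = g y \<longleftrightarrow> h x = h y"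
  shows "card (g ` A) = card (h ` A)"
proof -
  have "bij_betw (\<lambda>z. h (inv_into A g z)) (g ` A) (h ` A)"
    unfolding bij_betw_def
  proof
    show "inj_on (\<lambda>z. h (inv_into A g z)) (g ` A)"
      by (rule inj_onI) (metis assms f_inv_into_f inv_into_into)
    have "h (inv_into A g (g x)) = h x" if "x \<in> A" for x
      using that assms by (metis f_inv_into_f imageI inv_into_into)
    then show "(\<lambda>z. h (inv_into A g z)) ` g ` A = h ` A" by (force simp: image_iff)
  qed
  then show ?thesis by (rule bij_betw_same_card)
qed

text \<open>\<open>r\<close> need not be a homomorphism: it is also used for a choice of
  representatives along a coset-valued lift, where products agree only modulo
  \<open>M\<close>.\<close>

lemma card_rcosets_eq:
  assumes "group G" "group H" "subgroup N G" "subgroup M H"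
    and r: "\<And>x. x \<in> carrier G \<Longrightarrow> r x \<in> carrier H"
    and iff: "\<And>x y. x \<in> carrier G \<Longrightarrow> y \<in> carrier G \<Longrightarrow> x \<otimes>\<^bsub>G\<^esub> inv\<^bsub>G\<^esub> y \<in> N \<longleftrightarrow> r x \<otimes>\<^bsub>H\<^esub> inv\<^bsub>H\<^esub> (r y) \<in> M"
    and onto: "\<And>z. z \<in> carrier H \<Longrightarrow> \<exists>x\<in>carrier G. r x \<otimes>\<^bsub>H\<^esub> inv\<^bsub>H\<^esub> z \<in> M"
  shows "card (rcosets\<^bsub>G\<^esub> N) = card (rcosets\<^bsub>H\<^esub> M)"
proof -
  interpret G: group G by fact
  interpret H: group H by fact
  have "rcosets\<^bsub>G\<^esub> N = (\<lambda>x. N #>\<^bsub>G\<^esub> x) ` carrier G" by (auto simp: RCOSETS_def)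
  moreover have "rcosets\<^bsub>H\<^esub> M = (\<lambda>x. M #>\<^bsub>H\<^esub> r x) ` carrier G"
  proof -
    have "M #>\<^bsub>H\<^esub> z \<in> (\<lambda>x. M #>\<^bsub>H\<^esub> r x) ` carrier G" if "z \<in> carrier H" for z
    proof -
      obtain x where x: "x \<in> carrier G" "r x \<otimes>\<^bsub>H\<^esub> inv\<^bsub>H\<^esub> z \<in> M" using onto[OF \<open>z \<in> carrier H\<close>] by (rule bexE)
      then have "M #>\<^bsub>H\<^esub> r x = M #>\<^bsub>H\<^esub> z" using r that H.rcos_eq_iff[OF assms(4)] by simp
      then show ?thesis using x by (metis imageI)
    qed
    then show ?thesis using r unfolding RCOSETS_def by (auto simp del: set_eq_iff)
  qed
  moreover have "card ((\<lambda>x. N #>\<^bsub>G\<^esub> x) ` carrier G) = card ((\<lambda>x. M #>\<^bsub>H\<^esub> r x) ` carrier G)"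
    by (rule card_image_cong_kernel) (simp add: G.rcos_eq_iff[OF assms(3)] H.rcos_eq_iff[OF assms(4)] r iff)
  ultimately show ?thesis by simp
qed

lemma card_rcosets_vimage:
  assumes "group_hom G H f" "f ` carrier G = carrier H" "subgroup M H"
  shows "card (rcosets\<^bsub>G\<^esub> (f -` M \<inter> carrier G)) = card (rcosets\<^bsub>H\<^esub> M)"
proof -
  interpret group_hom G H f by fact
  note Mn = assms(3)
  show ?thesis
  proof (rule card_rcosets_eq[where r = f])
    show "subgroup (f -` M \<inter> carrier G) G"
      using subgroup_vimage[OF assms(1,3)] .
    fix z assume "z \<in> carrier H"
    then obtain x where "x \<in> carrier G" "f x = z" using assms(2) by (metis imageE)
    then show "\<exists>x\<in>carrier G. f x \<otimes>\<^bsub>H\<^esub> inv\<^bsub>H\<^esub> z \<in> M"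
      using subgroup.one_closed[OF Mn] by (intro bexI[of _ x]) auto
  qed (use assms in \<open>auto simp: G.is_group H.is_group\<close>)
qed

section \<open>Quotients\<close>

lemma (in group) inv_cancel:
  assumes "a \<in> carrier G" "b \<in> carrier G"
  shows "inv a \<otimes> (a \<otimes> b) = b" "a \<otimes> (inv a \<otimes> b) = b"
  using assms by (simp_all add: m_assoc[symmetric])

text \<open>
  The quotient of \<open>G\<close> by the fibres of \<open>p\<close>. The values of \<open>p\<close> represent the cosets, so that the
  quotient can live in any type that is large enough.
\<close>

definition quo :: "'a tgroup \<Rightarrow> ('a \<Rightarrow> 'b) \<Rightarrow> 'b tgroup" where
  "quo G p = \<lparr>carrier = p ` carrier G,
     monoid.mult = \<lambda>a b. p (inv_into (carrier G) p a \<otimes>\<^bsub>G\<^esub> inv_into (carrier G) p b),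
     one = p \<one>\<^bsub>G\<^esub>,
     gtop = topology (\<lambda>U. U \<subseteq> p ` carrier G \<and> openin (gtop G) (p -` U \<inter> carrier G))\<rparr>"

locale coset_map = profinite G for G :: "'a tgroup" (structure) +
  fixes K :: "'a set" and p :: "'a \<Rightarrow> 'b"
  assumes K_normal: "K \<lhd> G" and K_closed: "closedin (gtop G) K"
    and p_eq: "\<And>x y. x \<in> carrier G \<Longrightarrow> y \<in> carrier G \<Longrightarrow> p x = p y \<longleftrightarrow> x \<otimes> inv y \<in> K"
begin

lemma quo_carrier: "carrier (quo G p) = p ` carrier G"
  and quo_one: "\<one>\<^bsub>quo G p\<^esub> = p \<one>"
  by (simp_all add: quo_def)

lemma quo_mult:
  assumes "x \<in> carrier G" "y \<in> carrier G"
  shows "p x \<otimes>\<^bsub>quo G p\<^esub> p y = p (x \<otimes> y)"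
proof -
  let ?s = "inv_into (carrier G) p"
  have s: "?s (p x) \<in> carrier G" "?s (p y) \<in> carrier G" "p (?s (p x)) = p x" "p (?s (p y)) = p y"
    using assms by (auto simp: inv_into_into f_inv_into_f)
  then have k: "?s (p x) \<otimes> inv x \<in> K" "?s (p y) \<otimes> inv y \<in> K" using p_eq assms by blast+
  have "(?s (p x) \<otimes> ?s (p y)) \<otimes> inv (x \<otimes> y) = (?s (p x) \<otimes> (?s (p y) \<otimes> inv y) \<otimes> inv (?s (p x))) \<otimes> (?s (p x) \<otimes> inv x)"
    using s assms by (simp add: m_assoc inv_mult_group inv_cancel)
  also have "\<dots> \<in> K" by (rule normalD(4)[OF K_normal normalD(6)[OF K_normal k(2) s(1)] k(1)])
  finally show ?thesis using s assms by (simp add: quo_def p_eq)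
qed

lemma quo_group: "group (quo G p)"
proof (rule groupI)
  show "\<exists>y\<in>carrier (quo G p). y \<otimes>\<^bsub>quo G p\<^esub> x = \<one>\<^bsub>quo G p\<^esub>" if x: "x \<in> carrier (quo G p)" for x
  proof -
    obtain a where "a \<in> carrier G" "x = p a" using x quo_carrier by auto
    then show ?thesis by (intro bexI[of _ "p (inv a)"]) (auto simp: quo_mult quo_one quo_carrier)
  qed
qed (auto simp: quo_carrier quo_one quo_mult m_assoc)

lemma quo_hom: "group_hom G (quo G p) p"
  unfolding group_hom_def group_hom_axioms_def hom_def
  using quo_group by (auto simp: quo_mult quo_carrier)

lemma openin_quo: "openin (gtop (quo G p)) U \<longleftrightarrow> U \<subseteq> p ` carrier G \<and> openin (gtop G) (p -` U \<inter> carrier G)"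
proof -
  have "istopology (\<lambda>U. U \<subseteq> p ` carrier G \<and> openin (gtop G) (p -` U \<inter> carrier G))"
    unfolding istopology_def
  proof (rule conjI; intro allI impI)
    fix S T
    assume "S \<subseteq> p ` carrier G \<and> openin (gtop G) (p -` S \<inter> carrier G)" "T \<subseteq> p ` carrier G \<and> openin (gtop G) (p -` T \<inter> carrier G)"
    moreover have "p -` (S \<inter> T) \<inter> carrier G = (p -` S \<inter> carrier G) \<inter> (p -` T \<inter> carrier G)" by auto
    ultimately show "S \<inter> T \<subseteq> p ` carrier G \<and> openin (gtop G) (p -` (S \<inter> T) \<inter> carrier G)"
      by (metis le_infI1 openin_Int)
  next
    fix \<K> assume a: "\<forall>U\<in>\<K>. U \<subseteq> p ` carrier G \<and> openin (gtop G) (p -` U \<inter> carrier G)"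
    have "p -` \<Union>\<K> \<inter> carrier G = \<Union>((\<lambda>U. p -` U \<inter> carrier G) ` \<K>)" by auto
    moreover have "openin (gtop G) \<dots>" using a by (intro openin_Union) auto
    ultimately show "\<Union>\<K> \<subseteq> p ` carrier G \<and> openin (gtop G) (p -` \<Union>\<K> \<inter> carrier G)" using a by auto
  qed
  then show ?thesis by (simp add: quo_def)
qed

lemma quo_topspace: "topspace (gtop (quo G p)) = p ` carrier G"
proof -
  have "p -` p ` carrier G \<inter> carrier G = carrier G" by auto
  then have "openin (gtop (quo G p)) (p ` carrier G)"
    using openin_topspace[of "gtop G"] by (simp add: openin_quo)
  moreover have "topspace (gtop (quo G p)) \<subseteq> p ` carrier G" using openin_quo openin_topspace by blast
  ultimately show ?thesis using openin_subset by blast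
qed

lemma quo_continuous: "continuous_map (gtop G) (gtop (quo G p)) p"
proof -
  have "{x \<in> carrier G. p x \<in> U} = p -` U \<inter> carrier G" for U by auto
  then show ?thesis unfolding continuous_map_def quo_topspace by (auto simp: openin_quo)
qed

lemma image_normal_open:
  assumes "N \<lhd> G" "openin (gtop G) N"
  shows "p ` N \<lhd> quo G p" "openin (gtop (quo G p)) (p ` N)"
proof -
  interpret group_hom G "quo G p" p by (rule quo_hom)
  interpret N: normal N G by fact
  show im: "p ` N \<lhd> quo G p" using N.surj_hom_normal_subgroup[OF quo_hom] quo_carrier by simp
  have "openin (gtop G) (p -` (p ` N) \<inter> carrier G)"
  proof (rule open_subgroupI[OF _ assms(2)])
    show "subgroup (p -` (p ` N) \<inter> carrier G) G"
      using normal_imp_subgroup[OF vimage_normal[OF quo_hom im]] .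
    show "N \<noteq> {}" using N.one_closed by blast
    show "N \<subseteq> p -` (p ` N) \<inter> carrier G" using N.subset by auto
  qed
  then show "openin (gtop (quo G p)) (p ` N)" using N.subset by (auto simp: openin_quo)
qed

lemma vimage_image:
  assumes "subgroup N G" "K \<subseteq> N"
  shows "p -` (p ` N) \<inter> carrier G = N"
proof
  show "N \<subseteq> p -` (p ` N) \<inter> carrier G" using subgroup.subset[OF assms(1)] by auto
  show "p -` (p ` N) \<inter> carrier G \<subseteq> N"
  proof
    fix x assume "x \<in> p -` (p ` N) \<inter> carrier G"
    then obtain n where n: "n \<in> N" "p x = p n" and x: "x \<in> carrier G" by auto
    have "n \<in> carrier G" using n subgroup.subset[OF assms(1)] by auto
    then have "x \<otimes> inv n \<in> N" using n x p_eq assms(2) by auto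
    then have "x \<otimes> inv n \<otimes> n \<in> N" using n subgroup.m_closed[OF assms(1)] by simp
    then show "x \<in> N" using x \<open>n \<in> carrier G\<close> by (simp add: m_assoc)
  qed
qed

lemma p_eq_one: "x \<in> carrier G \<Longrightarrow> p x = p \<one> \<longleftrightarrow> x \<in> K"
  using p_eq[of x \<one>] by simp

text \<open>The images of open normal subgroups give the base of cosets. A point other than the
  neutral one is separated by an open normal subgroup over \<open>K\<close>, which is where
  closedness of \<open>K\<close> enters.\<close>

lemma quo_profinite: "profinite_group (quo G p)"
proof (rule profinite_group_of_base[OF quo_group])
  interpret h: group_hom G "quo G p" p by (rule quo_hom)
  show "topspace (gtop (quo G p)) = carrier (quo G p)" by (simp add: quo_topspace quo_carrier)
  have "compactin (gtop (quo G p)) (p ` topspace (gtop G))"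
    using image_compactin[OF _ quo_continuous] compact unfolding compact_space_def by blast
  then show "compact_space (gtop (quo G p))" by (simp add: compact_space_def quo_topspace)
  fix U a assume U: "openin (gtop (quo G p)) U" "a \<in> U"
  then obtain x where x: "x \<in> carrier G" "a = p x" using openin_quo by blast
  obtain N where N: "N \<in> open_normal G" "N #> x \<subseteq> p -` U \<inter> carrier G"
    using open_normal_basis_at[of "p -` U \<inter> carrier G" x] U x openin_quo by auto
  have "p ` N #>\<^bsub>quo G p\<^esub> a \<subseteq> U"
  proof
    fix y assume "y \<in> p ` N #>\<^bsub>quo G p\<^esub> a"
    then obtain n where n: "n \<in> N" "y = p n \<otimes>\<^bsub>quo G p\<^esub> p x" using x by (auto simp: r_coset_def)
    have "n \<in> carrier G" using subsetD[OF normalD(2)[OF open_normalD(1)[OF N(1)]] n(1)] .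
    from n(2) have "y = p (n \<otimes> x)" unfolding quo_mult[OF \<open>n \<in> carrier G\<close> x(1)] .
    moreover have "n \<otimes> x \<in> N #> x" using n(1) by (auto simp: r_coset_def)
    ultimately show "y \<in> U" using N(2) by auto
  qed
  then show "\<exists>N. N \<lhd> quo G p \<and> openin (gtop (quo G p)) N \<and> N #>\<^bsub>quo G p\<^esub> a \<subseteq> U"
    using image_normal_open[OF open_normalD(1,2)[OF N(1)]] by (intro exI[of _ "p ` N"] conjI)
next
  interpret h: group_hom G "quo G p" p by (rule quo_hom)
  fix M a assume M: "M \<lhd> quo G p" "openin (gtop (quo G p)) M" and a: "a \<in> carrier (quo G p)"
  then obtain x where x: "x \<in> carrier G" "a = p x" using quo_carrier by auto
  have Mc: "M \<subseteq> carrier (quo G p)" using h.H.normalD(2)[OF M(1)] .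
  have "p -` (M #>\<^bsub>quo G p\<^esub> a) \<inter> carrier G = (p -` M \<inter> carrier G) #> x"
    using x a Mc by (auto simp: h.H.r_coset_eq_vimage r_coset_eq_vimage)
  moreover have "openin (gtop G) \<dots>" using M x by (intro open_rcos) (auto simp: openin_quo)
  moreover have "M #>\<^bsub>quo G p\<^esub> a \<subseteq> p ` carrier G"
    using h.H.r_coset_subset_G[OF Mc a] quo_carrier by simp
  ultimately show "openin (gtop (quo G p)) (M #>\<^bsub>quo G p\<^esub> a)" by (simp add: openin_quo)
next
  fix a assume a: "a \<in> carrier (quo G p)" "a \<noteq> \<one>\<^bsub>quo G p\<^esub>"
  then obtain x where x: "x \<in> carrier G" "a = p x" using quo_carrier by auto
  then have "x \<notin> K" using a p_eq_one quo_one by auto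
  then obtain N where N: "N \<in> open_normal_over G K" "x \<notin> N"
    using open_normal_over_separates[OF K_normal K_closed x(1)] by blast
  then have Nn: "N \<in> open_normal G" "K \<subseteq> N" by (auto simp: open_normal_over_def)
  have "a \<notin> p ` N" using vimage_image[OF normalD(1)[OF open_normalD(1)[OF Nn(1)]] Nn(2)] x N(2) by auto
  then show "\<exists>N. N \<lhd> quo G p \<and> openin (gtop (quo G p)) N \<and> a \<notin> N"
    using image_normal_open[OF open_normalD(1,2)[OF Nn(1)]] by (intro exI[of _ "p ` N"] conjI)
qed

lemma vimage_open_normal_over:
  assumes "M \<in> open_normal (quo G p)"
  shows "p -` M \<inter> carrier G \<in> open_normal_over G K"
proof -
  interpret h: group_hom G "quo G p" p by (rule quo_hom)
  have "p -` M \<inter> carrier G \<in> open_normal G"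
    using vimage_open_normal[OF profinite_axioms profiniteI[OF quo_profinite] h.homh quo_continuous assms] .
  moreover have "K \<subseteq> p -` M \<inter> carrier G"
  proof
    fix x assume "x \<in> K"
    then have x: "x \<in> carrier G" "p x = p \<one>"
      using subsetD[OF normalD(2)[OF K_normal]] by (simp_all add: p_eq_one del: h.hom_one)
    then show "x \<in> p -` M \<inter> carrier G" using h.H.normalD(3)[of M] assms x by (simp add: open_normal_def)
  qed
  ultimately show ?thesis by (simp add: open_normal_over_def)
qed

lemma quo_factor:
  assumes f: "f \<in> hom G H" and H: "group H" and K1: "\<And>x. x \<in> K \<Longrightarrow> f x = \<one>\<^bsub>H\<^esub>"
  defines "f' \<equiv> \<lambda>a. f (inv_into (carrier G) p a)"
  shows "\<And>x. x \<in> carrier G \<Longrightarrow> f' (p x) = f x" "f' \<in> hom (quo G p) H"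
proof -
  interpret group_hom G H f
    using f H group_axioms by (simp add: group_hom_def group_hom_axioms_def)
  show f': "f' (p x) = f x" if "x \<in> carrier G" for x
  proof -
    let ?y = "inv_into (carrier G) p (p x)"
    have y: "?y \<in> carrier G" "p ?y = p x" using that by (auto simp: inv_into_into f_inv_into_f)
    then have "f (?y \<otimes> inv x) = \<one>\<^bsub>H\<^esub>" using K1 p_eq that by simp
    then have "f ?y \<otimes>\<^bsub>H\<^esub> inv\<^bsub>H\<^esub> (f x) = \<one>\<^bsub>H\<^esub>" using that y by simp
    then have "f ?y = f x" using that y
      by (metis H.inv_equality H.inv_inv H.inv_closed hom_closed)
    then show ?thesis by (simp add: f'_def)
  qed
  show "f' \<in> hom (quo G p) H"
    unfolding hom_def by (auto simp: quo_carrier f' quo_mult)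
qed

end

section \<open>Sorting data\<close>

text \<open>The conditions are detached from the group: a family of subgroups, a subgroup
  \<open>T\<close> in the role of the whole group, and an index function. They then apply both to
  the open normal subgroups of a quotient and to those of \<open>P\<close> over \<open>K\<close>. Of
  condition (ii) only one implication is kept; the other holds because \<open>J\<close> belongs to
  \<open>sqrt_seq J\<close>.\<close>

definition sorting_on ::
    "(nat \<Rightarrow> 'j list \<Rightarrow> 'j list) \<Rightarrow> 'a set set \<Rightarrow> 'a set \<Rightarrow> ('a set \<Rightarrow> nat) \<Rightarrow> ('a set \<Rightarrow> 'j list set) \<Rightarrow> bool" where
  "sorting_on Jsub \<N> T ind F \<longleftrightarrow>
     (\<forall>N\<in>\<N>. F N \<noteq> {} \<and> F N \<subseteq> sort_seqs \<and> (\<forall>J\<in>F N. sqrt_seq J \<subseteq> F N)) \<and> F T = sort_seqs \<and>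
     (\<forall>N1\<in>\<N>. \<forall>N2\<in>\<N>. \<forall>k\<ge>1. \<forall>J\<in>F N1. N1 \<subseteq> N2 \<and> ind N1 \<le> k \<longrightarrow> Jsub k J \<in> F N2) \<and>
     (\<forall>N1\<in>\<N>. \<forall>N2\<in>\<N>. \<forall>J1\<in>F N1. \<forall>J2\<in>F N2. J1 @ J2 \<in> F (N1 \<inter> N2))"

abbreviation index :: "('a, 'b) monoid_scheme \<Rightarrow> 'a set \<Rightarrow> nat" where
  "index G N \<equiv> card (rcosets\<^bsub>G\<^esub> N)"

lemma sorting_onD:
  assumes "sorting_on Jsub \<N> T ind F"
  shows "N \<in> \<N> \<Longrightarrow> F N \<noteq> {}" "N \<in> \<N> \<Longrightarrow> F N \<subseteq> sort_seqs" "N \<in> \<N> \<Longrightarrow> J \<in> F N \<Longrightarrow> sqrt_seq J \<subseteq> F N"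
    "F T = sort_seqs"
    "N1 \<in> \<N> \<Longrightarrow> N2 \<in> \<N> \<Longrightarrow> k \<ge> 1 \<Longrightarrow> J \<in> F N1 \<Longrightarrow> N1 \<subseteq> N2 \<Longrightarrow> ind N1 \<le> k \<Longrightarrow> Jsub k J \<in> F N2"
    "N1 \<in> \<N> \<Longrightarrow> N2 \<in> \<N> \<Longrightarrow> J1 \<in> F N1 \<Longrightarrow> J2 \<in> F N2 \<Longrightarrow> J1 @ J2 \<in> F (N1 \<inter> N2)"
  using assms unfolding sorting_on_def by simp_all

lemma sorting_onI:
  assumes "\<And>N. N \<in> \<N> \<Longrightarrow> F N \<noteq> {}" "\<And>N. N \<in> \<N> \<Longrightarrow> F N \<subseteq> sort_seqs"
    "\<And>N J. N \<in> \<N> \<Longrightarrow> J \<in> F N \<Longrightarrow> sqrt_seq J \<subseteq> F N" "F T = sort_seqs"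
    "\<And>N1 N2 k J. N1 \<in> \<N> \<Longrightarrow> N2 \<in> \<N> \<Longrightarrow> k \<ge> 1 \<Longrightarrow> J \<in> F N1 \<Longrightarrow> N1 \<subseteq> N2 \<Longrightarrow> ind N1 \<le> k \<Longrightarrow> Jsub k J \<in> F N2"
    "\<And>N1 N2 J1 J2. N1 \<in> \<N> \<Longrightarrow> N2 \<in> \<N> \<Longrightarrow> J1 \<in> F N1 \<Longrightarrow> J2 \<in> F N2 \<Longrightarrow> J1 @ J2 \<in> F (N1 \<inter> N2)"
  shows "sorting_on Jsub \<N> T ind F"
  using assms unfolding sorting_on_def by simp

lemma sqrt_seq_self: "J \<in> sort_seqs \<Longrightarrow> J \<in> sqrt_seq J"
  by (simp add: sqrt_seq_def)

lemma sorting_data_iff: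
  "sorting_data Jsub G F \<longleftrightarrow> sorting_on Jsub (open_normal G) (carrier G) (index G) F"
  (is "?L = ?R")
proof
  assume L: ?L
  show ?R
  proof (rule sorting_onI)
    fix N J assume N: "N \<in> open_normal G" "J \<in> F N"
    then have "J \<in> sort_seqs" using L unfolding sorting_data_def by (metis subsetD)
    then show "sqrt_seq J \<subseteq> F N" using L N unfolding sorting_data_def by metis
  qed (use L in \<open>simp_all add: sorting_data_def Jcap_def\<close>)
next
  assume R: ?R
  have "J \<in> F N" if "J \<in> sort_seqs" "sqrt_seq J \<subseteq> F N" for J N
    using that sqrt_seq_self by blast
  then show ?L unfolding sorting_data_def Jcap_def
    by (intro conjI ballI allI impI iffI) (use sorting_onD[OF R] in simp_all)
qed

text \<open>Sorting data travel along any map of subgroups that respects inclusions, intersections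
  and indices; below it is taken to be a preimage, an image, or the preimage under a coset-valued
  lift.\<close>

lemma sorting_on_pull:
  assumes F: "sorting_on Jsub \<N> T ind F"
    and t: "\<And>N. N \<in> \<N>' \<Longrightarrow> t N \<in> \<N>" "t T' = T"
      "\<And>N1 N2. N1 \<in> \<N>' \<Longrightarrow> N2 \<in> \<N>' \<Longrightarrow> N1 \<subseteq> N2 \<Longrightarrow> t N1 \<subseteq> t N2"
      "\<And>N1 N2. N1 \<in> \<N>' \<Longrightarrow> N2 \<in> \<N>' \<Longrightarrow> t (N1 \<inter> N2) = t N1 \<inter> t N2"
      "\<And>N. N \<in> \<N>' \<Longrightarrow> ind (t N) = ind' N"
  shows "sorting_on Jsub \<N>' T' ind' (\<lambda>N. F (t N))"
proof (rule sorting_onI)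
  fix N1 N2 k J
  assume "N1 \<in> \<N>'" "N2 \<in> \<N>'" "k \<ge> 1" "J \<in> F (t N1)" "N1 \<subseteq> N2" "ind' N1 \<le> k"
  then show "Jsub k J \<in> F (t N2)" using sorting_onD(5)[OF F t(1) t(1)] t(3,5) by metis
qed (use t sorting_onD[OF F] in \<open>simp_all\<close>)

text \<open>Only non-emptiness needs an argument: \<open>J @ J'\<close> contains the sorts of
  \<open>J\<close> and of \<open>J'\<close>, so closure under \<open>sqrt_seq\<close> puts it into
  both values.\<close>

lemma sorting_on_Int:
  assumes F: "sorting_on Jsub \<N> T ind F" and F': "sorting_on Jsub \<N> T ind F'"
  shows "sorting_on Jsub \<N> T ind (\<lambda>N. F N \<inter> F' N)"
proof (rule sorting_onI)
  fix N assume N: "N \<in> \<N>"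
  obtain J J' where J: "J \<in> F N" "J' \<in> F' N" using sorting_onD(1)[OF F N] sorting_onD(1)[OF F' N] by auto
  then have "J @ J' \<in> sqrt_seq J" "J @ J' \<in> sqrt_seq J'"
    using sorting_onD(2)[OF F N] by (auto simp: sqrt_seq_def sort_seqs_def)
  then show "F N \<inter> F' N \<noteq> {}" using sorting_onD(3)[OF F N J(1)] sorting_onD(3)[OF F' N J(2)] by auto
qed (use sorting_onD[OF F] sorting_onD[OF F'] in \<open>auto\<close>)

lemma sorting_on_INT:
  assumes "S \<noteq> {}" "\<And>F. F \<in> S \<Longrightarrow> sorting_on Jsub \<N> T ind F" "\<And>N. N \<in> \<N> \<Longrightarrow> (\<Inter>F\<in>S. F N) \<noteq> {}"
  shows "sorting_on Jsub \<N> T ind (\<lambda>N. \<Inter>F\<in>S. F N)"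
proof (rule sorting_onI)
  have "(\<Inter>F\<in>S. F T) = (\<Inter>F\<in>S. sort_seqs)" using sorting_onD(4)[OF assms(2)] by (intro INF_cong) auto
  then show "(\<Inter>F\<in>S. F T) = sort_seqs" using assms(1) by simp
  show "(\<Inter>F\<in>S. F N) \<subseteq> sort_seqs" if N: "N \<in> \<N>" for N
  proof -
    obtain F where "F \<in> S" using assms(1) by auto
    then show ?thesis using sorting_onD(2)[OF assms(2) N] by blast
  qed
  show "sqrt_seq J \<subseteq> (\<Inter>F\<in>S. F N)" if "N \<in> \<N>" "J \<in> (\<Inter>F\<in>S. F N)" for N J
    using sorting_onD(3)[OF assms(2) that(1)] that(2) by (intro INT_greatest) simp
  show "Jsub k J \<in> (\<Inter>F\<in>S. F N2)"
    if "N1 \<in> \<N>" "N2 \<in> \<N>" "k \<ge> 1" "J \<in> (\<Inter>F\<in>S. F N1)" "N1 \<subseteq> N2" "ind N1 \<le> k" for N1 N2 k J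
    using sorting_onD(5)[OF assms(2) that(1-3)] that(4-6) by simp
  show "J1 @ J2 \<in> (\<Inter>F\<in>S. F (N1 \<inter> N2))"
    if "N1 \<in> \<N>" "N2 \<in> \<N>" "J1 \<in> (\<Inter>F\<in>S. F N1)" "J2 \<in> (\<Inter>F\<in>S. F N2)" for N1 N2 J1 J2
    using sorting_onD(6)[OF assms(2) that(1-2)] that(3-4) by simp
qed (rule assms(3))

lemma sorting_on_all:
  assumes "\<forall>k\<ge>1. \<forall>J\<in>sort_seqs. Jsub k J \<in> sort_seqs"
  shows "sorting_on Jsub \<N> T ind (\<lambda>_. sort_seqs)"
  by (rule sorting_onI) (use assms in \<open>auto simp: sort_seqs_def sqrt_seq_def\<close>)

lemma sorting_on_cong:
  assumes "sorting_on Jsub \<N> T ind F" "T \<in> \<N>" "\<And>N. N \<in> \<N> \<Longrightarrow> F' N = F N"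
    "\<And>N M. N \<in> \<N> \<Longrightarrow> M \<in> \<N> \<Longrightarrow> N \<inter> M \<in> \<N>"
  shows "sorting_on Jsub \<N> T ind F'"
  by (rule sorting_onI) (use sorting_onD[OF assms(1)] assms(2-) in simp_all)

lemma sorting_on_vimage:
  assumes F: "sorting_on Jsub \<N> (carrier G) (index G) F" and f: "group_hom G H f" "f ` carrier G = carrier H"
    and v: "\<And>M. M \<in> open_normal H \<Longrightarrow> f -` M \<inter> carrier G \<in> \<N>"
  shows "sorting_on Jsub (open_normal H) (carrier H) (index H) (\<lambda>M. F (f -` M \<inter> carrier G))"
proof (rule sorting_on_pull[OF F])
  show "f -` carrier H \<inter> carrier G = carrier G" using f(2) by auto
  show "index G (f -` M \<inter> carrier G) = index H M" if "M \<in> open_normal H" for M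
    using that by (intro card_rcosets_vimage[OF f]) (simp_all add: open_normal_def normal_imp_subgroup)
qed (use v in auto)

lemma sorted_morphismD:
  assumes "sorted_morphism G1 F1 G2 F2 f"
  shows "f \<in> hom G1 G2" "continuous_map (gtop G1) (gtop G2) f" "f ` carrier G1 = carrier G2"
    "\<And>x. x \<in> carrier G1 \<Longrightarrow> f x \<in> carrier G2"
    "\<And>x y. x \<in> carrier G1 \<Longrightarrow> y \<in> carrier G1 \<Longrightarrow> f (x \<otimes>\<^bsub>G1\<^esub> y) = f x \<otimes>\<^bsub>G2\<^esub> f y"
    "\<And>N. N \<in> open_normal G2 \<Longrightarrow> F2 N \<subseteq> F1 (f -` N \<inter> carrier G1)"
  using assms by (auto simp: sorted_morphism_def hom_def)

text \<open>Continuity is traded for openness of the preimages of open normal subgroups, the form in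
  which morphisms are built below.\<close>

lemma sorted_morphism_iff:
  assumes "profinite G1" "profinite G2"
  shows "sorted_morphism G1 F1 G2 F2 f \<longleftrightarrow> f \<in> hom G1 G2 \<and> f ` carrier G1 = carrier G2 \<and>
    (\<forall>M\<in>open_normal G2. f -` M \<inter> carrier G1 \<in> open_normal G1 \<and> F2 M \<subseteq> F1 (f -` M \<inter> carrier G1))"
proof -
  have "continuous_map (gtop G1) (gtop G2) f"
    if "f \<in> hom G1 G2" "\<forall>M\<in>open_normal G2. f -` M \<inter> carrier G1 \<in> open_normal G1"
    using continuous_homI[OF assms that(1)] that(2) by (simp add: open_normal_def)
  moreover have "f -` M \<inter> carrier G1 \<in> open_normal G1"
    if "f \<in> hom G1 G2" "continuous_map (gtop G1) (gtop G2) f" "M \<in> open_normal G2" for M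
    using vimage_open_normal[OF assms that] .
  ultimately show ?thesis unfolding sorted_morphism_def by blast
qed

lemma sorted_morphism_comp:
  assumes f: "sorted_morphism G1 F1 G2 F2 f" and g: "sorted_morphism G2 F2 G3 F3 g"
    and pro: "profinite G2" "profinite G3"
  shows "sorted_morphism G1 F1 G3 F3 (\<lambda>x. g (f x))"
  unfolding sorted_morphism_def
proof (intro conjI ballI)
  note fD = sorted_morphismD[OF f] and gD = sorted_morphismD[OF g]
  show "(\<lambda>x. g (f x)) \<in> hom G1 G3" using fD gD by (auto simp: hom_def)
  show "continuous_map (gtop G1) (gtop G3) (\<lambda>x. g (f x))"
    using continuous_map_compose[OF fD(2) gD(2)] by (simp add: o_def)
  show "(\<lambda>x. g (f x)) ` carrier G1 = carrier G3" using fD(3) gD(3) by (simp add: image_image[symmetric])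
  fix N assume N: "N \<in> open_normal G3"
  have "g -` N \<inter> carrier G2 \<in> open_normal G2" using vimage_open_normal[OF pro gD(1,2) N] .
  then have "F2 (g -` N \<inter> carrier G2) \<subseteq> F1 (f -` (g -` N \<inter> carrier G2) \<inter> carrier G1)" by (rule fD(6))
  moreover have "f -` (g -` N \<inter> carrier G2) \<inter> carrier G1 = (\<lambda>x. g (f x)) -` N \<inter> carrier G1" using fD(4) by auto
  ultimately show "F3 N \<subseteq> F1 ((\<lambda>x. g (f x)) -` N \<inter> carrier G1)" using gD(6)[OF N] by simp
qed

section \<open>Sorted quotients described inside the group\<close>

text \<open>
  Sorting data on the quotient of \<open>P\<close> by \<open>K\<close>, indexed by the open normal subgroups of \<open>P\<close>
  that contain \<open>K\<close>. The value is normalised to be empty elsewhere, so that pairs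
  \<open>(K, \<Phi>)\<close> are partially ordered.
\<close>

definition rel_sorting ::
    "(nat \<Rightarrow> 'j list \<Rightarrow> 'j list) \<Rightarrow> 'a tgroup \<Rightarrow> 'a set \<Rightarrow> ('a set \<Rightarrow> 'j list set) \<Rightarrow> bool" where
  "rel_sorting Jsub P K \<Phi> \<longleftrightarrow> K \<lhd> P \<and> closedin (gtop P) K \<and>
     sorting_on Jsub (open_normal_over P K) (carrier P) (index P) \<Phi> \<and>
     (\<forall>N. N \<notin> open_normal_over P K \<longrightarrow> \<Phi> N = {})"

text \<open>A morphism out of \<open>P/K\<close>, written as a map on \<open>P\<close> that is
  trivial on \<open>K\<close>. No carrier for the quotient has to be chosen, and
  \<open>\<Phi>\<close> is evaluated at preimages taken in \<open>P\<close>.\<close>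

definition rel_morphism ::
    "'a tgroup \<Rightarrow> 'a set \<Rightarrow> ('a set \<Rightarrow> 'j list set) \<Rightarrow> 'b tgroup \<Rightarrow> ('b set \<Rightarrow> 'j list set) \<Rightarrow> ('a \<Rightarrow> 'b) \<Rightarrow> bool" where
  "rel_morphism P K \<Phi> B FB \<phi> \<longleftrightarrow>
     \<phi> \<in> hom P B \<and> \<phi> ` carrier P = carrier B \<and> (\<forall>x\<in>K. \<phi> x = \<one>\<^bsub>B\<^esub>) \<and>
     (\<forall>M\<in>open_normal B. \<phi> -` M \<inter> carrier P \<in> open_normal P \<and> FB M \<subseteq> \<Phi> (\<phi> -` M \<inter> carrier P))"

lemma rel_morphismD:
  assumes "rel_morphism P K \<Phi> B FB \<phi>"
  shows "\<phi> \<in> hom P B" "\<phi> ` carrier P = carrier B" "\<And>x. x \<in> K \<Longrightarrow> \<phi> x = \<one>\<^bsub>B\<^esub>"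
    "\<And>M. M \<in> open_normal B \<Longrightarrow> \<phi> -` M \<inter> carrier P \<in> open_normal P"
    "\<And>M. M \<in> open_normal B \<Longrightarrow> FB M \<subseteq> \<Phi> (\<phi> -` M \<inter> carrier P)"
    "\<And>x. x \<in> carrier P \<Longrightarrow> \<phi> x \<in> carrier B"
  using assms by (auto simp: rel_morphism_def)

context coset_map
begin

lemma quo_sorted:
  assumes "sorting_on Jsub (open_normal_over G K) (carrier G) (index G) \<Phi>"
  shows "sorted_profinite Jsub (quo G p) (\<lambda>M. \<Phi> (p -` M \<inter> carrier G))"
proof -
  have "sorting_on Jsub (open_normal (quo G p)) (carrier (quo G p)) (index (quo G p)) (\<lambda>M. \<Phi> (p -` M \<inter> carrier G))"
    by (rule sorting_on_vimage[OF assms quo_hom quo_carrier[symmetric] vimage_open_normal_over])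
  then show ?thesis using quo_profinite by (simp add: sorted_profinite_def sorting_data_iff)
qed

lemma rel_morphism_quo:
  assumes "rel_morphism G K \<Phi> B FB \<phi>" "profinite B"
  defines "f \<equiv> \<lambda>a. \<phi> (inv_into (carrier G) p a)"
  shows "sorted_morphism (quo G p) (\<lambda>M. \<Phi> (p -` M \<inter> carrier G)) B FB f"
    "\<And>x. x \<in> carrier G \<Longrightarrow> f (p x) = \<phi> x"
proof -
  interpret B: profinite B by fact
  note D = rel_morphismD[OF assms(1)]
  note fac = quo_factor[OF D(1) B.group_axioms D(3), folded f_def]
  show fp: "f (p x) = \<phi> x" if "x \<in> carrier G" for x using fac(1)[OF _ that] by (simp add: f_def)
  have v: "p -` (f -` M \<inter> carrier (quo G p)) \<inter> carrier G = \<phi> -` M \<inter> carrier G" for M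
  proof (rule Set.set_eqI)
    fix x show "x \<in> p -` (f -` M \<inter> carrier (quo G p)) \<inter> carrier G \<longleftrightarrow> x \<in> \<phi> -` M \<inter> carrier G"
      by (cases "x \<in> carrier G") (simp_all add: fp quo_carrier)
  qed
  show "sorted_morphism (quo G p) (\<lambda>M. \<Phi> (p -` M \<inter> carrier G)) B FB f"
    unfolding sorted_morphism_iff[OF profiniteI[OF quo_profinite] assms(2)]
  proof (intro conjI ballI)
    show fh: "f \<in> hom (quo G p) B" using fac(2) by simp
    show "f ` carrier (quo G p) = carrier B" using fp D(2) by (simp add: quo_carrier image_image cong: image_cong)
    fix M assume M: "M \<in> open_normal B"
    have "group_hom (quo G p) B f" using fh quo_group B.group_axioms
      by (simp add: group_hom_def group_hom_axioms_def)
    then have "f -` M \<inter> carrier (quo G p) \<lhd> quo G p"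
      by (rule vimage_normal) (rule B.open_normalD(1)[OF M])
    moreover have "openin (gtop (quo G p)) (f -` M \<inter> carrier (quo G p))"
      unfolding openin_quo v using D(4)[OF M] by (auto simp: open_normal_def quo_carrier)
    ultimately show "f -` M \<inter> carrier (quo G p) \<in> open_normal (quo G p)" by (simp add: open_normal_def)
    show "FB M \<subseteq> \<Phi> (p -` (f -` M \<inter> carrier (quo G p)) \<inter> carrier G)"
      unfolding v using D(5)[OF M] .
  qed
qed

lemma sorted_morphism_quo:
  assumes "sorted_morphism (quo G p) (\<lambda>M. \<Phi> (p -` M \<inter> carrier G)) B FB f" "profinite B"
  shows "rel_morphism G K \<Phi> B FB (\<lambda>x. f (p x))"
  unfolding rel_morphism_def
proof (intro conjI ballI)
  interpret h: group_hom G "quo G p" p by (rule quo_hom)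
  interpret B: profinite B by fact
  note D = sorted_morphismD[OF assms(1)]
  interpret f: group_hom "quo G p" B f using D(1) by unfold_locales
  show "(\<lambda>x. f (p x)) \<in> hom G B" using D(1,4) by (auto simp: hom_def)
  show "(\<lambda>x. f (p x)) ` carrier G = carrier B" using D(3) by (simp add: quo_carrier image_image)
  show "f (p x) = \<one>\<^bsub>B\<^esub>" if "x \<in> K" for x
  proof -
    have "x \<in> carrier G" using that subsetD[OF normalD(2)[OF K_normal]] by simp
    then have "p x = \<one>\<^bsub>quo G p\<^esub>" using that by (simp add: p_eq_one quo_one del: h.hom_one)
    then show ?thesis by simp
  qed
  fix M assume M: "M \<in> open_normal B"
  have v: "p -` (f -` M \<inter> carrier (quo G p)) \<inter> carrier G = (\<lambda>x. f (p x)) -` M \<inter> carrier G"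
    by (auto simp: quo_carrier)
  have "f -` M \<inter> carrier (quo G p) \<in> open_normal (quo G p)"
    using vimage_open_normal[OF profiniteI[OF quo_profinite] assms(2) D(1,2) M] .
  from vimage_open_normal_over[OF this] show "(\<lambda>x. f (p x)) -` M \<inter> carrier G \<in> open_normal G"
    unfolding v by (simp add: open_normal_over_def)
  show "FB M \<subseteq> \<Phi> ((\<lambda>x. f (p x)) -` M \<inter> carrier G)" using D(6)[OF M] unfolding v .
qed

end

section \<open>Lifts to quotients and embedding problems\<close>

text \<open>A morphism from \<open>E\<close> to \<open>P/K\<close> whose values are the cosets of \<open>K\<close> themselves.\<close>

definition rel_lift ::
    "'c tgroup \<Rightarrow> ('c set \<Rightarrow> 'j list set) \<Rightarrow> 'a tgroup \<Rightarrow> 'a set \<Rightarrow> ('a set \<Rightarrow> 'j list set) \<Rightarrow> ('c \<Rightarrow> 'a set) \<Rightarrow> bool" where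
  "rel_lift E FE P K \<Phi> q \<longleftrightarrow>
     (\<forall>e\<in>carrier E. \<exists>x\<in>carrier P. q e = K #>\<^bsub>P\<^esub> x) \<and>
     (\<forall>e\<in>carrier E. \<forall>e'\<in>carrier E. \<forall>x\<in>q e. \<forall>x'\<in>q e'. x \<otimes>\<^bsub>P\<^esub> x' \<in> q (e \<otimes>\<^bsub>E\<^esub> e')) \<and>
     (\<forall>x\<in>carrier P. \<exists>e\<in>carrier E. x \<in> q e) \<and>
     (\<forall>N\<in>open_normal_over P K. {e \<in> carrier E. q e \<subseteq> N} \<in> open_normal E \<and>
        \<Phi> N \<subseteq> FE {e \<in> carrier E. q e \<subseteq> N})"

locale lift = P: profinite P + E: profinite E
  for P :: "'a tgroup" and E :: "'c tgroup" +
  fixes K :: "'a set" and FE :: "'c set \<Rightarrow> 'j list set" and \<Phi> :: "'a set \<Rightarrow> 'j list set" and q :: "'c \<Rightarrow> 'a set"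
  assumes K_normal: "K \<lhd> P" and K_closed: "closedin (gtop P) K" and lift: "rel_lift E FE P K \<Phi> q"
begin

lemma K_subset: "K \<subseteq> carrier P" and K_subgroup: "subgroup K P"
  using P.normalD[OF K_normal] by auto

lemma q_mult: "e \<in> carrier E \<Longrightarrow> e' \<in> carrier E \<Longrightarrow> x \<in> q e \<Longrightarrow> x' \<in> q e' \<Longrightarrow> x \<otimes>\<^bsub>P\<^esub> x' \<in> q (e \<otimes>\<^bsub>E\<^esub> e')"
  and q_onto: "x \<in> carrier P \<Longrightarrow> \<exists>e\<in>carrier E. x \<in> q e"
  and q_open: "N \<in> open_normal_over P K \<Longrightarrow> {e \<in> carrier E. q e \<subseteq> N} \<in> open_normal E"
  and q_sort: "N \<in> open_normal_over P K \<Longrightarrow> \<Phi> N \<subseteq> FE {e \<in> carrier E. q e \<subseteq> N}"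
  using lift unfolding rel_lift_def by simp_all

lemma q_mem:
  assumes "e \<in> carrier E" "x \<in> q e"
  shows "x \<in> carrier P" "q e = K #>\<^bsub>P\<^esub> x"
proof -
  obtain y where y: "y \<in> carrier P" "q e = K #>\<^bsub>P\<^esub> y" using lift assms(1) unfolding rel_lift_def by auto
  show "x \<in> carrier P" using y assms P.mem_rcos_iff[OF K_subgroup y(1)] by auto
  show "q e = K #>\<^bsub>P\<^esub> x" using y assms P.repr_independence[OF _ y(1) K_subgroup] by auto
qed

lemma q_ex: "e \<in> carrier E \<Longrightarrow> \<exists>x. x \<in> q e"
  using lift P.rcos_self[OF _ K_subgroup] unfolding rel_lift_def by metis

lemma q_one: "q \<one>\<^bsub>E\<^esub> = K"
proof -
  obtain x where x: "x \<in> q \<one>\<^bsub>E\<^esub>" using q_ex E.one_closed by auto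
  note xq = q_mem[OF E.one_closed x]
  have "x \<otimes>\<^bsub>P\<^esub> x \<in> q \<one>\<^bsub>E\<^esub>" using q_mult[OF _ _ x x] by simp
  then have "x \<otimes>\<^bsub>P\<^esub> x \<otimes>\<^bsub>P\<^esub> inv\<^bsub>P\<^esub> x \<in> K" using xq P.mem_rcos_iff[OF K_subgroup xq(1)] by auto
  then have "x \<in> K" using xq by (simp add: P.m_assoc)
  then show ?thesis using xq P.coset_join2[OF xq(1) K_subgroup] by simp
qed

lemma q_inv: 
  assumes e: "e \<in> carrier E" and x: "x \<in> q e"
  shows "inv\<^bsub>P\<^esub> x \<in> q (inv\<^bsub>E\<^esub> e)"
proof -
  obtain y where y: "y \<in> q (inv\<^bsub>E\<^esub> e)" using q_ex e by auto
  note yq = q_mem[OF _ y] and xP = q_mem(1)[OF e x]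
  have "y \<otimes>\<^bsub>P\<^esub> x \<in> K" using q_mult[OF _ e y x] e q_one by simp
  then have "K #>\<^bsub>P\<^esub> y = K #>\<^bsub>P\<^esub> inv\<^bsub>P\<^esub> x"
    using e yq xP P.rcos_eq_iff[OF K_subgroup] by simp
  then show ?thesis using e yq xP P.rcos_self[OF _ K_subgroup] by simp
qed

lemma q_subset_iff:
  assumes "N \<in> open_normal_over P K" "e \<in> carrier E" "x \<in> q e"
  shows "q e \<subseteq> N \<longleftrightarrow> x \<in> N"
proof
  have N: "subgroup N P" "K \<subseteq> N"
    using assms(1) by (auto simp: open_normal_over_def open_normal_def normal_imp_subgroup)
  assume "x \<in> N"
  then show "q e \<subseteq> N"
    using q_mem[OF assms(2,3)] N subgroup.m_closed[OF N(1)] by (auto simp: r_coset_def)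
qed (use assms in auto)

lemma q_eq_K:
  assumes "e \<in> carrier E" "\<one>\<^bsub>P\<^esub> \<in> q e"
  shows "q e = K"
  using q_mem[OF assms] K_subset by simp

text \<open>The composite of \<open>q\<close> with the map induced by \<open>f\<close> on
  \<open>P/K\<close>; any element of the coset may be used once \<open>f\<close> is trivial on
  \<open>K\<close>.\<close>

definition along :: "('a \<Rightarrow> 'b) \<Rightarrow> 'c \<Rightarrow> 'b" where
  "along f e = f (SOME x. x \<in> q e)"

lemma along_eq:
  assumes "group B" "f \<in> hom P B" "\<And>x. x \<in> K \<Longrightarrow> f x = \<one>\<^bsub>B\<^esub>" and e: "e \<in> carrier E" and x: "x \<in> q e"
  shows "along f e = f x"
proof -
  interpret f: group_hom P B f using assms P.group_axioms
    by (simp add: group_hom_def group_hom_axioms_def)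
  let ?y = "SOME x. x \<in> q e"
  have y: "?y \<in> q e" using x by (rule someI)
  note yP = q_mem(1)[OF e y] and xP = q_mem[OF e x]
  have "?y \<otimes>\<^bsub>P\<^esub> inv\<^bsub>P\<^esub> x \<in> K" using y xP P.mem_rcos_iff[OF K_subgroup xP(1)] by simp
  then have "f ?y \<otimes>\<^bsub>B\<^esub> inv\<^bsub>B\<^esub> (f x) = \<one>\<^bsub>B\<^esub>" using assms(3) yP xP f.hom_mult f.hom_inv by (metis P.inv_closed)
  then have "f ?y = f x" using f.hom_closed[OF yP] f.hom_closed[OF xP(1)]
    by (metis f.H.inv_equality f.H.inv_inv f.H.inv_closed)
  then show ?thesis by (simp add: along_def)
qed

lemma sorted_morphism_along:
  assumes \<phi>: "rel_morphism P K \<Phi> B FB \<phi>" and "profinite B"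
  shows "sorted_morphism E FE B FB (along \<phi>)"
    "\<And>e x. e \<in> carrier E \<Longrightarrow> x \<in> q e \<Longrightarrow> along \<phi> e = \<phi> x"
proof -
  interpret B: profinite B by fact
  note D = rel_morphismD[OF \<phi>]
  interpret f: group_hom P B \<phi> using D(1) by unfold_locales
  show al: "along \<phi> e = \<phi> x" if "e \<in> carrier E" "x \<in> q e" for e x
    using along_eq[OF B.group_axioms D(1) D(3) that] .
  show "sorted_morphism E FE B FB (along \<phi>)"
    unfolding sorted_morphism_iff[OF E.profinite_axioms assms(2)]
  proof (intro conjI ballI)
    have cl: "along \<phi> e \<in> carrier B" if "e \<in> carrier E" for e
      using q_ex[OF that] al[OF that] q_mem(1)[OF that] by auto
    moreover have "along \<phi> (e \<otimes>\<^bsub>E\<^esub> e') = along \<phi> e \<otimes>\<^bsub>B\<^esub> along \<phi> e'"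
      if ee: "e \<in> carrier E" "e' \<in> carrier E" for e e'
    proof -
      obtain x x' where x: "x \<in> q e" "x' \<in> q e'" using q_ex ee by blast
      have "along \<phi> (e \<otimes>\<^bsub>E\<^esub> e') = \<phi> (x \<otimes>\<^bsub>P\<^esub> x')" using ee by (intro al q_mult x) auto
      also have "\<dots> = \<phi> x \<otimes>\<^bsub>B\<^esub> \<phi> x'" using q_mem(1) x ee by simp
      finally show ?thesis using al x ee by simp
    qed
    ultimately show "along \<phi> \<in> hom E B" by (auto simp: hom_def)
    show "along \<phi> ` carrier E = carrier B"
    proof
      show "along \<phi> ` carrier E \<subseteq> carrier B" using cl by auto
      show "carrier B \<subseteq> along \<phi> ` carrier E"
      proof
        fix b assume "b \<in> carrier B"
        then obtain x where x: "x \<in> carrier P" "b = \<phi> x" using D(2) by auto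
        then obtain e where "e \<in> carrier E" "x \<in> q e" using q_onto by auto
        then show "b \<in> along \<phi> ` carrier E" using al x by (intro image_eqI[of _ _ e]) simp_all
      qed
    qed
    fix M assume M: "M \<in> open_normal B"
    let ?N = "\<phi> -` M \<inter> carrier P"
    have N: "?N \<in> open_normal_over P K"
      using D(3) D(4)[OF M] M K_subset B.normalD(3)[of M] by (auto simp: open_normal_over_def open_normal_def)
    have "along \<phi> -` M \<inter> carrier E = {e \<in> carrier E. q e \<subseteq> ?N}"
    proof (rule Set.set_eqI)
      fix e
      show "e \<in> along \<phi> -` M \<inter> carrier E \<longleftrightarrow> e \<in> {e \<in> carrier E. q e \<subseteq> ?N}"
      proof (cases "e \<in> carrier E")
        case True
        then obtain x where x: "x \<in> q e" using q_ex by blast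
        show ?thesis using True al[OF True x] q_subset_iff[OF N True x] q_mem(1)[OF True x] by simp
      qed simp
    qed
    then show "along \<phi> -` M \<inter> carrier E \<in> open_normal E" "FB M \<subseteq> FE (along \<phi> -` M \<inter> carrier E)"
      using q_open[OF N] q_sort[OF N] D(5)[OF M] by auto
  qed
qed

text \<open>The data of \<open>E\<close>, pushed to \<open>P/K\<close> along \<open>q\<close>, are
  the competitor against which the least data on a fibre product will be measured.\<close>

lemma sorting_on_along:
  assumes "sorting_data Jsub E FE"
  shows "sorting_on Jsub (open_normal_over P K) (carrier P) (index P) (\<lambda>N. FE {e \<in> carrier E. q e \<subseteq> N})"
proof (rule sorting_on_pull[OF assms[unfolded sorting_data_iff]])
  show "{e \<in> carrier E. q e \<subseteq> carrier P} = carrier E" using q_mem by auto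
  fix N assume N: "N \<in> open_normal_over P K"
  have Ns: "subgroup N P"
    using N by (auto simp: open_normal_over_def open_normal_def normal_imp_subgroup)
  show "{e \<in> carrier E. q e \<subseteq> N} \<in> open_normal E" by (rule q_open[OF N])
  \<comment> \<open>Representatives of the values of \<open>q\<close>: multiplicative only modulo
    \<open>K\<close>, which suffices to compare indices.\<close>
  define r where "r e = (SOME x. x \<in> q e)" for e
  have r: "r e \<in> q e" if "e \<in> carrier E" for e
    unfolding r_def using q_ex[OF that] by (rule someI_ex)
  note rP = q_mem(1)[OF _ r]
  show "index E {e \<in> carrier E. q e \<subseteq> N} = index P N"
  proof (rule card_rcosets_eq[where r = r])
    show "subgroup {e \<in> carrier E. q e \<subseteq> N} E"
      using q_open[OF N] by (auto simp: open_normal_def normal_imp_subgroup)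
    show "x \<otimes>\<^bsub>E\<^esub> inv\<^bsub>E\<^esub> y \<in> {e \<in> carrier E. q e \<subseteq> N} \<longleftrightarrow> r x \<otimes>\<^bsub>P\<^esub> inv\<^bsub>P\<^esub> r y \<in> N"
      if "x \<in> carrier E" "y \<in> carrier E" for x y
    proof -
      have "r x \<otimes>\<^bsub>P\<^esub> inv\<^bsub>P\<^esub> r y \<in> q (x \<otimes>\<^bsub>E\<^esub> inv\<^bsub>E\<^esub> y)"
        using that r q_inv by (intro q_mult) auto
      then show ?thesis using that q_subset_iff[OF N] by simp
    qed
    show "\<exists>x\<in>carrier E. r x \<otimes>\<^bsub>P\<^esub> inv\<^bsub>P\<^esub> z \<in> N" if z: "z \<in> carrier P" for z
    proof -
      obtain e where e: "e \<in> carrier E" "z \<in> q e" using q_onto[OF z] by auto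
      have "r e \<otimes>\<^bsub>P\<^esub> inv\<^bsub>P\<^esub> z \<in> K"
        using q_mem(2)[OF e] r[OF e(1)] P.mem_rcos_iff[OF K_subgroup z] by simp
      then show ?thesis using e N by (auto simp: open_normal_over_def)
    qed
  qed (use Ns rP P.group_axioms E.group_axioms in auto)
qed auto

text \<open>The kernel of \<open>q\<close> is the intersection of the closed preimages of the open
  normal subgroups over \<open>K\<close>, so compactness of \<open>E\<close> applies. This converts
  openness in \<open>E\<close> into openness in \<open>P/K\<close>.\<close>

lemma kernel_within:
  assumes U: "openin (gtop E) U" "{e \<in> carrier E. q e = K} \<subseteq> U"
  shows "\<exists>N\<in>open_normal_over P K. {e \<in> carrier E. q e \<subseteq> N} \<subseteq> U"
proof -
  let ?C = "(\<lambda>N. {e \<in> carrier E. q e \<subseteq> N}) ` open_normal_over P K"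
  have "\<exists>C\<in>?C. C \<subseteq> U"
  proof (rule compact_space_directed[OF E.compact])
    have cP: "carrier P \<in> open_normal_over P K" using P.carrier_open_normal_over[OF K_normal] .
    show "?C \<noteq> {}" using cP by auto
    show "closedin (gtop E) C" if "C \<in> ?C" for C
      using that q_open E.open_normalD(3) by auto
    show "\<exists>C\<in>?C. C \<subseteq> A \<inter> B" if AB: "A \<in> ?C" "B \<in> ?C" for A B
    proof -
      obtain N M where NM: "N \<in> open_normal_over P K" "M \<in> open_normal_over P K"
        "A = {e \<in> carrier E. q e \<subseteq> N}" "B = {e \<in> carrier E. q e \<subseteq> M}"
        using AB by blast
      have "{e \<in> carrier E. q e \<subseteq> N \<inter> M} \<in> ?C" using P.open_normal_over_Int[OF NM(1,2)] by (rule imageI)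
      moreover have "{e \<in> carrier E. q e \<subseteq> N \<inter> M} \<subseteq> A \<inter> B" using NM by auto
      ultimately show ?thesis by (rule rev_bexI)
    qed
    show "\<Inter>?C \<subseteq> U"
    proof
      fix e assume e: "e \<in> \<Inter>?C"
      then have eE: "e \<in> carrier E" using cP by blast
      obtain x where x: "x \<in> q e" using q_ex[OF eE] by auto
      have "x \<in> K"
      proof (rule ccontr)
        assume "x \<notin> K"
        then obtain N where N: "N \<in> open_normal_over P K" "x \<notin> N"
          using P.open_normal_over_separates[OF K_normal K_closed q_mem(1)[OF eE x]] by auto
        then have "q e \<subseteq> N" using e by blast
        then show False using N x by auto
      qed
      then have "q e = K" using q_mem[OF eE x] P.coset_join2[OF _ K_subgroup] by simp
      then show "e \<in> U" using eE U by auto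
    qed
  qed (use U in auto)
  then show ?thesis by auto
qed

end

section \<open>Embedding problems and minimal kernels\<close>

text \<open>The last conjunct says that \<open>A\<close> is a quotient of \<open>P/K\<close>, as
  membership in \<open>SIm\<close> requires; for \<open>B\<close> the map \<open>\<phi>\<close> says
  so. Both groups live on \<open>nat\<close> to match \<open>SIm\<close>.\<close>

definition embedding_problem ::
    "(nat \<Rightarrow> 'j list \<Rightarrow> 'j list) \<Rightarrow> 'a tgroup \<Rightarrow> 'a set \<Rightarrow> ('a set \<Rightarrow> 'j list set) \<Rightarrow>
     nat tgroup \<Rightarrow> (nat set \<Rightarrow> 'j list set) \<Rightarrow> nat tgroup \<Rightarrow> (nat set \<Rightarrow> 'j list set) \<Rightarrow>
     (nat \<Rightarrow> nat) \<Rightarrow> ('a \<Rightarrow> nat) \<Rightarrow> bool" where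
  "embedding_problem Jsub P K \<Phi> A FA B FB \<pi> \<phi> \<longleftrightarrow>
     sorted_profinite Jsub A FA \<and> finite (carrier A) \<and> sorted_profinite Jsub B FB \<and> finite (carrier B) \<and>
     sorted_morphism A FA B FB \<pi> \<and> rel_morphism P K \<Phi> B FB \<phi> \<and> (\<exists>\<alpha>. rel_morphism P K \<Phi> A FA \<alpha>)"

definition solvable ::
    "'a tgroup \<Rightarrow> 'a set \<Rightarrow> ('a set \<Rightarrow> 'j list set) \<Rightarrow>
     nat tgroup \<Rightarrow> (nat set \<Rightarrow> 'j list set) \<Rightarrow> (nat \<Rightarrow> nat) \<Rightarrow> ('a \<Rightarrow> nat) \<Rightarrow> bool" where
  "solvable P K \<Phi> A FA \<pi> \<phi> \<longleftrightarrow> (\<exists>\<psi>. rel_morphism P K \<Phi> A FA \<psi> \<and> (\<forall>x\<in>carrier P. \<pi> (\<psi> x) = \<phi> x))"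

definition minimal_unsolvable where
  "minimal_unsolvable Jsub P K \<Phi> A FA B FB \<pi> \<phi> \<longleftrightarrow>
     embedding_problem Jsub P K \<Phi> A FA B FB \<pi> \<phi> \<and> \<not> solvable P K \<Phi> A FA \<pi> \<phi> \<and>
     (\<forall>A' FA' B' FB' \<pi>' \<phi>'. embedding_problem Jsub P K \<Phi> A' FA' B' FB' \<pi>' \<phi>' \<and>
        card {a \<in> carrier A'. \<pi>' a = \<one>\<^bsub>B'\<^esub>} < card {a \<in> carrier A. \<pi> a = \<one>\<^bsub>B\<^esub>} \<longrightarrow>
        solvable P K \<Phi> A' FA' \<pi>' \<phi>')"

lemma SEPD:
  fixes A B :: "nat tgroup"
  assumes "SEP Jsub G F" "sorted_profinite Jsub A FA" "finite (carrier A)" "sorted_profinite Jsub B FB" "finite (carrier B)"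
    "sorted_morphism G F A FA \<alpha>" "sorted_morphism G F B FB \<phi>" "sorted_morphism A FA B FB \<pi>"
  shows "\<exists>\<psi>. sorted_morphism G F A FA \<psi> \<and> (\<forall>x\<in>carrier G. \<pi> (\<psi> x) = \<phi> x)"
proof -
  have "(A, FA) \<in> SIm Jsub G F" "(B, FB) \<in> SIm Jsub G F" using assms by (auto simp: SIm_def)
  then show ?thesis using assms(1,7,8) unfolding SEP_def by blast
qed

text \<open>Least elements of cosets serve as representatives, so a quotient of a finite group on
  \<open>nat\<close> is again a group on \<open>nat\<close> and may occur in an embedding
  problem.\<close>

lemma ex_coset_map:
  fixes A :: "'a :: wellorder tgroup"
  assumes "profinite A" "K \<lhd> A" "closedin (gtop A) K"
  shows "\<exists>c :: 'a \<Rightarrow> 'a. coset_map A K c"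
proof -
  interpret A: profinite A by fact
  note Ks = A.normalD(1)[OF assms(2)]
  define c where "c a = (LEAST b. b \<in> K #>\<^bsub>A\<^esub> a)" for a
  have c: "c a \<in> K #>\<^bsub>A\<^esub> a" if "a \<in> carrier A" for a
    unfolding c_def using A.rcos_self[OF that Ks] by (rule LeastI)
  have "c x = c y \<longleftrightarrow> x \<otimes>\<^bsub>A\<^esub> inv\<^bsub>A\<^esub> y \<in> K" if xy: "x \<in> carrier A" "y \<in> carrier A" for x y
  proof -
    have "c x = c y \<longleftrightarrow> K #>\<^bsub>A\<^esub> x = K #>\<^bsub>A\<^esub> y"
      using c[OF xy(1)] c[OF xy(2)] A.repr_independence[OF _ _ Ks] xy unfolding c_def by metis
    then show ?thesis using A.rcos_eq_iff[OF Ks xy] by simp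
  qed
  then have "coset_map A K c" using assms by (simp add: coset_map_def coset_map_axioms_def)
  then show ?thesis by blast
qed

lemma finite_profinite_discrete:
  assumes "profinite A" "finite (carrier A)" "U \<subseteq> carrier A"
  shows "openin (gtop A) U" "closedin (gtop A) U"
proof -
  interpret A: profinite A by fact
  have "gtop A = discrete_topology (carrier A)"
    using finite_t1_space_imp_discrete_topology[of "gtop A"] A.Hausdorff assms(2) Hausdorff_imp_t1_space by auto
  then show "openin (gtop A) U" "closedin (gtop A) U" using assms(3) by simp_all
qed

lemma sorted_profiniteD:
  assumes "sorted_profinite Jsub G F"
  shows "profinite G" "sorting_on Jsub (open_normal G) (carrier G) (index G) F" "sorting_data Jsub G F"
  using assms by (auto simp: sorted_profinite_def sorting_data_iff profiniteI)

lemma rel_sortingD: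
  assumes "rel_sorting Jsub P K \<Phi>"
  shows "K \<lhd> P" "closedin (gtop P) K" "sorting_on Jsub (open_normal_over P K) (carrier P) (index P) \<Phi>"
    "\<And>N. N \<notin> open_normal_over P K \<Longrightarrow> \<Phi> N = {}"
  using assms by (auto simp: rel_sorting_def)

lemma embedding_problemD:
  assumes "embedding_problem Jsub P K \<Phi> A FA B FB \<pi> \<phi>"
  shows "sorted_profinite Jsub A FA" "finite (carrier A)" "sorted_profinite Jsub B FB" "finite (carrier B)"
    "sorted_morphism A FA B FB \<pi>" "rel_morphism P K \<Phi> B FB \<phi>" "\<exists>\<alpha>. rel_morphism P K \<Phi> A FA \<alpha>"
  using assms by (auto simp: embedding_problem_def)

text \<open>
  By Goursat's lemma the image of a solution \<open>\<psi>\<close> over \<open>E\<close> in the fibre product of \<open>P/K\<close> and \<open>A\<close>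
  over \<open>B\<close> is a fibre product over some quotient \<open>C\<close> of \<open>A\<close> lying over \<open>B\<close>. With the intersection of the
  sorting data coming from \<open>A\<close> and from \<open>P/K\<close>, the pair \<open>A \<rightarrow> C\<close>, \<open>P/K \<rightarrow> C\<close> is an embedding problem
  that is unsolvable as well, so minimality of the kernel forces \<open>C = B\<close>.
\<close>

lemma minimal_unsolvable_full:
  fixes E :: "'c tgroup" and P :: "'a tgroup"
  assumes P: "profinite P" and rs: "rel_sorting Jsub P K \<Phi>"
    and min: "minimal_unsolvable Jsub P K \<Phi> A FA B FB \<pi> \<phi>"
    and E: "sorted_profinite Jsub E FE" "SEP Jsub E FE" and q: "rel_lift E FE P K \<Phi> q"
  shows "\<exists>\<psi>. sorted_morphism E FE A FA \<psi> \<and>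
    (\<forall>e\<in>carrier E. \<forall>x\<in>q e. \<pi> (\<psi> e) = \<phi> x) \<and>
    (\<forall>x\<in>carrier P. \<forall>a\<in>carrier A. \<phi> x = \<pi> a \<longrightarrow> (\<exists>e\<in>carrier E. x \<in> q e \<and> \<psi> e = a))"
proof -
  interpret P: profinite P by fact
  note rsD = rel_sortingD[OF rs]
  have prob: "embedding_problem Jsub P K \<Phi> A FA B FB \<pi> \<phi>" and unsolv: "\<not> solvable P K \<Phi> A FA \<pi> \<phi>"
    using min by (auto simp: minimal_unsolvable_def)
  note pD = embedding_problemD[OF prob]
  obtain \<alpha> where \<alpha>: "rel_morphism P K \<Phi> A FA \<alpha>" using pD(7) by auto
  interpret A: profinite A using sorted_profiniteD(1)[OF pD(1)] .
  interpret B: profinite B using sorted_profiniteD(1)[OF pD(3)] .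
  interpret E: profinite E using sorted_profiniteD(1)[OF E(1)] .
  interpret L: lift P E K FE \<Phi> q
    using rsD(1,2) q by (simp add: lift_def lift_axioms_def P E.profinite_axioms)
  note \<pi> = sorted_morphismD[OF pD(5)]
  interpret \<pi>: group_hom A B \<pi> using \<pi>(1) by unfold_locales
  note \<phi> = rel_morphismD[OF pD(6)]
  interpret \<phi>: group_hom P B \<phi> using \<phi>(1) by unfold_locales
  note al\<phi> = L.sorted_morphism_along[OF pD(6) B.profinite_axioms]
  note al\<alpha> = L.sorted_morphism_along[OF \<alpha> A.profinite_axioms]
  \<comment> \<open>SEP of \<open>E\<close> solves the problem pulled back along \<open>q\<close>;
    the composite with \<open>\<alpha>\<close> shows that \<open>A\<close> is a quotient of
    \<open>E\<close>.\<close>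
  obtain \<psi> where \<psi>: "sorted_morphism E FE A FA \<psi>" and \<psi>\<phi>: "\<forall>e\<in>carrier E. \<pi> (\<psi> e) = L.along \<phi> e"
    using SEPD[OF E(2) pD(1-4) al\<alpha>(1) al\<phi>(1) pD(5)] by blast
  note \<psi>D = sorted_morphismD[OF \<psi>]
  interpret \<psi>: group_hom E A \<psi> using \<psi>D(1) by unfold_locales
  have lift: "\<pi> (\<psi> e) = \<phi> x" if "e \<in> carrier E" "x \<in> q e" for e x
    using \<psi>\<phi> al\<phi>(2)[OF that] that by simp
  define ker where "ker = {a \<in> carrier A. \<pi> a = \<one>\<^bsub>B\<^esub>}"
  \<comment> \<open>\<open>K0\<close> is the part of the image of \<open>E\<close> in the fibre
    product that lies over the neutral element of \<open>P/K\<close>; the image is everything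
    exactly if \<open>K0\<close> is the whole kernel.\<close>
  define K0 where "K0 = \<psi> ` {e \<in> carrier E. q e = K}"
  have oneK: "\<one>\<^bsub>P\<^esub> \<in> K" using P.normalD(3)[OF rsD(1)] .
  have K0_ker: "K0 \<subseteq> ker"
    unfolding K0_def ker_def using lift[OF _, of _ "\<one>\<^bsub>P\<^esub>"] oneK by auto
  show ?thesis
  proof (cases "K0 = ker")
    case True
    have "\<exists>e\<in>carrier E. x \<in> q e \<and> \<psi> e = a" if xa: "x \<in> carrier P" "a \<in> carrier A" "\<phi> x = \<pi> a" for x a
    proof -
      \<comment> \<open>Any \<open>e0\<close> over \<open>x\<close> can be corrected by an element
        of the kernel of \<open>q\<close>, because \<open>\<psi>\<close> maps that kernel onto the
        kernel of \<open>\<pi>\<close>.\<close>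
      obtain e0 where e0: "e0 \<in> carrier E" "x \<in> q e0" using L.q_onto[OF xa(1)] by auto
      have p0: "\<psi> e0 \<in> carrier A" using e0 by simp
      have "\<pi> (inv\<^bsub>A\<^esub> \<psi> e0 \<otimes>\<^bsub>A\<^esub> a) = \<one>\<^bsub>B\<^esub>" using lift[OF e0] xa p0 by simp
      then have "inv\<^bsub>A\<^esub> \<psi> e0 \<otimes>\<^bsub>A\<^esub> a \<in> K0" using xa p0 unfolding True ker_def by simp
      then obtain e1 where e1: "e1 \<in> carrier E" "q e1 = K" "\<psi> e1 = inv\<^bsub>A\<^esub> \<psi> e0 \<otimes>\<^bsub>A\<^esub> a"
        unfolding K0_def by auto
      have "\<psi> (e0 \<otimes>\<^bsub>E\<^esub> e1) = a" using e0 e1 p0 xa by (simp add: A.inv_cancel)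
      moreover have "x \<otimes>\<^bsub>P\<^esub> \<one>\<^bsub>P\<^esub> \<in> q (e0 \<otimes>\<^bsub>E\<^esub> e1)" using e0 e1 oneK by (intro L.q_mult) auto
      ultimately show ?thesis using e0 e1 xa by (intro bexI[of _ "e0 \<otimes>\<^bsub>E\<^esub> e1"]) auto
    qed
    then show ?thesis using \<psi> lift by (intro exI[of _ \<psi>]) simp
  next
    case False
    have kerq: "{e \<in> carrier E. q e = K} \<lhd> E"
      unfolding E.normal_inv_iff
    proof (intro conjI ballI)
      have qK: "q e = K \<longleftrightarrow> \<one>\<^bsub>P\<^esub> \<in> q e" if "e \<in> carrier E" for e
        using L.q_eq_K[OF that] oneK by auto
      show "subgroup {e \<in> carrier E. q e = K} E"
      proof (rule E.subgroupI)
        show "{e \<in> carrier E. q e = K} \<noteq> {}" using L.q_one by (auto intro: exI[of _ "\<one>\<^bsub>E\<^esub>"])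
        show "inv\<^bsub>E\<^esub> e \<in> {e \<in> carrier E. q e = K}" if "e \<in> {e \<in> carrier E. q e = K}" for e
          using that L.q_inv[of e "\<one>\<^bsub>P\<^esub>"] qK by auto
        show "e \<otimes>\<^bsub>E\<^esub> e' \<in> {e \<in> carrier E. q e = K}"
          if "e \<in> {e \<in> carrier E. q e = K}" "e' \<in> {e \<in> carrier E. q e = K}" for e e'
          using that L.q_mult[of e e' "\<one>\<^bsub>P\<^esub>" "\<one>\<^bsub>P\<^esub>"] qK by auto
      qed auto
      fix g h assume g: "g \<in> carrier E" "h \<in> {e \<in> carrier E. q e = K}"
      obtain x where x: "x \<in> q g" using L.q_ex[OF g(1)] by auto
      have "x \<otimes>\<^bsub>P\<^esub> \<one>\<^bsub>P\<^esub> \<otimes>\<^bsub>P\<^esub> inv\<^bsub>P\<^esub> x \<in> q (g \<otimes>\<^bsub>E\<^esub> h \<otimes>\<^bsub>E\<^esub> inv\<^bsub>E\<^esub> g)"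
        using g x oneK by (intro L.q_mult L.q_inv) auto
      then show "g \<otimes>\<^bsub>E\<^esub> h \<otimes>\<^bsub>E\<^esub> inv\<^bsub>E\<^esub> g \<in> {e \<in> carrier E. q e = K}"
        using qK g L.q_mem(1)[OF g(1) x] by simp
    qed
    have K0n: "K0 \<lhd> A"
      unfolding K0_def using normal.surj_hom_normal_subgroup[OF kerq \<psi>.group_hom_axioms \<psi>D(3)] .
    have K0c: "K0 \<subseteq> carrier A" using K0_ker by (auto simp: ker_def)
    obtain c :: "nat \<Rightarrow> nat" where "coset_map A K0 c"
      using ex_coset_map[OF A.profinite_axioms K0n finite_profinite_discrete(2)[OF A.profinite_axioms pD(2) K0c]] by auto
    then interpret c: coset_map A K0 c .
    let ?C = "quo A c"
    interpret ch: group_hom A ?C c using c.quo_hom .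
    have proC: "profinite ?C" using profiniteI[OF c.quo_profinite] .
    interpret C: profinite ?C by fact
    \<comment> \<open>The map from \<open>P/K\<close> to \<open>A/K0\<close> induced by
      \<open>\<psi>\<close>: two elements of \<open>E\<close> over the same coset differ by the
      kernel of \<open>q\<close>, which \<open>\<psi>\<close> sends into \<open>K0\<close>.\<close>
    define \<gamma> where "\<gamma> x = c (\<psi> (SOME e. e \<in> carrier E \<and> x \<in> q e))" for x
    have ceq: "c (\<psi> e) = c (\<psi> e')" if e: "e \<in> carrier E" "e' \<in> carrier E" "x \<in> q e" "x \<in> q e'" for e e' x
    proof -
      have "x \<otimes>\<^bsub>P\<^esub> inv\<^bsub>P\<^esub> x \<in> q (e \<otimes>\<^bsub>E\<^esub> inv\<^bsub>E\<^esub> e')" using e by (intro L.q_mult L.q_inv) auto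
      then have "q (e \<otimes>\<^bsub>E\<^esub> inv\<^bsub>E\<^esub> e') = K" using e L.q_mem(1) L.q_eq_K by simp
      then have "\<psi> (e \<otimes>\<^bsub>E\<^esub> inv\<^bsub>E\<^esub> e') \<in> K0" using e unfolding K0_def by (intro imageI) auto
      then show ?thesis using e c.p_eq by simp
    qed
    have \<gamma>: "\<gamma> x = c (\<psi> e)" if e: "e \<in> carrier E" "x \<in> q e" for e x
    proof -
      have "(SOME e. e \<in> carrier E \<and> x \<in> q e) \<in> carrier E \<and> x \<in> q (SOME e. e \<in> carrier E \<and> x \<in> q e)"
        using e by (intro someI[of "\<lambda>e. e \<in> carrier E \<and> x \<in> q e"]) auto
      then show ?thesis unfolding \<gamma>_def using e ceq by blast
    qed
    have \<gamma>hom: "\<gamma> \<in> hom P ?C"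
    proof (rule homI)
      show "\<gamma> x \<in> carrier ?C" if "x \<in> carrier P" for x
        using L.q_onto[OF that] \<gamma> by auto
      fix x y assume xy: "x \<in> carrier P" "y \<in> carrier P"
      obtain e e' where e: "e \<in> carrier E" "e' \<in> carrier E" "x \<in> q e" "y \<in> q e'"
        using L.q_onto[OF xy(1)] L.q_onto[OF xy(2)] by auto
      have "\<gamma> (x \<otimes>\<^bsub>P\<^esub> y) = c (\<psi> (e \<otimes>\<^bsub>E\<^esub> e'))" using e by (intro \<gamma> L.q_mult) auto
      then show "\<gamma> (x \<otimes>\<^bsub>P\<^esub> y) = \<gamma> x \<otimes>\<^bsub>?C\<^esub> \<gamma> y" using e \<gamma> by simp
    qed
    interpret \<gamma>h: group_hom P ?C \<gamma> using \<gamma>hom by unfold_locales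
    have \<gamma>onto: "\<gamma> ` carrier P = carrier ?C"
    proof
      show "carrier ?C \<subseteq> \<gamma> ` carrier P"
      proof
        fix z assume "z \<in> carrier ?C"
        then obtain a where a: "a \<in> carrier A" "z = c a" by (auto simp: c.quo_carrier)
        obtain e where e: "e \<in> carrier E" "\<psi> e = a" using a(1) \<psi>D(3) by (metis imageE)
        obtain x where x: "x \<in> q e" using L.q_ex[OF e(1)] by auto
        then show "z \<in> \<gamma> ` carrier P" using a e \<gamma>[OF e(1) x] L.q_mem(1)[OF e(1) x] by (metis imageI)
      qed
    qed auto
    have \<gamma>K: "\<gamma> x = \<one>\<^bsub>?C\<^esub>" if "x \<in> K" for x
      using \<gamma>[of "\<one>\<^bsub>E\<^esub>" x] that L.q_one by simp
    have \<gamma>open: "\<gamma> -` M \<inter> carrier P \<in> open_normal_over P K" if M: "M \<in> open_normal ?C" for M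
    proof -
      note Mn = C.open_normalD[OF M]
      have n: "\<gamma> -` M \<inter> carrier P \<lhd> P" using vimage_normal[OF \<gamma>h.group_hom_axioms Mn(1)] .
      have sub: "K \<subseteq> \<gamma> -` M \<inter> carrier P"
        using \<gamma>K ch.H.normalD(3)[OF Mn(1)] L.K_subset by auto
      have cM: "c -` M \<inter> carrier A \<in> open_normal A"
        using c.vimage_open_normal_over[OF M] by (simp add: open_normal_over_def)
      \<comment> \<open>Openness is available only in \<open>E\<close>. This open set contains the
        kernel of \<open>q\<close>, hence the preimage of some open normal subgroup over
        \<open>K\<close>.\<close>
      let ?U = "\<psi> -` (c -` M \<inter> carrier A) \<inter> carrier E"
      have "?U \<in> open_normal E"
        using vimage_open_normal[OF E.profinite_axioms A.profinite_axioms \<psi>D(1,2) cM] .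
      then have "openin (gtop E) ?U" by (simp add: open_normal_def)
      moreover have "{e \<in> carrier E. q e = K} \<subseteq> ?U"
      proof
        fix e assume e: "e \<in> {e \<in> carrier E. q e = K}"
        then have "c (\<psi> e) = \<one>\<^bsub>?C\<^esub>" using \<gamma>[of e "\<one>\<^bsub>P\<^esub>"] oneK \<gamma>K by simp
        then have "c (\<psi> e) \<in> M" using ch.H.normalD(3)[OF Mn(1)] by metis
        then show "e \<in> ?U" using e by simp
      qed
      ultimately have "\<exists>N\<in>open_normal_over P K. {e \<in> carrier E. q e \<subseteq> N} \<subseteq> ?U"
        by (rule L.kernel_within)
      then obtain N where N: "N \<in> open_normal_over P K" "{e \<in> carrier E. q e \<subseteq> N} \<subseteq> ?U" by auto
      have Nn: "N \<in> open_normal P" using N(1) by (simp add: open_normal_over_def)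
      have "N \<subseteq> \<gamma> -` M \<inter> carrier P"
      proof
        fix x assume x: "x \<in> N"
        then have xP: "x \<in> carrier P" using P.normalD(2)[OF P.open_normalD(1)[OF Nn]] by auto
        then obtain e where e: "e \<in> carrier E" "x \<in> q e" using L.q_onto by auto
        then have "e \<in> {e \<in> carrier E. q e \<subseteq> N}" using L.q_subset_iff[OF N(1) e] x by simp
        then have "e \<in> ?U" using N(2) by (rule rev_subsetD)
        then show "x \<in> \<gamma> -` M \<inter> carrier P" using \<gamma>[OF e] xP by simp
      qed
      moreover have "N \<noteq> {}" using P.normalD(3)[OF P.open_normalD(1)[OF Nn]] by auto
      ultimately show ?thesis
        using P.open_normalI[OF n P.open_normalD(2)[OF Nn]] sub by (simp add: open_normal_over_def)
    qed
    \<comment> \<open>The largest choice for which both \<open>c\<close> and \<open>\<gamma>\<close>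
      are morphisms.\<close>
    define FC where "FC M = FA (c -` M \<inter> carrier A) \<inter> \<Phi> (\<gamma> -` M \<inter> carrier P)" for M
    have cont_c: "c -` M \<inter> carrier A \<in> open_normal A" if "M \<in> open_normal ?C" for M
      using c.vimage_open_normal_over[OF that] by (simp add: open_normal_over_def)
    have sC: "sorted_profinite Jsub ?C FC"
      unfolding sorted_profinite_def sorting_data_iff FC_def
      using c.quo_profinite
        sorting_on_Int[OF sorting_on_vimage[OF sorted_profiniteD(2)[OF pD(1)] ch.group_hom_axioms c.quo_carrier[symmetric] cont_c]
          sorting_on_vimage[OF rsD(3) \<gamma>h.group_hom_axioms \<gamma>onto \<gamma>open]]
      by simp
    have mc: "sorted_morphism A FA ?C FC c"
      unfolding sorted_morphism_iff[OF A.profinite_axioms proC]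
      using ch.homh c.quo_carrier cont_c by (auto simp: FC_def)
    have m\<gamma>: "rel_morphism P K \<Phi> ?C FC \<gamma>"
      unfolding rel_morphism_def
      using \<gamma>hom \<gamma>onto \<gamma>K \<gamma>open by (auto simp: FC_def open_normal_over_def)
    have probC: "embedding_problem Jsub P K \<Phi> A FA ?C FC c \<gamma>"
      unfolding embedding_problem_def using pD(1,2) sC mc m\<gamma> \<alpha> by (auto simp: c.quo_carrier)
    have "{a \<in> carrier A. c a = \<one>\<^bsub>?C\<^esub>} = K0"
      using K0c c.p_eq_one by (auto simp: c.quo_one simp del: ch.hom_one)
    moreover have "card K0 < card ker"
      using K0_ker False pD(2) by (intro psubset_card_mono) (auto simp: ker_def)
    ultimately have "card {a \<in> carrier A. c a = \<one>\<^bsub>?C\<^esub>} < card ker" by simp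
    with probC have "solvable P K \<Phi> A FA c \<gamma>"
      unfolding ker_def
      by (intro min[unfolded minimal_unsolvable_def, THEN conjunct2, THEN conjunct2, rule_format] conjI)
    then obtain \<psi>' where \<psi>': "rel_morphism P K \<Phi> A FA \<psi>'" "\<forall>x\<in>carrier P. c (\<psi>' x) = \<gamma> x"
      unfolding solvable_def by auto
    \<comment> \<open>\<open>\<psi>' x\<close> and \<open>\<psi> e\<close> agree modulo
      \<open>K0\<close>, which lies in the kernel of \<open>\<pi>\<close>; so the solution over the
      larger quotient of \<open>A\<close> also solves the original problem.\<close>
    have "\<pi> (\<psi>' x) = \<phi> x" if x: "x \<in> carrier P" for x
    proof -
      obtain e where e: "e \<in> carrier E" "x \<in> q e" using L.q_onto[OF x] by auto
      have a: "\<psi>' x \<in> carrier A" "\<psi> e \<in> carrier A" using rel_morphismD(6)[OF \<psi>'(1) x] e by auto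
      have "c (\<psi>' x) = c (\<psi> e)" using \<psi>'(2) x \<gamma>[OF e] by simp
      then have "\<psi>' x \<otimes>\<^bsub>A\<^esub> inv\<^bsub>A\<^esub> \<psi> e \<in> ker" using c.p_eq[OF a] subsetD[OF K0_ker] by metis
      then have "\<pi> (\<psi>' x) \<otimes>\<^bsub>B\<^esub> inv\<^bsub>B\<^esub> (\<pi> (\<psi> e)) = \<one>\<^bsub>B\<^esub>" using a by (simp add: ker_def)
      then have "\<pi> (\<psi>' x) = \<pi> (\<psi> e)" using \<pi>.hom_closed[OF a(1)] \<pi>.hom_closed[OF a(2)]
        by (metis B.inv_equality B.inv_inv B.inv_closed)
      then show ?thesis using lift[OF e] by simp
    qed
    then have "solvable P K \<Phi> A FA \<pi> \<phi>"
      unfolding solvable_def using \<psi>'(1) by (intro exI[of _ \<psi>']) simp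
    then show ?thesis using unsolv by simp
  qed
qed

definition rel_SEP where
  "rel_SEP Jsub P K \<Phi> \<longleftrightarrow>
     (\<forall>A FA B FB \<pi> \<phi>. embedding_problem Jsub P K \<Phi> A FA B FB \<pi> \<phi> \<longrightarrow> solvable P K \<Phi> A FA \<pi> \<phi>)"

lemma ex_minimal_unsolvable:
  assumes "\<not> rel_SEP Jsub P K \<Phi>"
  shows "\<exists>A FA B FB \<pi> \<phi>. minimal_unsolvable Jsub P K \<Phi> A FA B FB \<pi> \<phi>"
proof -
  define Q where "Q n \<longleftrightarrow> (\<exists>A FA B FB \<pi> \<phi>. embedding_problem Jsub P K \<Phi> A FA B FB \<pi> \<phi> \<and>
    \<not> solvable P K \<Phi> A FA \<pi> \<phi> \<and> n = card {a \<in> carrier A. \<pi> a = \<one>\<^bsub>B\<^esub>})" for n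
  have "\<exists>n. Q n" using assms unfolding rel_SEP_def Q_def by blast
  then obtain n where n: "Q n" "\<And>m. m < n \<Longrightarrow> \<not> Q m" using exists_least_iff[of Q] by auto
  obtain A FA B FB \<pi> \<phi> where *: "embedding_problem Jsub P K \<Phi> A FA B FB \<pi> \<phi>"
    "\<not> solvable P K \<Phi> A FA \<pi> \<phi>" "n = card {a \<in> carrier A. \<pi> a = \<one>\<^bsub>B\<^esub>}"
    using n(1) unfolding Q_def by blast
  have "minimal_unsolvable Jsub P K \<Phi> A FA B FB \<pi> \<phi>"
    unfolding minimal_unsolvable_def using * n(2) unfolding Q_def by blast
  then show ?thesis by blast
qed

lemma (in group) mult_inv_eq_one_iff:
  "a \<in> carrier G \<Longrightarrow> b \<in> carrier G \<Longrightarrow> a \<otimes> inv b = \<one> \<longleftrightarrow> a = b"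
  by (metis inv_equality inv_inv inv_closed r_inv)

section \<open>The fibre product step\<close>

text \<open>The data on \<open>P/K'\<close> for which the maps to \<open>P/K\<close> and to
  \<open>A\<close> are both morphisms.\<close>

definition sorting_above where
  "sorting_above Jsub P K' \<Phi> A FA \<psi> \<Theta> \<longleftrightarrow>
     sorting_on Jsub (open_normal_over P K') (carrier P) (index P) \<Theta> \<and> (\<forall>N. \<Phi> N \<subseteq> \<Theta> N) \<and>
     (\<forall>M\<in>open_normal A. FA M \<subseteq> \<Theta> (\<psi> -` M \<inter> carrier P))"

text \<open>Leastness is the universal property of the fibre product on the side of the sorting: a
  map from \<open>E\<close> into it is a morphism as soon as its two components are. The empty
  default value is the normalisation of \<open>rel_sorting\<close>.\<close>

definition least_sorting where
  "least_sorting Jsub P K' \<Phi> A FA \<psi> N =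
     (if N \<in> open_normal_over P K' then \<Inter>\<Theta>\<in>{\<Theta>. sorting_above Jsub P K' \<Phi> A FA \<psi> \<Theta>}. \<Theta> N else {})"

text \<open>The danger is that the intersection of all competing data is empty. By compactness every
  \<open>N\<close> over \<open>K'\<close> contains \<open>N1 \<inter> k0\<close> with
  \<open>N1\<close> over \<open>K\<close>; conditions (iv) and (iii), applied to an element of
  \<open>\<Phi> N1\<close> and an element of the value of \<open>FA\<close> at the trivial subgroup,
  give an element that lies in all competing values at \<open>N\<close>.\<close>

lemma least_sorting:
  fixes P :: "'a tgroup" and A :: "'b tgroup"
  assumes Jok: "\<forall>k\<ge>1. \<forall>J\<in>sort_seqs. Jsub k J \<in> sort_seqs"
    and P: "profinite P" and rs: "rel_sorting Jsub P K \<Phi>"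
    and A: "sorted_profinite Jsub A FA" "finite (carrier A)"
    and \<psi>: "sorted_morphism P F A FA \<psi>" and K': "K' = K \<inter> (\<psi> -` {\<one>\<^bsub>A\<^esub>} \<inter> carrier P)"
  shows "rel_sorting Jsub P K' (least_sorting Jsub P K' \<Phi> A FA \<psi>)"
    "\<Phi> N \<subseteq> least_sorting Jsub P K' \<Phi> A FA \<psi> N"
    "M \<in> open_normal A \<Longrightarrow> FA M \<subseteq> least_sorting Jsub P K' \<Phi> A FA \<psi> (\<psi> -` M \<inter> carrier P)"
    "sorting_above Jsub P K' \<Phi> A FA \<psi> \<Theta> \<Longrightarrow> least_sorting Jsub P K' \<Phi> A FA \<psi> N \<subseteq> \<Theta> N"
proof -
  interpret P: profinite P by fact
  interpret A: profinite A using sorted_profiniteD(1)[OF A(1)] .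
  note \<psi>D = sorted_morphismD[OF \<psi>]
  interpret \<psi>: group_hom P A \<psi> using \<psi>D(1) by unfold_locales
  note rsD = rel_sortingD[OF rs]
  let ?T = "{\<Theta>. sorting_above Jsub P K' \<Phi> A FA \<psi> \<Theta>}"
  let ?L = "least_sorting Jsub P K' \<Phi> A FA \<psi>"
  define k0 where "k0 = \<psi> -` {\<one>\<^bsub>A\<^esub>} \<inter> carrier P"
  have one: "{\<one>\<^bsub>A\<^esub>} \<in> open_normal A"
    using A.one_is_normal finite_profinite_discrete(1)[OF A.profinite_axioms A(2), of "{\<one>\<^bsub>A\<^esub>}"]
    by (simp add: open_normal_def)
  have v: "\<psi> -` M \<inter> carrier P \<in> open_normal P" if "M \<in> open_normal A" for M
    using vimage_open_normal[OF P A.profinite_axioms \<psi>D(1,2) that] .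
  have k0: "k0 \<in> open_normal P" using v[OF one] by (simp add: k0_def)
  have K'k: "K' = K \<inter> k0" using K' by (simp add: k0_def)
  have K'n: "K' \<lhd> P" unfolding K'k by (intro P.normal_subgroup_intersect rsD(1) P.open_normalD(1)[OF k0])
  have K'c: "closedin (gtop P) K'" unfolding K'k by (intro closedin_Int rsD(2) P.open_normalD(3)[OF k0])
  have ovK: "N \<in> open_normal_over P K'" if "N \<in> open_normal_over P K" for N
    using that K'k by (auto simp: open_normal_over_def)
  have ovk: "\<psi> -` M \<inter> carrier P \<in> open_normal_over P K'" if M: "M \<in> open_normal A" for M
    using v[OF M] A.normalD(3)[OF A.open_normalD(1)[OF M]] K' by (auto simp: open_normal_over_def)
  have sA: "sorting_on Jsub (open_normal A) (carrier A) (index A) FA" using sorted_profiniteD(2)[OF A(1)] .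
  \<comment> \<open>The constant data compete, so the intersection is over a non-empty family; this
    uses that \<open>Jsub\<close> maps into \<open>sort_seqs\<close>.\<close>
  have "sorting_above Jsub P K' \<Phi> A FA \<psi> (\<lambda>_. sort_seqs)"
    unfolding sorting_above_def
  proof (intro conjI ballI allI)
    show "sorting_on Jsub (open_normal_over P K') (carrier P) (index P) (\<lambda>_. sort_seqs)"
      by (rule sorting_on_all) (rule Jok)
    show "\<Phi> N \<subseteq> sort_seqs" for N
      using sorting_onD(2)[OF rsD(3)] rsD(4) by (cases "N \<in> open_normal_over P K") auto
  qed (use sorting_onD(2)[OF sA] in auto)
  then have T: "?T \<noteq> {}" by auto
  show L4: "?L N \<subseteq> \<Theta> N" if "sorting_above Jsub P K' \<Phi> A FA \<psi> \<Theta>" for \<Theta> N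
    using that by (auto simp: least_sorting_def)
  show "?L N \<supseteq> \<Phi> N" for N
    using rsD(4)[of N] ovK[of N]
    by (cases "N \<in> open_normal_over P K") (simp_all add: least_sorting_def sorting_above_def le_INF_iff)
  show "FA M \<subseteq> ?L (\<psi> -` M \<inter> carrier P)" if "M \<in> open_normal A" for M
    using ovk[OF that] that by (simp add: least_sorting_def sorting_above_def le_INF_iff)
  have "sorting_on Jsub (open_normal_over P K') (carrier P) (index P) (\<lambda>N. \<Inter>\<Theta>\<in>?T. \<Theta> N)"
  proof (rule sorting_on_INT[OF T])
    fix N assume N: "N \<in> open_normal_over P K'"
    have No: "openin (gtop P) N" "K \<inter> k0 \<subseteq> N"
      using N K'k by (auto simp: open_normal_over_def open_normal_def)
    obtain N1 where N1: "N1 \<in> open_normal_over P K" "N1 \<inter> k0 \<subseteq> N"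
      using P.open_normal_over_within[OF rsD(1,2) P.open_normalD(3)[OF k0] No] by auto
    obtain J1 where J1: "J1 \<in> \<Phi> N1" using sorting_onD(1)[OF rsD(3) N1(1)] by auto
    obtain J2 where J2: "J2 \<in> FA {\<one>\<^bsub>A\<^esub>}" using sorting_onD(1)[OF sA one] by auto
    \<comment> \<open>\<open>Suc\<close> makes the bound on the index positive, as condition (iii)
      asks.\<close>
    have "Jsub (Suc (index P (N1 \<inter> k0))) (J1 @ J2) \<in> \<Theta> N" if "\<Theta> \<in> ?T" for \<Theta>
    proof -
      have \<Theta>: "sorting_on Jsub (open_normal_over P K') (carrier P) (index P) \<Theta>" "J1 \<in> \<Theta> N1" "J2 \<in> \<Theta> k0"
        using that J1 J2 one by (auto simp: sorting_above_def k0_def)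
      have k0': "k0 \<in> open_normal_over P K'" using ovk[OF one] by (simp add: k0_def)
      have "J1 @ J2 \<in> \<Theta> (N1 \<inter> k0)" using sorting_onD(6)[OF \<Theta>(1) ovK[OF N1(1)] k0' \<Theta>(2,3)] .
      then show ?thesis
        by (intro sorting_onD(5)[OF \<Theta>(1) P.open_normal_over_Int[OF ovK[OF N1(1)] k0'] N _ _ N1(2)]) auto
    qed
    then show "(\<Inter>\<Theta>\<in>?T. \<Theta> N) \<noteq> {}" by blast
  qed (simp add: sorting_above_def)
  then have "sorting_on Jsub (open_normal_over P K') (carrier P) (index P) ?L"
  proof (rule sorting_on_cong)
    show "carrier P \<in> open_normal_over P K'" using P.carrier_open_normal_over[OF K'n] .
  qed (auto simp: least_sorting_def intro: P.open_normal_over_Int)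
  then show "rel_sorting Jsub P K' ?L"
    using K'n K'c by (simp add: rel_sorting_def least_sorting_def)
qed

text \<open>\<open>y\<close> is the fibre product of \<open>P/K\<close> and \<open>A\<close> over
  \<open>B\<close>, realised as the quotient of \<open>P\<close> by the intersection of
  \<open>K\<close> with the kernel of \<open>\<psi>\<close>; the condition on \<open>z\<close> and
  \<open>a\<close> says that \<open>P\<close> maps onto it.\<close>

definition extension_step ::
    "(nat \<Rightarrow> 'j list \<Rightarrow> 'j list) \<Rightarrow> 'a tgroup \<Rightarrow> 'a set \<times> ('a set \<Rightarrow> 'j list set) \<Rightarrow>
     'a set \<times> ('a set \<Rightarrow> 'j list set) \<Rightarrow> bool" where
  "extension_step Jsub P x y \<longleftrightarrow>
     (\<exists>A FA B FB \<pi> \<phi> \<psi>. minimal_unsolvable Jsub P (fst x) (snd x) A FA B FB \<pi> \<phi> \<and>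
        sorted_morphism P (\<lambda>_. sort_seqs) A FA \<psi> \<and> (\<forall>z\<in>carrier P. \<pi> (\<psi> z) = \<phi> z) \<and>
        (\<forall>z\<in>carrier P. \<forall>a\<in>carrier A. \<phi> z = \<pi> a \<longrightarrow> (\<exists>w\<in>carrier P. z \<in> fst x #>\<^bsub>P\<^esub> w \<and> \<psi> w = a)) \<and>
        fst y = fst x \<inter> (\<psi> -` {\<one>\<^bsub>A\<^esub>} \<inter> carrier P) \<and>
        snd y = least_sorting Jsub P (fst y) (snd x) A FA \<psi>)"

text \<open>The projection of \<open>P\<close> is a lift for every \<open>\<Phi>\<close>, because
  \<open>P\<close> carries the largest data. The analysis of solutions over \<open>E\<close> thus
  applies to \<open>E = P\<close>, where it produces the next quotient.\<close>

lemma canonical_lift: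
  fixes P :: "'a tgroup"
  assumes P: "profinite P" and rs: "rel_sorting Jsub P K \<Phi>"
  shows "rel_lift P (\<lambda>_. sort_seqs) P K \<Phi> (\<lambda>x. K #>\<^bsub>P\<^esub> x)"
proof -
  interpret P: profinite P by fact
  note rsD = rel_sortingD[OF rs]
  interpret K: normal K P by (rule rsD(1))
  have Ks: "subgroup K P" using P.normalD(1)[OF rsD(1)] .
  show ?thesis
    unfolding rel_lift_def
  proof (intro conjI ballI)
    show "x \<otimes>\<^bsub>P\<^esub> x' \<in> K #>\<^bsub>P\<^esub> (e \<otimes>\<^bsub>P\<^esub> e')"
      if "e \<in> carrier P" "e' \<in> carrier P" "x \<in> K #>\<^bsub>P\<^esub> e" "x' \<in> K #>\<^bsub>P\<^esub> e'" for e e' x x'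
      using that K.rcos_sum[OF that(1,2)] unfolding set_mult_def by blast
    show "\<exists>e\<in>carrier P. x \<in> K #>\<^bsub>P\<^esub> e" if "x \<in> carrier P" for x
      using P.rcos_self[OF that Ks] that by auto
    fix N assume N: "N \<in> open_normal_over P K"
    have Nn: "N \<lhd> P" "K \<subseteq> N" using N by (auto simp: open_normal_over_def open_normal_def)
    have "K #>\<^bsub>P\<^esub> e \<subseteq> N \<longleftrightarrow> e \<in> N" if "e \<in> carrier P" for e
      using P.rcos_self[OF that Ks] P.normalD(4)[OF Nn(1)] Nn(2) by (auto simp: r_coset_def)
    then have "{e \<in> carrier P. K #>\<^bsub>P\<^esub> e \<subseteq> N} = N" using P.normalD(2)[OF Nn(1)] by auto
    then show "{e \<in> carrier P. K #>\<^bsub>P\<^esub> e \<subseteq> N} \<in> open_normal P" "\<Phi> N \<subseteq> sort_seqs"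
      using N sorting_onD(2)[OF rsD(3) N] by (auto simp: open_normal_over_def)
  qed auto
qed

lemma extension_step_exists:
  fixes P :: "'a tgroup"
  assumes Jok: "\<forall>k\<ge>1. \<forall>J\<in>sort_seqs. Jsub k J \<in> sort_seqs"
    and P: "profinite P" "SEP Jsub P (\<lambda>_. sort_seqs)" and rs: "rel_sorting Jsub P K \<Phi>"
    and "\<not> rel_SEP Jsub P K \<Phi>"
  shows "\<exists>y. extension_step Jsub P (K, \<Phi>) y"
proof -
  obtain A FA B FB \<pi> \<phi> where min: "minimal_unsolvable Jsub P K \<Phi> A FA B FB \<pi> \<phi>"
    using ex_minimal_unsolvable[OF assms(5)] by auto
  interpret P: profinite P by fact
  have sP: "sorted_profinite Jsub P (\<lambda>_. sort_seqs)"
    using sorting_on_all[OF Jok] P.profin by (simp add: sorted_profinite_def sorting_data_iff)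
  have Ks: "subgroup K P" using P.normalD(1)[OF rel_sortingD(1)[OF rs]] .
  obtain \<psi> where "sorted_morphism P (\<lambda>_. sort_seqs) A FA \<psi>"
    "\<forall>e\<in>carrier P. \<forall>x\<in>K #>\<^bsub>P\<^esub> e. \<pi> (\<psi> e) = \<phi> x"
    "\<forall>x\<in>carrier P. \<forall>a\<in>carrier A. \<phi> x = \<pi> a \<longrightarrow> (\<exists>e\<in>carrier P. x \<in> K #>\<^bsub>P\<^esub> e \<and> \<psi> e = a)"
    using minimal_unsolvable_full[OF P(1) rs min sP P(2) canonical_lift[OF P(1) rs]] by auto
  moreover have "\<forall>e\<in>carrier P. \<pi> (\<psi> e) = \<phi> e"
    using calculation(2) P.rcos_self[OF _ Ks] by metis
  ultimately have "extension_step Jsub P (K, \<Phi>) (K \<inter> (\<psi> -` {\<one>\<^bsub>A\<^esub>} \<inter> carrier P),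
      least_sorting Jsub P (K \<inter> (\<psi> -` {\<one>\<^bsub>A\<^esub>} \<inter> carrier P)) \<Phi> A FA \<psi>)"
    unfolding extension_step_def using min
    by (intro exI[of _ A] exI[of _ FA] exI[of _ B] exI[of _ FB] exI[of _ \<pi>] exI[of _ \<phi>] exI[of _ \<psi>]) simp
  then show ?thesis by blast
qed

text \<open>The last conclusion makes the step proper: if \<open>y = x\<close>, then
  \<open>\<psi>\<close> is trivial on the kernel of \<open>x\<close> and respects its data, hence
  solves a problem that has no solution.\<close>

lemma extension_stepD:
  fixes P :: "'a tgroup"
  assumes Jok: "\<forall>k\<ge>1. \<forall>J\<in>sort_seqs. Jsub k J \<in> sort_seqs"
    and P: "profinite P" and rs: "rel_sorting Jsub P (fst x) (snd x)" and st: "extension_step Jsub P x y"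
  shows "rel_sorting Jsub P (fst y) (snd y)" "fst y \<subseteq> fst x" "snd x N \<subseteq> snd y N" "y \<noteq> x"
proof -
  obtain A FA B FB \<pi> \<phi> \<psi> where min: "minimal_unsolvable Jsub P (fst x) (snd x) A FA B FB \<pi> \<phi>"
    and \<psi>: "sorted_morphism P (\<lambda>_. sort_seqs) A FA \<psi>" "\<forall>z\<in>carrier P. \<pi> (\<psi> z) = \<phi> z"
    and y: "fst y = fst x \<inter> (\<psi> -` {\<one>\<^bsub>A\<^esub>} \<inter> carrier P)"
      "snd y = least_sorting Jsub P (fst y) (snd x) A FA \<psi>"
    using st unfolding extension_step_def by auto
  note pD = embedding_problemD[OF min[unfolded minimal_unsolvable_def, THEN conjunct1]]
  have Ap: "profinite A" using sorted_profiniteD(1)[OF pD(1)] .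
  note L = least_sorting[OF Jok P rs pD(1,2) \<psi>(1) y(1), folded y(2)]
  show "rel_sorting Jsub P (fst y) (snd y)" "snd x N \<subseteq> snd y N" using L(1,2) by auto
  show "fst y \<subseteq> fst x" using y(1) by auto
  show "y \<noteq> x"
  proof
    assume eq: "y = x"
    note \<psi>D = sorted_morphismD[OF \<psi>(1)]
    have "rel_morphism P (fst x) (snd x) A FA \<psi>"
      unfolding rel_morphism_def
    proof (intro conjI ballI)
      show "\<psi> z = \<one>\<^bsub>A\<^esub>" if "z \<in> fst x" for z using that y(1) eq by auto
      show "\<psi> -` M \<inter> carrier P \<in> open_normal P" if "M \<in> open_normal A" for M
        using vimage_open_normal[OF P Ap \<psi>D(1,2) that] .
      show "FA M \<subseteq> snd x (\<psi> -` M \<inter> carrier P)" if "M \<in> open_normal A" for M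
        using L(3)[OF that] eq by simp
    qed (use \<psi>D in auto)
    then have "solvable P (fst x) (snd x) A FA \<pi> \<phi>"
      unfolding solvable_def using \<psi>(2) by (intro exI[of _ \<psi>]) simp
    then show False using min by (simp add: minimal_unsolvable_def)
  qed
qed

text \<open>The new lift pairs the old one with a solution: \<open>q' e\<close> consists of the
  \<open>z\<close> in \<open>q e\<close> with \<open>\<psi> z = \<psi>E e\<close>. Fullness over
  \<open>P\<close> makes these sets non-empty, fullness over \<open>E\<close> makes the new lift
  onto, and leastness of the data gives the sorting condition.\<close>

lemma extension_step_lift:
  fixes P :: "'a tgroup" and E :: "'c tgroup"
  assumes Jok: "\<forall>k\<ge>1. \<forall>J\<in>sort_seqs. Jsub k J \<in> sort_seqs"
    and P: "profinite P" and rs: "rel_sorting Jsub P (fst x) (snd x)" and st: "extension_step Jsub P x y"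
    and E: "sorted_profinite Jsub E FE" "SEP Jsub E FE" and q: "rel_lift E FE P (fst x) (snd x) q"
  shows "\<exists>q'. rel_lift E FE P (fst y) (snd y) q' \<and> (\<forall>e\<in>carrier E. q' e \<subseteq> q e)"
proof -
  obtain A FA B FB \<pi> \<phi> \<psi> where min: "minimal_unsolvable Jsub P (fst x) (snd x) A FA B FB \<pi> \<phi>"
    and \<psi>: "sorted_morphism P (\<lambda>_. sort_seqs) A FA \<psi>" "\<forall>z\<in>carrier P. \<pi> (\<psi> z) = \<phi> z"
    and fullP: "\<And>z a. z \<in> carrier P \<Longrightarrow> a \<in> carrier A \<Longrightarrow> \<phi> z = \<pi> a \<Longrightarrow> \<exists>w\<in>carrier P. z \<in> fst x #>\<^bsub>P\<^esub> w \<and> \<psi> w = a"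
    and y: "fst y = fst x \<inter> (\<psi> -` {\<one>\<^bsub>A\<^esub>} \<inter> carrier P)"
      "snd y = least_sorting Jsub P (fst y) (snd x) A FA \<psi>"
    using st unfolding extension_step_def by auto
  note pD = embedding_problemD[OF min[unfolded minimal_unsolvable_def, THEN conjunct1]]
  interpret P: profinite P by fact
  interpret A: profinite A using sorted_profiniteD(1)[OF pD(1)] .
  interpret E: profinite E using sorted_profiniteD(1)[OF E(1)] .
  define K where "K = fst x"
  define K' where "K' = fst y"
  note rsD = rel_sortingD[OF rs, folded K_def]
  note y = y[folded K_def K'_def]
  note L = least_sorting[OF Jok P rs pD(1,2) \<psi>(1) y(1)[unfolded K_def], folded y(2)]
  interpret L: lift P E K FE "snd x" q
    using rsD(1,2) q by (simp add: lift_def lift_axioms_def P E.profinite_axioms K_def)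
  note \<psi>D = sorted_morphismD[OF \<psi>(1)]
  interpret \<psi>: group_hom P A \<psi> using \<psi>D(1) by unfold_locales
  obtain \<psi>E where \<psi>E: "sorted_morphism E FE A FA \<psi>E" "\<And>e z. e \<in> carrier E \<Longrightarrow> z \<in> q e \<Longrightarrow> \<pi> (\<psi>E e) = \<phi> z"
    and fullE: "\<And>z a. z \<in> carrier P \<Longrightarrow> a \<in> carrier A \<Longrightarrow> \<phi> z = \<pi> a \<Longrightarrow> \<exists>e\<in>carrier E. z \<in> q e \<and> \<psi>E e = a"
    using minimal_unsolvable_full[OF P rs min E q] by auto
  note \<psi>ED = sorted_morphismD[OF \<psi>E(1)]
  interpret \<psi>E: group_hom E A \<psi>E using \<psi>ED(1) by unfold_locales
  note rs' = rel_sortingD[OF L(1), folded K'_def]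
  have K's: "subgroup K' P" using P.normalD(1)[OF rs'(1)] .
  define q' where "q' e = {z \<in> q e. \<psi> z = \<psi>E e}" for e
  have q'sub: "q' e \<subseteq> q e" for e by (auto simp: q'_def)
  have q'P: "z \<in> carrier P" if "e \<in> carrier E" "z \<in> q' e" for e z using that L.q_mem(1) by (auto simp: q'_def)
  have q'coset: "q' e = K' #>\<^bsub>P\<^esub> z" if e: "e \<in> carrier E" and z: "z \<in> q' e" for e z
  proof -
    have zP: "z \<in> carrier P" using q'P[OF e z] .
    have zq: "z \<in> q e" "\<psi> z = \<psi>E e" using z by (auto simp: q'_def)
    have "w \<in> q' e \<longleftrightarrow> w \<in> K' #>\<^bsub>P\<^esub> z" for w
    proof (cases "w \<in> carrier P")
      case True
      have "\<psi> w = \<psi>E e \<longleftrightarrow> \<psi> (w \<otimes>\<^bsub>P\<^esub> inv\<^bsub>P\<^esub> z) = \<one>\<^bsub>A\<^esub>"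
        using True zP zq(2) A.mult_inv_eq_one_iff[OF \<psi>.hom_closed[OF True] \<psi>.hom_closed[OF zP]] by simp
      moreover have "w \<in> q e \<longleftrightarrow> w \<otimes>\<^bsub>P\<^esub> inv\<^bsub>P\<^esub> z \<in> K"
        using L.q_mem(2)[OF e zq(1)] P.mem_rcos_iff[OF L.K_subgroup zP] True by simp
      ultimately show ?thesis
        using True zP P.mem_rcos_iff[OF K's zP, of w] y(1) by (simp add: q'_def)
    next
      case False
      then show ?thesis using q'P[OF e] P.mem_rcos_iff[OF K's zP] by auto
    qed
    then show ?thesis by auto
  qed
  have q'ex: "\<exists>z. z \<in> q' e" if e: "e \<in> carrier E" for e
  proof -
    obtain z where z: "z \<in> q e" using L.q_ex[OF e] by auto
    obtain w where w: "w \<in> carrier P" "z \<in> K #>\<^bsub>P\<^esub> w" "\<psi> w = \<psi>E e"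
      using fullP[OF L.q_mem(1)[OF e z] \<psi>E.hom_closed[OF e]] \<psi>E(2)[OF e z] by (auto simp: K_def)
    have "q e = K #>\<^bsub>P\<^esub> w" using L.q_mem(2)[OF e z] P.repr_independence[OF w(2,1) L.K_subgroup] by simp
    then have "w \<in> q e" using P.rcos_self[OF w(1) L.K_subgroup] by simp
    then show ?thesis using w by (auto simp: q'_def)
  qed
  have q'mult: "z \<otimes>\<^bsub>P\<^esub> z' \<in> q' (e \<otimes>\<^bsub>E\<^esub> e')"
    if "e \<in> carrier E" "e' \<in> carrier E" "z \<in> q' e" "z' \<in> q' e'" for e e' z z'
    using that L.q_mult[OF that(1,2)] q'P by (auto simp: q'_def)
  have q'inv: "inv\<^bsub>P\<^esub> z \<in> q' (inv\<^bsub>E\<^esub> e)" if "e \<in> carrier E" "z \<in> q' e" for e z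
    using that L.q_inv[OF that(1)] q'P[OF that] by (auto simp: q'_def)
  have q'one: "\<one>\<^bsub>P\<^esub> \<in> q' \<one>\<^bsub>E\<^esub>" using L.q_one P.normalD(3)[OF rsD(1)] by (simp add: q'_def)
  have q'iff: "q' e \<subseteq> N \<longleftrightarrow> z \<in> N" if N: "N \<in> open_normal_over P K'" and e: "e \<in> carrier E" "z \<in> q' e" for N e z
  proof
    have N': "subgroup N P" "K' \<subseteq> N"
      using N by (auto simp: open_normal_over_def open_normal_def normal_imp_subgroup)
    assume "z \<in> N"
    then show "q' e \<subseteq> N"
      using q'coset[OF e] N' subgroup.m_closed[OF N'(1)] by (auto simp: r_coset_def)
  qed (use e in auto)
  have eqK: "{e \<in> carrier E. q' e \<subseteq> N} = {e \<in> carrier E. q e \<subseteq> N}" if N: "N \<in> open_normal_over P K" for N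
  proof -
    have N': "N \<in> open_normal_over P K'" using N y(1) by (auto simp: open_normal_over_def)
    have "q' e \<subseteq> N \<longleftrightarrow> q e \<subseteq> N" if e: "e \<in> carrier E" for e
    proof -
      obtain z where z: "z \<in> q' e" using q'ex[OF e] by auto
      then have "z \<in> q e" using q'sub by auto
      then show ?thesis using q'iff[OF N' e z] L.q_subset_iff[OF N e] by simp
    qed
    then show ?thesis by auto
  qed
  have v: "\<psi> -` M \<inter> carrier P \<in> open_normal_over P K'" if M: "M \<in> open_normal A" for M
    using vimage_open_normal[OF P A.profinite_axioms \<psi>D(1,2) M] A.normalD(3)[OF A.open_normalD(1)[OF M]] y(1)
    by (auto simp: open_normal_over_def)
  have eqA: "{e \<in> carrier E. q' e \<subseteq> \<psi> -` M \<inter> carrier P} = \<psi>E -` M \<inter> carrier E" if M: "M \<in> open_normal A" for M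
  proof -
    have "q' e \<subseteq> \<psi> -` M \<inter> carrier P \<longleftrightarrow> \<psi>E e \<in> M" if e: "e \<in> carrier E" for e
    proof -
      obtain z where z: "z \<in> q' e" using q'ex[OF e] by auto
      then show ?thesis using q'iff[OF v[OF M] e z] q'P[OF e z] by (simp add: q'_def)
    qed
    then show ?thesis by auto
  qed
  have one: "{\<one>\<^bsub>A\<^esub>} \<in> open_normal A"
    using A.one_is_normal finite_profinite_discrete(1)[OF A.profinite_axioms pD(2), of "{\<one>\<^bsub>A\<^esub>}"]
    by (simp add: open_normal_def)
  have q'open: "{e \<in> carrier E. q' e \<subseteq> N} \<in> open_normal E" if N: "N \<in> open_normal_over P K'" for N
  proof -
    have Nn: "N \<lhd> P" "openin (gtop P) N" "K' \<subseteq> N" using N by (auto simp: open_normal_over_def open_normal_def)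
    let ?S = "{e \<in> carrier E. q' e \<subseteq> N}"
    have mem: "e \<in> ?S" if "e \<in> carrier E" "z \<in> q' e" "z \<in> N" for e z using that q'iff[OF N] by simp
    have Sn: "?S \<lhd> E"
      unfolding E.normal_inv_iff
    proof (intro conjI ballI)
      show "subgroup ?S E"
      proof (rule E.subgroupI)
        show "?S \<noteq> {}" using mem[OF _ q'one] P.normalD(3)[OF Nn(1)] by auto
        fix e assume e: "e \<in> ?S"
        obtain z where z: "z \<in> q' e" "z \<in> N" using e q'ex by blast
        show "inv\<^bsub>E\<^esub> e \<in> ?S"
          using e z q'inv P.normalD(5)[OF Nn(1)] by (intro mem[of _ "inv\<^bsub>P\<^esub> z"]) auto
        fix e' assume e': "e' \<in> ?S"
        obtain z' where z': "z' \<in> q' e'" "z' \<in> N" using e' q'ex by blast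
        show "e \<otimes>\<^bsub>E\<^esub> e' \<in> ?S"
          using e z e' z' q'mult P.normalD(4)[OF Nn(1)] by (intro mem[of _ "z \<otimes>\<^bsub>P\<^esub> z'"]) auto
      qed auto
      fix g e assume g: "g \<in> carrier E" and e: "e \<in> ?S"
      obtain z where z: "z \<in> q' e" "z \<in> N" using e q'ex by blast
      obtain w where w: "w \<in> q' g" using q'ex[OF g] by auto
      show "g \<otimes>\<^bsub>E\<^esub> e \<otimes>\<^bsub>E\<^esub> inv\<^bsub>E\<^esub> g \<in> ?S"
        using e z g w q'P[OF g w] P.normalD(6)[OF Nn(1)]
        by (intro mem[of _ "w \<otimes>\<^bsub>P\<^esub> z \<otimes>\<^bsub>P\<^esub> inv\<^bsub>P\<^esub> w"] q'mult q'inv) auto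
    qed
    have kc: "closedin (gtop P) (\<psi> -` {\<one>\<^bsub>A\<^esub>} \<inter> carrier P)"
      using v[OF one] P.open_normalD(3) by (simp add: open_normal_over_def)
    obtain N1 where N1: "N1 \<in> open_normal_over P K" "N1 \<inter> (\<psi> -` {\<one>\<^bsub>A\<^esub>} \<inter> carrier P) \<subseteq> N"
      using P.open_normal_over_within[OF rsD(1,2) kc Nn(2) Nn(3)[unfolded y(1)]] by (rule bexE)
    \<comment> \<open>An open set inside the preimage of \<open>N\<close>: over it, values of
      \<open>q'\<close> meet \<open>N1\<close> as well as the kernel of \<open>\<psi>\<close>, and
      \<open>N\<close> contains the intersection of these two.\<close>
    let ?U = "{e \<in> carrier E. q e \<subseteq> N1} \<inter> (\<psi>E -` {\<one>\<^bsub>A\<^esub>} \<inter> carrier E)"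
    have U: "?U \<in> open_normal E"
      using L.q_open[OF N1(1)] vimage_open_normal[OF E.profinite_axioms A.profinite_axioms \<psi>ED(1,2) one]
      by (rule E.Int_open_normal)
    moreover have "?U \<subseteq> ?S"
    proof
      fix e assume e: "e \<in> ?U"
      then obtain z where z: "z \<in> q' e" using q'ex by auto
      then have "z \<in> N1 \<inter> (\<psi> -` {\<one>\<^bsub>A\<^esub>} \<inter> carrier P)" using e q'sub[of e] q'P[of e z] by (auto simp: q'_def)
      then have "z \<in> N" using N1(2) by (rule rev_subsetD)
      then show "e \<in> ?S" using e z mem by auto
    qed
    moreover have "?U \<noteq> {}" using E.normalD(3)[OF E.open_normalD(1)[OF U]] by blast
    ultimately show ?thesis
      using E.open_normalI[OF Sn E.open_normalD(2)[OF U]] by simp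
  qed
  \<comment> \<open>Empty data stand in for \<open>snd y\<close>: they give access to
    \<open>sorting_on_along\<close> for \<open>q'\<close>, from which the condition on
    \<open>snd y\<close> is then derived.\<close>
  have lift0: "rel_lift E FE P K' (\<lambda>_. {}) q'"
    unfolding rel_lift_def
  proof (intro conjI ballI)
    show "\<exists>x\<in>carrier P. q' e = K' #>\<^bsub>P\<^esub> x" if "e \<in> carrier E" for e
      using q'ex[OF that] q'coset[OF that] q'P[OF that] by auto
    show "\<exists>e\<in>carrier E. z \<in> q' e" if "z \<in> carrier P" for z
      using fullE[OF that, of "\<psi> z"] \<psi>(2) that by (auto simp: q'_def)
  qed (use q'mult q'open in auto)
  interpret L': lift P E K' FE "\<lambda>_. {}" q'
    using rs'(1,2) lift0 by (simp add: lift_def lift_axioms_def P E.profinite_axioms)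
  have above: "sorting_above Jsub P K' (snd x) A FA \<psi> (\<lambda>N. FE {e \<in> carrier E. q' e \<subseteq> N})"
    unfolding sorting_above_def
  proof (intro conjI allI ballI)
    show "sorting_on Jsub (open_normal_over P K') (carrier P) (index P) (\<lambda>N. FE {e \<in> carrier E. q' e \<subseteq> N})"
      using L'.sorting_on_along[OF sorted_profiniteD(3)[OF E(1)]] .
    show "snd x N \<subseteq> FE {e \<in> carrier E. q' e \<subseteq> N}" for N
      using eqK L.q_sort rsD(4) by (cases "N \<in> open_normal_over P K") auto
    show "FA M \<subseteq> FE {e \<in> carrier E. q' e \<subseteq> \<psi> -` M \<inter> carrier P}" if "M \<in> open_normal A" for M
      unfolding eqA[OF that] using \<psi>ED(6)[OF that] .
  qed
  have "snd y N \<subseteq> FE {e \<in> carrier E. q' e \<subseteq> N}" for N by (rule L(4)[OF above])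
  then have "rel_lift E FE P K' (snd y) q'"
    using lift0 unfolding rel_lift_def by simp
  then show ?thesis unfolding K'_def using q'sub by (intro exI[of _ q']) simp
qed

section \<open>The tower of quotients\<close>

text \<open>Going up means a smaller kernel and more sorts, so that the projection from the upper
  quotient to the lower one is a morphism. Validity of both pairs is part of the relation, so its
  field consists of the valid pairs.\<close>

definition tower_le ::
    "(nat \<Rightarrow> 'j list \<Rightarrow> 'j list) \<Rightarrow> 'a tgroup \<Rightarrow>
     (('a set \<times> ('a set \<Rightarrow> 'j list set)) \<times> ('a set \<times> ('a set \<Rightarrow> 'j list set))) set" where
  "tower_le Jsub P = {(x, y). rel_sorting Jsub P (fst x) (snd x) \<and> rel_sorting Jsub P (fst y) (snd y) \<and>
     fst y \<subseteq> fst x \<and> (\<forall>N. snd x N \<subseteq> snd y N)}"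

definition tower_lub :: "('a set \<times> ('a set \<Rightarrow> 'j list set)) set \<Rightarrow> 'a set \<times> ('a set \<Rightarrow> 'j list set)" where
  "tower_lub M = (\<Inter>x\<in>M. fst x, \<lambda>N. \<Union>x\<in>M. snd x N)"

text \<open>The chosen step depends on \<open>x\<close> alone and not on any cover \<open>E\<close>;
  a pair without a step is a fixed point.\<close>

definition tower_succ where
  "tower_succ Jsub P x = (if \<exists>y. extension_step Jsub P x y then SOME y. extension_step Jsub P x y else x)"

lemma Field_tower_le: "Field (tower_le Jsub P) = {x. rel_sorting Jsub P (fst x) (snd x)}"
  unfolding Field_def tower_le_def by auto

text \<open>By compactness an open normal subgroup over the intersection already contains the kernel
  of some member, so its value is non-empty. Every other condition involves at most two members, and
  one of these is above the other.\<close>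

lemma tower_chain:
  assumes "M \<in> Chains (tower_le Jsub P)" "M \<noteq> {}" and P: "profinite P"
  shows "rel_sorting Jsub P (\<Inter>x\<in>M. fst x) (\<lambda>N. \<Union>x\<in>M. snd x N)"
    "\<And>U. openin (gtop P) U \<Longrightarrow> (\<Inter>x\<in>M. fst x) \<subseteq> U \<Longrightarrow> \<exists>x\<in>M. fst x \<subseteq> U"
proof -
  interpret P: profinite P by fact
  have rs: "rel_sorting Jsub P (fst x) (snd x)" if "x \<in> M" for x
    using that assms(1) unfolding Chains_def tower_le_def by auto
  have comp: "(x, y) \<in> tower_le Jsub P \<or> (y, x) \<in> tower_le Jsub P" if "x \<in> M" "y \<in> M" for x y
    using that assms(1) unfolding Chains_def by auto
  have ub: "\<exists>z\<in>M. fst z \<subseteq> fst x \<inter> fst y \<and> (\<forall>N. snd x N \<union> snd y N \<subseteq> snd z N)" if "x \<in> M" "y \<in> M" for x y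
    using comp[OF that] that unfolding tower_le_def by (auto simp: Int_absorb1 Int_absorb2)
  note rsD = rel_sortingD[OF rs]
  let ?K = "\<Inter>x\<in>M. fst x" and ?F = "\<lambda>N. \<Union>x\<in>M. snd x N"
  show dir: "\<exists>x\<in>M. fst x \<subseteq> U" if U: "openin (gtop P) U" "?K \<subseteq> U" for U
  proof -
    have "\<exists>C\<in>fst ` M. C \<subseteq> U"
    proof (rule compact_space_directed[OF P.compact _ _ _ U(1)])
      show "\<exists>C\<in>fst ` M. C \<subseteq> A \<inter> B" if AB: "A \<in> fst ` M" "B \<in> fst ` M" for A B
      proof -
        obtain x y where xy: "x \<in> M" "y \<in> M" "A = fst x" "B = fst y" using AB by blast
        then show ?thesis using ub[OF xy(1,2)] by auto
      qed
    qed (use assms(2) rsD(2) U(2) in auto)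
    then show ?thesis by auto
  qed
  have Kn: "?K \<lhd> P"
    unfolding P.normal_inv_iff
  proof (intro conjI ballI)
    show "subgroup ?K P"
      using assms(2) P.normalD(1)[OF rsD(1)] by (intro P.subgroups_Inter) auto
    show "x \<otimes>\<^bsub>P\<^esub> h \<otimes>\<^bsub>P\<^esub> inv\<^bsub>P\<^esub> x \<in> ?K" if "x \<in> carrier P" "h \<in> ?K" for x h
      using that P.normalD(6)[OF rsD(1)] by auto
  qed
  have Kc: "closedin (gtop P) ?K"
    using closedin_Inter[of "fst ` M" "gtop P"] assms(2) rsD(2) by auto
  have loc: "\<exists>x\<in>M. N \<in> open_normal_over P (fst x)" if N: "N \<in> open_normal_over P ?K" for N
  proof -
    obtain x where "x \<in> M" "fst x \<subseteq> N" using dir[of N] N by (auto simp: open_normal_over_def open_normal_def)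
    then show ?thesis using N by (auto simp: open_normal_over_def)
  qed
  have mem: "N \<in> open_normal_over P (fst x)" if "x \<in> M" "J \<in> snd x N" for x N J
    using rsD(4)[OF that(1), of N] that(2) by auto
  have up: "N2 \<in> open_normal_over P (fst x)"
    if "N1 \<in> open_normal_over P (fst x)" "N2 \<in> open_normal_over P ?K" "N1 \<subseteq> N2" for x N1 N2
    using that by (auto simp: open_normal_over_def)
  have cov: "carrier P \<in> open_normal_over P (fst x)" if "x \<in> M" for x
    using P.carrier_open_normal_over[OF rsD(1)[OF that]] .
  have "sorting_on Jsub (open_normal_over P ?K) (carrier P) (index P) ?F"
  proof (rule sorting_onI)
    fix N assume N: "N \<in> open_normal_over P ?K"
    obtain x where x: "x \<in> M" "N \<in> open_normal_over P (fst x)" using loc[OF N] by auto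
    show "?F N \<noteq> {}" using sorting_onD(1)[OF rsD(3)[OF x(1)] x(2)] x(1) by auto
    show "?F N \<subseteq> sort_seqs"
    proof
      fix J assume "J \<in> ?F N"
      then obtain y where y: "y \<in> M" "J \<in> snd y N" by auto
      then show "J \<in> sort_seqs" using sorting_onD(2)[OF rsD(3)[OF y(1)] mem[OF y]] by auto
    qed
  next
    fix N J assume "N \<in> open_normal_over P ?K" "J \<in> ?F N"
    then obtain y where y: "y \<in> M" "J \<in> snd y N" by auto
    then show "sqrt_seq J \<subseteq> ?F N" using sorting_onD(3)[OF rsD(3)[OF y(1)] mem[OF y] y(2)] by auto
  next
    have "?F (carrier P) = (\<Union>x\<in>M. sort_seqs)"
      by (rule SUP_cong[OF refl]) (rule sorting_onD(4)[OF rsD(3)])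
    then show "?F (carrier P) = sort_seqs" using assms(2) by simp
  next
    fix N1 N2 k J assume *: "N1 \<in> open_normal_over P ?K" "N2 \<in> open_normal_over P ?K" "1 \<le> k" "J \<in> ?F N1" "N1 \<subseteq> N2" "index P N1 \<le> k"
    then obtain y where y: "y \<in> M" "J \<in> snd y N1" by auto
    have "Jsub k J \<in> snd y N2"
      using sorting_onD(5)[OF rsD(3)[OF y(1)] mem[OF y] up[OF mem[OF y] *(2,5)] *(3) y(2) *(5,6)] .
    then show "Jsub k J \<in> ?F N2" using y by auto
  next
    fix N1 N2 J1 J2 assume "J1 \<in> ?F N1" "J2 \<in> ?F N2"
    then obtain x y where xy: "x \<in> M" "y \<in> M" "J1 \<in> snd x N1" "J2 \<in> snd y N2" by auto
    then obtain z where z: "z \<in> M" "J1 \<in> snd z N1" "J2 \<in> snd z N2" using ub[OF xy(1,2)] by blast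
    have "J1 @ J2 \<in> snd z (N1 \<inter> N2)"
      using sorting_onD(6)[OF rsD(3)[OF z(1)] mem[OF z(1,2)] mem[OF z(1,3)] z(2,3)] .
    then show "J1 @ J2 \<in> ?F (N1 \<inter> N2)" using z by auto
  qed
  moreover have "?F N = {}" if "N \<notin> open_normal_over P ?K" for N
  proof -
    have "N \<notin> open_normal_over P (fst x)" if "x \<in> M" for x
      using that \<open>N \<notin> _\<close> by (auto simp: open_normal_over_def)
    then show ?thesis using rsD(4) by auto
  qed
  ultimately show "rel_sorting Jsub P ?K ?F" using Kn Kc by (simp add: rel_sorting_def)
qed

lemma (in profinite) closed_rcos:
  assumes "closedin (gtop G) C" "y \<in> carrier G"
  shows "closedin (gtop G) (C #> y)"
proof -
  have C: "C \<subseteq> carrier G" using closedin_subset[OF assms(1)] by simp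
  have "continuous_map (gtop G) (gtop G) (\<lambda>x. x \<otimes> inv y)"
    using assms by (intro cont_mult2) auto
  from closedin_continuous_map_preimage[OF this assms(1)] show ?thesis
    using assms C by (simp add: r_coset_eq_vimage)
qed

context lift
begin

text \<open>The fibre is a coset of the kernel of \<open>q\<close>, an intersection of closed
  subgroups. Closed fibres let compactness of \<open>E\<close> find preimages under a limit of
  lifts.\<close>

lemma fibre_closed:
  assumes x: "x \<in> carrier P"
  shows "closedin (gtop E) {e \<in> carrier E. x \<in> q e}"
proof -
  obtain e0 where e0: "e0 \<in> carrier E" "x \<in> q e0" using q_onto[OF x] by auto
  let ?k = "\<Inter>N\<in>open_normal_over P K. {e \<in> carrier E. q e \<subseteq> N}"
  have cP: "carrier P \<in> open_normal_over P K" using P.carrier_open_normal_over[OF K_normal] .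
  have "closedin (gtop E) ?k"
    using cP q_open E.open_normalD(3) by (intro closedin_INT) auto
  then have "closedin (gtop E) (?k #>\<^bsub>E\<^esub> e0)" using e0 by (intro E.closed_rcos)
  moreover have "?k #>\<^bsub>E\<^esub> e0 = {e \<in> carrier E. x \<in> q e}"
  proof -
    have "e \<in> ?k #>\<^bsub>E\<^esub> e0 \<longleftrightarrow> x \<in> q e" if e: "e \<in> carrier E" for e
    proof -
      obtain y where y: "y \<in> q e" using q_ex[OF e] by auto
      have yP: "y \<in> carrier P" using q_mem(1)[OF e y] .
      have yx: "y \<otimes>\<^bsub>P\<^esub> inv\<^bsub>P\<^esub> x \<in> q (e \<otimes>\<^bsub>E\<^esub> inv\<^bsub>E\<^esub> e0)" using e e0 y by (intro q_mult q_inv) auto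
      have "e \<in> ?k #>\<^bsub>E\<^esub> e0 \<longleftrightarrow> e \<otimes>\<^bsub>E\<^esub> inv\<^bsub>E\<^esub> e0 \<in> ?k"
        using cP e e0 by (subst E.r_coset_eq_vimage) auto
      also have "\<dots> \<longleftrightarrow> (\<forall>N\<in>open_normal_over P K. y \<otimes>\<^bsub>P\<^esub> inv\<^bsub>P\<^esub> x \<in> N)"
        using q_subset_iff[OF _ _ yx] e e0 by simp
      also have "\<dots> \<longleftrightarrow> y \<otimes>\<^bsub>P\<^esub> inv\<^bsub>P\<^esub> x \<in> K"
        using P.open_normal_over_separates[OF K_normal K_closed, of "y \<otimes>\<^bsub>P\<^esub> inv\<^bsub>P\<^esub> x"] yP x
        by (auto simp: open_normal_over_def)
      also have "\<dots> \<longleftrightarrow> K #>\<^bsub>P\<^esub> y = K #>\<^bsub>P\<^esub> x" using P.rcos_eq_iff[OF K_subgroup yP x] by simp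
      also have "\<dots> \<longleftrightarrow> x \<in> q e"
        using q_mem(2)[OF e y] q_mem(2)[OF e] P.rcos_self[OF x K_subgroup] by metis
      finally show ?thesis .
    qed
    moreover have "?k #>\<^bsub>E\<^esub> e0 \<subseteq> carrier E" using cP e0 by (auto simp: r_coset_def)
    ultimately show ?thesis by blast
  qed
  ultimately show ?thesis by simp
qed

end

lemma rel_liftD:
  assumes "rel_lift E FE P K \<Phi> q" "profinite P" "profinite E" "rel_sorting Jsub P K \<Phi>"
  shows "lift P E K FE \<Phi> q"
  using assms by (auto simp: lift_def lift_axioms_def rel_sorting_def)

text \<open>The limit takes intersections of cosets: they are non-empty by compactness of
  \<open>P\<close>, and every \<open>x\<close> is attained by compactness of \<open>E\<close>. An
  open normal subgroup over the limit kernel lies over the kernel of some member, where openness and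
  sorting are already known.\<close>

lemma rel_lift_chain:
  fixes P :: "'a tgroup" and E :: "'c tgroup"
    and C :: "(('a set \<times> ('a set \<Rightarrow> 'j list set)) \<times> ('c \<Rightarrow> 'a set)) set"
  assumes P: "profinite P" and E: "profinite E" and C: "C \<noteq> {}" "fst ` C \<in> Chains (tower_le Jsub P)"
    and l: "\<And>x q. (x, q) \<in> C \<Longrightarrow> rel_lift E FE P (fst x) (snd x) q"
    and mono: "\<And>x q x' q'. (x, q) \<in> C \<Longrightarrow> (x', q') \<in> C \<Longrightarrow>
      fst x' \<subseteq> fst x \<and> (\<forall>e\<in>carrier E. q' e \<subseteq> q e) \<or> fst x \<subseteq> fst x' \<and> (\<forall>e\<in>carrier E. q e \<subseteq> q' e)"
  shows "rel_lift E FE P (\<Inter>x\<in>fst ` C. fst x) (\<lambda>N. \<Union>x\<in>fst ` C. snd x N) (\<lambda>e. \<Inter>z\<in>C. snd z e)"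
proof -
  interpret P: profinite P by fact
  interpret E: profinite E by fact
  have ne: "fst ` C \<noteq> {}" using C(1) by auto
  note ch = tower_chain[OF C(2) ne P]
  let ?K = "\<Inter>x\<in>fst ` C. fst x" and ?q = "\<lambda>e. \<Inter>z\<in>C. snd z e"
  have rs: "rel_sorting Jsub P (fst (fst z)) (snd (fst z))" if "z \<in> C" for z
    using that C(2) unfolding Chains_def tower_le_def by auto
  have L: "lift P E (fst (fst z)) FE (snd (fst z)) (snd z)" if "z \<in> C" for z
    using rel_liftD[OF l P E rs[OF that]] that by (metis prod.collapse)
  note rs' = rel_sortingD[OF ch(1)]
  have Ks: "subgroup ?K P" using P.normalD(1)[OF rs'(1)] .
  have dir: "\<exists>w\<in>C. fst (fst w) \<subseteq> fst (fst z) \<inter> fst (fst z') \<and> (\<forall>e\<in>carrier E. snd w e \<subseteq> snd z e \<inter> snd z' e)"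
    if zz: "z \<in> C" "z' \<in> C" for z z'
  proof -
    have "(fst z, snd z) \<in> C" "(fst z', snd z') \<in> C" using zz by simp_all
    from mono[OF this] show ?thesis
    proof
      assume "fst (fst z') \<subseteq> fst (fst z) \<and> (\<forall>e\<in>carrier E. snd z' e \<subseteq> snd z e)"
      then show ?thesis using zz by (intro bexI[of _ z']) auto
    next
      assume "fst (fst z) \<subseteq> fst (fst z') \<and> (\<forall>e\<in>carrier E. snd z e \<subseteq> snd z' e)"
      then show ?thesis using zz by (intro bexI[of _ z]) auto
    qed
  qed
  have coset: "?q e = ?K #>\<^bsub>P\<^esub> x" "x \<in> carrier P" if e: "e \<in> carrier E" and x: "x \<in> ?q e" for e x
  proof -
    obtain z0 where z0: "z0 \<in> C" using C(1) by auto
    show xP: "x \<in> carrier P" using lift.q_mem(1)[OF L[OF z0] e] x z0 by auto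
    have "w \<in> ?q e \<longleftrightarrow> w \<in> ?K #>\<^bsub>P\<^esub> x" for w
    proof -
      have "w \<in> snd z e \<longleftrightarrow> w \<in> carrier P \<and> w \<otimes>\<^bsub>P\<^esub> inv\<^bsub>P\<^esub> x \<in> fst (fst z)" if z: "z \<in> C" for z
        using lift.q_mem(2)[OF L[OF z] e, of x] x z P.mem_rcos_iff[OF lift.K_subgroup[OF L[OF z]] xP] by auto
      then show ?thesis using P.mem_rcos_iff[OF Ks xP] z0 by auto
    qed
    then show "?q e = ?K #>\<^bsub>P\<^esub> x" by auto
  qed
  have qex: "\<exists>x. x \<in> ?q e" if e: "e \<in> carrier E" for e
  proof (rule ccontr)
    assume "\<not> ?thesis"
    then have "\<Inter>((\<lambda>z. snd z e) ` C) \<subseteq> {}" by auto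
    have "\<exists>D\<in>(\<lambda>z. snd z e) ` C. D \<subseteq> {}"
    proof (rule compact_space_directed[OF P.compact _ _ _ _ \<open>_ \<subseteq> {}\<close>])
      show "closedin (gtop P) D" if DD: "D \<in> (\<lambda>z. snd z e) ` C" for D
      proof -
        obtain z where z: "z \<in> C" "D = snd z e" using DD by blast
        obtain x where x: "x \<in> snd z e" using lift.q_ex[OF L[OF z(1)] e] by auto
        show ?thesis
          unfolding z(2) lift.q_mem(2)[OF L[OF z(1)] e x]
          using P.closed_rcos[OF lift.K_closed[OF L[OF z(1)]] lift.q_mem(1)[OF L[OF z(1)] e x]] .
      qed
      show "\<exists>D\<in>(\<lambda>z. snd z e) ` C. D \<subseteq> A \<inter> B" if AB: "A \<in> (\<lambda>z. snd z e) ` C" "B \<in> (\<lambda>z. snd z e) ` C" for A B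
      proof -
        obtain z z' where zz: "z \<in> C" "z' \<in> C" "A = snd z e" "B = snd z' e" using AB by blast
        obtain w where "w \<in> C" "\<forall>e\<in>carrier E. snd w e \<subseteq> snd z e \<inter> snd z' e" using dir[OF zz(1,2)] by auto
        then show ?thesis using zz e by (intro bexI[of _ "snd w e"]) auto
      qed
    qed (use C(1) in auto)
    then obtain z where z: "z \<in> C" "snd z e = {}" by auto
    then show False using lift.q_ex[OF L[OF z(1)] e] by auto
  qed
  have qonto: "\<exists>e\<in>carrier E. x \<in> ?q e" if x: "x \<in> carrier P" for x
  proof (rule ccontr)
    assume neg: "\<not> ?thesis"
    let ?f = "\<lambda>z. {e \<in> carrier E. x \<in> snd z e}"
    have sub: "\<Inter>(?f ` C) \<subseteq> {}" using neg C(1) by auto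
    have "\<exists>D\<in>?f ` C. D \<subseteq> {}"
    proof (rule compact_space_directed[OF E.compact _ _ _ _ sub])
      show "closedin (gtop E) D" if "D \<in> ?f ` C" for D
        using that lift.fibre_closed[OF L x] by auto
      show "\<exists>D\<in>?f ` C. D \<subseteq> A \<inter> B" if AB: "A \<in> ?f ` C" "B \<in> ?f ` C" for A B
      proof -
        obtain z z' where zz: "z \<in> C" "z' \<in> C" "A = ?f z" "B = ?f z'" using AB by blast
        obtain w where "w \<in> C" "\<forall>e\<in>carrier E. snd w e \<subseteq> snd z e \<inter> snd z' e" using dir[OF zz(1,2)] by auto
        then show ?thesis using zz by (intro bexI[of _ "?f w"]) auto
      qed
    qed (use C(1) in auto)
    then obtain z where z: "z \<in> C" "?f z = {}" by auto
    then show False using lift.q_onto[OF L[OF z(1)] x] by auto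
  qed
  have same: "{e \<in> carrier E. ?q e \<subseteq> N} = {e \<in> carrier E. snd z e \<subseteq> N}"
    if z: "z \<in> C" and N: "N \<in> open_normal_over P (fst (fst z))" for z N
  proof -
    have N': "subgroup N P" "?K \<subseteq> N"
      using N z by (auto simp: open_normal_over_def open_normal_def normal_imp_subgroup)
    have "?q e \<subseteq> N \<longleftrightarrow> snd z e \<subseteq> N" if e: "e \<in> carrier E" for e
    proof -
      obtain x where x: "x \<in> ?q e" using qex[OF e] by auto
      have "?q e \<subseteq> N \<longleftrightarrow> x \<in> N"
      proof
        assume "x \<in> N"
        then show "?q e \<subseteq> N"
          unfolding coset(1)[OF e x] using subsetD[OF N'(2)] subgroup.m_closed[OF N'(1)]
          by (auto simp: r_coset_def)
      qed (rule subsetD[OF _ x])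
      then show ?thesis using lift.q_subset_iff[OF L[OF z] N e, of x] x z by auto
    qed
    then show ?thesis by auto
  qed
  show ?thesis
    unfolding rel_lift_def
  proof (intro conjI ballI)
    show "\<exists>x\<in>carrier P. ?q e = ?K #>\<^bsub>P\<^esub> x" if "e \<in> carrier E" for e
      using qex[OF that] coset[OF that] by metis
    show "x \<otimes>\<^bsub>P\<^esub> x' \<in> ?q (e \<otimes>\<^bsub>E\<^esub> e')"
      if "e \<in> carrier E" "e' \<in> carrier E" "x \<in> ?q e" "x' \<in> ?q e'" for e e' x x'
    proof (rule INT_I)
      fix z assume "z \<in> C"
      then show "x \<otimes>\<^bsub>P\<^esub> x' \<in> snd z (e \<otimes>\<^bsub>E\<^esub> e')" using that by (intro lift.q_mult[OF L]) auto
    qed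
    fix N assume N: "N \<in> open_normal_over P ?K"
    then have No: "openin (gtop P) N" "?K \<subseteq> N" by (simp_all add: open_normal_over_def open_normal_def)
    obtain z where "z \<in> C" "fst (fst z) \<subseteq> N" using ch(2)[OF No] by auto
    then have z: "z \<in> C" "N \<in> open_normal_over P (fst (fst z))"
      using N by (simp_all add: open_normal_over_def)
    show "{e \<in> carrier E. ?q e \<subseteq> N} \<in> open_normal E"
      unfolding same[OF z] using lift.q_open[OF L[OF z(1)] z(2)] .
    show "(\<Union>x\<in>fst ` C. snd x N) \<subseteq> FE {e \<in> carrier E. ?q e \<subseteq> N}"
    proof
      fix J assume "J \<in> (\<Union>x\<in>fst ` C. snd x N)"
      then obtain z' where z': "z' \<in> C" "J \<in> snd (fst z') N" by auto
      then have N': "N \<in> open_normal_over P (fst (fst z'))" using rel_sortingD(4)[OF rs[OF z'(1)], of N] by auto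
      show "J \<in> FE {e \<in> carrier E. ?q e \<subseteq> N}"
        unfolding same[OF z'(1) N'] using lift.q_sort[OF L[OF z'(1)] N'] z'(2) by auto
    qed
  qed (use qonto in auto)
qed

section \<open>The Bourbaki-Witt iteration and its fixed point\<close>

locale tower = profinite P for P :: "'a tgroup" +
  fixes Jsub :: "nat \<Rightarrow> 'j list \<Rightarrow> 'j list"
  assumes Jok: "\<forall>k\<ge>1. \<forall>J\<in>sort_seqs. Jsub k J \<in> sort_seqs"
    and SEP_P: "SEP Jsub P (\<lambda>_. sort_seqs)"
begin

lemma succ_le:
  assumes "x \<in> Field (tower_le Jsub P)"
  shows "(x, tower_succ Jsub P x) \<in> tower_le Jsub P"
proof (cases "\<exists>y. extension_step Jsub P x y")
  case True
  then have st: "extension_step Jsub P x (tower_succ Jsub P x)" by (simp add: tower_succ_def someI_ex)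
  have rs: "rel_sorting Jsub P (fst x) (snd x)" using assms by (simp add: Field_tower_le)
  show ?thesis
    using rs extension_stepD(1-3)[OF Jok profinite_axioms rs st] by (simp add: tower_le_def)
next
  case False
  then show ?thesis using assms unfolding Field_tower_le by (auto simp: tower_succ_def tower_le_def)
qed

sublocale bourbaki_witt_fixpoint tower_lub "tower_le Jsub P" "tower_succ Jsub P"
proof
  show "Partial_order (tower_le Jsub P)"
    unfolding partial_order_on_def preorder_on_def Field_tower_le
  proof (intro conjI)
    show "antisym (tower_le Jsub P)"
    proof (rule antisymI)
      fix x y assume "(x, y) \<in> tower_le Jsub P" "(y, x) \<in> tower_le Jsub P"
      then have "fst x = fst y" "snd x N = snd y N" for N unfolding tower_le_def by auto
      then show "x = y" by (intro prod_eqI ext)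
    qed
  qed (auto simp: refl_on_def trans_def tower_le_def, blast+)
  fix M assume M: "M \<in> Chains (tower_le Jsub P)"
  have rs: "rel_sorting Jsub P (fst x) (snd x)" if "x \<in> M" for x
    using that M unfolding Chains_def tower_le_def by auto
  show "(tower_lub M, z) \<in> tower_le Jsub P" if "M \<noteq> {}" "\<And>x. x \<in> M \<Longrightarrow> (x, z) \<in> tower_le Jsub P" for z
    using that(2) tower_chain(1)[OF M that(1) profinite_axioms] that(1)
    unfolding tower_le_def tower_lub_def by (auto; blast)
  show "(x, tower_lub M) \<in> tower_le Jsub P" if "x \<in> M" for x
    using rs[OF that] tower_chain(1)[OF M _ profinite_axioms] that
    unfolding tower_le_def tower_lub_def by auto
  show "tower_lub M \<in> Field (tower_le Jsub P)" if "M \<noteq> {}"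
    using tower_chain(1)[OF M that profinite_axioms] by (simp add: Field_tower_le tower_lub_def)
qed (rule succ_le)

text \<open>Only \<open>x\<close> itself is an iterate above a fixed point \<open>x\<close>, and any
  two iterates are comparable. This identifies the place where a maximal lift stops with
  \<open>fixp_above a\<close>.\<close>

lemma fixpoint_unique:
  assumes a: "a \<in> Field (tower_le Jsub P)" and x: "x \<in> iterates_above a" "tower_succ Jsub P x = x"
  shows "x = fixp_above a"
proof -
  have xF: "x \<in> Field (tower_le Jsub P)" using iterates_above_Field[OF x(1) a] .
  have "y = x" if "y \<in> iterates_above x" for y
    using that
  proof induction
    case (Sup M)
    then have "M = {x}" by auto
    then show ?case using xF by (intro leq_antisym lub_least lub_upper Sup) (auto intro: leq_refl)
  qed (use x in auto)
  moreover have "y = fixp_above a" if "y \<in> iterates_above (fixp_above a)" for y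
    using that
  proof induction
    case (Sup M)
    then have "M = {fixp_above a}" by auto
    then show ?case using fixp_above_Field[OF a] by (intro leq_antisym lub_least lub_upper Sup) (auto intro: leq_refl)
  qed (use fixp_above_unfold[OF a] in auto)
  ultimately show ?thesis using iterates_above_triangle[OF x(1) fixp_iterates_above a] by metis
qed

lemma fixp_rel_SEP:
  assumes a: "a \<in> Field (tower_le Jsub P)"
  shows "rel_SEP Jsub P (fst (fixp_above a)) (snd (fixp_above a))"
proof (rule ccontr)
  let ?x = "fixp_above a"
  assume neg: "\<not> ?thesis"
  have rs: "rel_sorting Jsub P (fst ?x) (snd ?x)" using fixp_above_Field[OF a] by (simp add: Field_tower_le)
  have ex: "\<exists>y. extension_step Jsub P ?x y"
    using extension_step_exists[OF Jok profinite_axioms SEP_P rs neg] by simp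
  then have "extension_step Jsub P ?x (tower_succ Jsub P ?x)" by (simp add: tower_succ_def someI_ex)
  from extension_stepD(4)[OF Jok profinite_axioms rs this] show False
    using fixp_above_unfold[OF a] by metis
qed

text \<open>Lifts at successive stages involve choices that have to fit together at limits. Zorn's
  lemma is therefore applied to pairs of an iterate and a lift to it, ordered by refinement; a
  maximal pair sits at a fixed point.\<close>

lemma fixp_lift:
  fixes E :: "'c tgroup"
  assumes a: "a \<in> Field (tower_le Jsub P)" and E: "sorted_profinite Jsub E FE" "SEP Jsub E FE"
    and q0: "rel_lift E FE P (fst a) (snd a) q0"
  shows "\<exists>q. rel_lift E FE P (fst (fixp_above a)) (snd (fixp_above a)) q \<and> (\<forall>e\<in>carrier E. q e \<subseteq> q0 e)"
proof -
  have Ep: "profinite E" using sorted_profiniteD(1)[OF E(1)] .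
  \<comment> \<open>Lifts are empty off the carrier, so that refinement is antisymmetric.\<close>
  define S where "S = {(x, q). x \<in> iterates_above a \<and> rel_lift E FE P (fst x) (snd x) q \<and>
    (\<forall>e. e \<notin> carrier E \<longrightarrow> q e = {}) \<and> (\<forall>e\<in>carrier E. q e \<subseteq> q0 e)}"
  define r where "r = {(z, z'). z \<in> S \<and> z' \<in> S \<and> (fst z, fst z') \<in> tower_le Jsub P \<and> (\<forall>e. snd z' e \<subseteq> snd z e)}"
  have norm: "rel_lift E FE P K \<Phi> (\<lambda>e. if e \<in> carrier E then q e else {}) \<longleftrightarrow> rel_lift E FE P K \<Phi> q" for K \<Phi> q
  proof -
    interpret E: profinite E by (rule Ep)
    have "{e \<in> carrier E. (if e \<in> carrier E then q e else {}) \<subseteq> N} = {e \<in> carrier E. q e \<subseteq> N}" for N by auto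
    then show ?thesis unfolding rel_lift_def by (simp cong: conj_cong)
  qed
  have FS: "Field r = S"
  proof -
    have "(fst z, fst z) \<in> tower_le Jsub P" if "z \<in> S" for z
      using that iterates_above_Field[OF _ a] leq_refl by (auto simp: S_def)
    then have "(z, z) \<in> r" if "z \<in> S" for z using that by (simp add: r_def)
    then show ?thesis by (auto intro: FieldI1) (auto simp: Field_def r_def)
  qed
  have po: "Partial_order r"
    unfolding partial_order_on_def preorder_on_def FS
  proof (intro conjI)
    show "refl_on S r"
      using FS unfolding refl_on_def r_def S_def
      using iterates_above_Field[OF _ a] leq_refl by auto
    show "trans r" unfolding trans_def r_def by (auto intro: leq_trans)
    show "antisym r"
    proof (rule antisymI)
      fix z z' assume "(z, z') \<in> r" "(z', z) \<in> r"
      then have "fst z = fst z'" "snd z e = snd z' e" for e unfolding r_def by (auto intro: leq_antisym)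
      then show "z = z'" by (metis ext prod_eqI)
    qed
  qed (auto simp: r_def)
  define b where "b = (a, \<lambda>e. if e \<in> carrier E then q0 e else {})"
  have b: "b \<in> S" unfolding S_def b_def using q0 norm iterates_above.base by auto
  have "\<exists>m\<in>Field r. \<forall>z\<in>Field r. (m, z) \<in> r \<longrightarrow> z = m"
  proof (rule Zorns_po_lemma[OF po])
    fix C assume C: "C \<in> Chains r"
    show "\<exists>u\<in>Field r. \<forall>z\<in>C. (z, u) \<in> r"
    proof (cases "C = {}")
      case True
      then show ?thesis using b unfolding FS by (intro bexI[of _ b]) simp_all
    next
      case False
      have CS: "z \<in> S" if "z \<in> C" for z using C that unfolding Chains_def r_def by auto
      have comp: "(z, z') \<in> r \<or> (z', z) \<in> r" if "z \<in> C" "z' \<in> C" for z z' using C that unfolding Chains_def by auto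
      have ch: "fst ` C \<in> Chains (tower_le Jsub P)"
      proof -
        have "(fst z, fst z') \<in> tower_le Jsub P \<or> (fst z', fst z) \<in> tower_le Jsub P" if "z \<in> C" "z' \<in> C" for z z'
          using comp[OF that] unfolding r_def by auto
        then show ?thesis unfolding Chains_def by simp
      qed
      define u where "u = (tower_lub (fst ` C), \<lambda>e. \<Inter>z\<in>C. snd z e)"
      have "rel_lift E FE P (\<Inter>x\<in>fst ` C. fst x) (\<lambda>N. \<Union>x\<in>fst ` C. snd x N) (\<lambda>e. \<Inter>z\<in>C. snd z e)"
      proof (rule rel_lift_chain[OF profinite_axioms Ep False ch])
        show "rel_lift E FE P (fst x) (snd x) q" if "(x, q) \<in> C" for x q using CS[OF that] by (simp add: S_def)
        show "fst x' \<subseteq> fst x \<and> (\<forall>e\<in>carrier E. q' e \<subseteq> q e) \<or> fst x \<subseteq> fst x' \<and> (\<forall>e\<in>carrier E. q e \<subseteq> q' e)"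
          if "(x, q) \<in> C" "(x', q') \<in> C" for x q x' q'
          using comp[OF that] unfolding r_def tower_le_def by auto
      qed
      moreover have "tower_lub (fst ` C) \<in> iterates_above a"
        using False CS by (intro iterates_above.Sup[OF ch]) (auto simp: S_def)
      moreover obtain z0 where "z0 \<in> C" using False by auto
      ultimately have uS: "u \<in> S"
        using CS[OF \<open>z0 \<in> C\<close>] unfolding S_def u_def tower_lub_def by fastforce
      have "(z, u) \<in> r" if "z \<in> C" for z
        using uS CS[OF that] that lub_upper[OF ch, of "fst z"] unfolding r_def u_def by auto
      then show ?thesis unfolding FS using uS by (intro bexI[of _ u] ballI)
    qed
  qed
  then obtain x q where m: "(x, q) \<in> S" "\<And>z. z \<in> S \<Longrightarrow> ((x, q), z) \<in> r \<Longrightarrow> z = (x, q)" unfolding FS by auto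
  have xi: "x \<in> iterates_above a" and xl: "rel_lift E FE P (fst x) (snd x) q" and qq: "\<forall>e\<in>carrier E. q e \<subseteq> q0 e"
    and qn: "\<forall>e. e \<notin> carrier E \<longrightarrow> q e = {}"
    using m(1) by (auto simp: S_def)
  have xF: "x \<in> Field (tower_le Jsub P)" using iterates_above_Field[OF xi a] .
  \<comment> \<open>A step would give a pair above the maximal one, and maximality turns this into
    \<open>?y = x\<close>.\<close>
  have "tower_succ Jsub P x = x"
  proof (cases "\<exists>y. extension_step Jsub P x y")
    case True
    let ?y = "tower_succ Jsub P x"
    have st: "extension_step Jsub P x ?y" using True by (simp add: tower_succ_def someI_ex)
    have rs: "rel_sorting Jsub P (fst x) (snd x)" using xF by (simp add: Field_tower_le)
    obtain q' where q': "rel_lift E FE P (fst ?y) (snd ?y) q'" "\<forall>e\<in>carrier E. q' e \<subseteq> q e"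
      using extension_step_lift[OF Jok profinite_axioms rs st E xl] by auto
    let ?z = "(?y, \<lambda>e. if e \<in> carrier E then q' e else {})"
    have "?z \<in> S" using q' qq norm iterates_above.step[OF xi] unfolding S_def by fastforce
    moreover have "((x, q), ?z) \<in> r"
      using m(1) \<open>?z \<in> S\<close> q' succ_le[OF xF] unfolding r_def by auto
    ultimately have "?z = (x, q)" by (rule m(2))
    then show ?thesis by (rule Pair_inject)
  qed (simp add: tower_succ_def)
  then show ?thesis using fixpoint_unique[OF a xi] xl qq by auto
qed

end

section \<open>Closed subgroups of products of finite groups\<close>

text \<open>A finite group given by its multiplication table, with 0 as neutral element. Tables form
  a countable type, so all finite groups up to isomorphism are available without making the index
  set of the product too large.\<close>

definition tab_group :: "nat list list \<Rightarrow> nat monoid" where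
  "tab_group T = \<lparr>carrier = {..<length T}, monoid.mult = \<lambda>x y. T ! x ! y, one = 0\<rparr>"

lemma iso_transport_group:
  assumes "group A" "bij_betw h (carrier A) (carrier B)"
    and "\<And>x y. x \<in> carrier A \<Longrightarrow> y \<in> carrier A \<Longrightarrow> h (x \<otimes>\<^bsub>A\<^esub> y) = h x \<otimes>\<^bsub>B\<^esub> h y" "h \<one>\<^bsub>A\<^esub> = \<one>\<^bsub>B\<^esub>"
  shows "group B" "h \<in> iso A B"
proof -
  interpret A: group A by fact
  have B: "carrier B = h ` carrier A" using assms(2) by (auto simp: bij_betw_def)
  show "group B"
  proof (rule groupI)
    show "\<exists>y\<in>carrier B. y \<otimes>\<^bsub>B\<^esub> x = \<one>\<^bsub>B\<^esub>" if x: "x \<in> carrier B" for x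
    proof -
      obtain a where a: "a \<in> carrier A" "x = h a" using x B by auto
      then have "h (inv\<^bsub>A\<^esub> a) \<otimes>\<^bsub>B\<^esub> x = \<one>\<^bsub>B\<^esub>" using assms(3)[of "inv\<^bsub>A\<^esub> a" a, symmetric] assms(4) by simp
      then show ?thesis using a B by auto
    qed
  qed (auto simp: B assms(3,4)[symmetric] A.m_assoc)
  show "h \<in> iso A B" using assms by (auto simp: iso_def hom_def bij_betw_def)
qed

lemma ex_tab_group_iso:
  assumes "group A" "finite (carrier A)"
  shows "\<exists>T h. group (tab_group T) \<and> h \<in> iso A (tab_group T)"
proof -
  interpret A: group A by fact
  let ?n = "card (carrier A)"
  obtain g where g: "bij_betw g (carrier A) {0..<?n}" using ex_bij_betw_finite_nat[OF assms(2)] by auto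
  \<comment> \<open>The transposition moves the number of the neutral element to 0.\<close>
  define h where "h x = Transposition.transpose (g \<one>\<^bsub>A\<^esub>) 0 (g x)" for x
  have npos: "0 < ?n" using assms(2) A.one_closed by (metis card_gt_0_iff empty_iff)
  have g1: "g \<one>\<^bsub>A\<^esub> \<in> {0..<?n}" using g A.one_closed by (auto simp: bij_betw_def)
  have "bij_betw (Transposition.transpose (g \<one>\<^bsub>A\<^esub>) 0) {0..<?n} {0..<?n}"
    using permutes_imp_bij[OF permutes_swap_id[OF g1, of 0]] npos by simp
  then have h: "bij_betw h (carrier A) {0..<?n}"
    using bij_betw_trans[OF g] by (simp add: h_def[abs_def] comp_def)
  have h1: "h \<one>\<^bsub>A\<^esub> = 0" by (simp add: h_def)
  define k where "k = inv_into (carrier A) h"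
  have k: "k (h x) = x" if "x \<in> carrier A" for x
    using that h by (simp add: k_def bij_betw_def)
  define T where "T = map (\<lambda>x. map (\<lambda>y. h (k x \<otimes>\<^bsub>A\<^esub> k y)) [0..<?n]) [0..<?n]"
  have "bij_betw h (carrier A) (carrier (tab_group T))"
    using h by (simp add: tab_group_def T_def atLeast0LessThan)
  moreover have "h (x \<otimes>\<^bsub>A\<^esub> y) = h x \<otimes>\<^bsub>tab_group T\<^esub> h y" if "x \<in> carrier A" "y \<in> carrier A" for x y
  proof -
    have "h x < ?n" "h y < ?n" using h that by (auto simp: bij_betw_def)
    then show ?thesis using that by (simp add: tab_group_def T_def k)
  qed
  moreover have "h \<one>\<^bsub>A\<^esub> = \<one>\<^bsub>tab_group T\<^esub>" using h1 by (simp add: tab_group_def)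
  ultimately show ?thesis using iso_transport_group[OF assms(1)] by blast
qed

text \<open>
  The closure of the subgroup generated by \<open>\<iota>\<close> in the product of the finite discrete groups \<open>A i\<close>.
\<close>

definition closure_group :: "'i set \<Rightarrow> ('i \<Rightarrow> nat monoid) \<Rightarrow> ('x \<Rightarrow> 'i \<Rightarrow> nat) \<Rightarrow> ('i \<Rightarrow> nat) tgroup" where
  "closure_group I A \<iota> = (let C = {x \<in> \<Pi>\<^sub>E i\<in>I. carrier (A i). \<forall>J. finite J \<and> J \<subseteq> I \<longrightarrow>
       (\<exists>y\<in>generate (product_group I A) (range \<iota>). \<forall>j\<in>J. x j = y j)}
     in \<lparr>carrier = C, monoid.mult = \<lambda>x y. \<lambda>i\<in>I. x i \<otimes>\<^bsub>A i\<^esub> y i, one = \<lambda>i\<in>I. \<one>\<^bsub>A i\<^esub>,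
       gtop = subtopology (product_topology (\<lambda>i. discrete_topology (carrier (A i))) I) C\<rparr>)"

locale generated_product =
  fixes I :: "'i set" and A :: "'i \<Rightarrow> nat monoid" and \<iota> :: "'x \<Rightarrow> 'i \<Rightarrow> nat"
  assumes A_group: "\<And>i. i \<in> I \<Longrightarrow> group (A i)" and A_finite: "\<And>i. i \<in> I \<Longrightarrow> finite (carrier (A i))"
    and \<iota>: "\<And>x. \<iota> x \<in> (\<Pi>\<^sub>E i\<in>I. carrier (A i))"
begin

abbreviation "W \<equiv> product_group I A"
abbreviation "P \<equiv> closure_group I A \<iota>"
abbreviation "gens \<equiv> generate W (range \<iota>)"

lemma W: "group W" using A_group by simp

lemma range_W: "range \<iota> \<subseteq> carrier W" using \<iota> by auto

lemma one_P: "\<one>\<^bsub>P\<^esub> = \<one>\<^bsub>W\<^esub>" and mult_P: "(\<otimes>\<^bsub>P\<^esub>) = (\<otimes>\<^bsub>W\<^esub>)"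
  by (simp_all add: closure_group_def Let_def)

lemma carrier_P: "carrier P = {x \<in> carrier W. \<forall>J. finite J \<and> J \<subseteq> I \<longrightarrow> (\<exists>y\<in>gens. \<forall>j\<in>J. x j = y j)}"
  and top_P: "gtop P = subtopology (product_topology (\<lambda>i. discrete_topology (carrier (A i))) I) (carrier P)"
  by (simp_all add: closure_group_def Let_def)

lemma carrier_PD: "x \<in> carrier P \<Longrightarrow> x \<in> carrier W" "x \<in> carrier P \<Longrightarrow> i \<in> I \<Longrightarrow> x i \<in> carrier (A i)"
    "x \<in> carrier P \<Longrightarrow> finite J \<Longrightarrow> J \<subseteq> I \<Longrightarrow> \<exists>y\<in>gens. \<forall>j\<in>J. x j = y j"
  unfolding carrier_P by auto

lemma gens_W: "gens \<subseteq> carrier W" using group.generate_incl[OF W range_W] .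

lemma gens_subgroup: "subgroup gens W" using group.generate_is_subgroup[OF W range_W] .

lemma gens_P: "gens \<subseteq> carrier P" unfolding carrier_P using gens_W by blast

lemma P_subgroup: "subgroup (carrier P) W"
proof (rule group.subgroupI[OF W])
  interpret W: group W by (rule W)
  show "carrier P \<subseteq> carrier W" using carrier_PD(1) by blast
  show "carrier P \<noteq> {}" using gens_P subgroup.one_closed[OF gens_subgroup] by blast
  show "inv\<^bsub>W\<^esub> x \<in> carrier P" if x: "x \<in> carrier P" for x
    unfolding carrier_P
  proof (intro CollectI conjI allI impI)
    show "inv\<^bsub>W\<^esub> x \<in> carrier W" using carrier_PD(1)[OF x] by (rule W.inv_closed)
    fix J assume J: "finite J \<and> J \<subseteq> I"
    then obtain y where y: "y \<in> gens" "\<forall>j\<in>J. x j = y j" using carrier_PD(3)[OF x, of J] by auto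
    have "\<forall>j\<in>J. (inv\<^bsub>W\<^esub> x) j = (inv\<^bsub>W\<^esub> y) j"
      using y J carrier_PD(1)[OF x] subsetD[OF gens_W y(1)] A_group by (auto simp: inv_product_group)
    then show "\<exists>y\<in>gens. \<forall>j\<in>J. (inv\<^bsub>W\<^esub> x) j = y j"
      using subgroup.m_inv_closed[OF gens_subgroup y(1)] by blast
  qed
  show "x \<otimes>\<^bsub>W\<^esub> z \<in> carrier P" if x: "x \<in> carrier P" and z: "z \<in> carrier P" for x z
    unfolding carrier_P
  proof (intro CollectI conjI allI impI)
    show "x \<otimes>\<^bsub>W\<^esub> z \<in> carrier W" using carrier_PD(1)[OF x] carrier_PD(1)[OF z] by (rule W.m_closed)
    fix J assume J: "finite J \<and> J \<subseteq> I"
    obtain y where y: "y \<in> gens" "\<forall>j\<in>J. x j = y j" using carrier_PD(3)[OF x, of J] J by auto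
    obtain w where w: "w \<in> gens" "\<forall>j\<in>J. z j = w j" using carrier_PD(3)[OF z, of J] J by auto
    have "\<forall>j\<in>J. (x \<otimes>\<^bsub>W\<^esub> z) j = (y \<otimes>\<^bsub>W\<^esub> w) j" using y w J by auto
    then show "\<exists>y\<in>gens. \<forall>j\<in>J. (x \<otimes>\<^bsub>W\<^esub> z) j = y j"
      using subgroup.m_closed[OF gens_subgroup y(1) w(1)] by blast
  qed
qed

lemma P_group: "group P"
proof -
  interpret W: group W by (rule W)
  show ?thesis
  proof (rule groupI)
    show "\<exists>y\<in>carrier P. y \<otimes>\<^bsub>P\<^esub> x = \<one>\<^bsub>P\<^esub>" if x: "x \<in> carrier P" for x
      using subgroup.m_inv_closed[OF P_subgroup x] W.l_inv[OF carrier_PD(1)[OF x]]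
      unfolding one_P mult_P by (intro bexI)
  qed (use P_subgroup carrier_PD(1) in
      \<open>simp_all add: one_P mult_P subgroup.one_closed subgroup.m_closed W.m_assoc W.l_one
        del: mult_product_group one_product_group\<close>)
qed

lemma inv_P: "x \<in> carrier P \<Longrightarrow> inv\<^bsub>P\<^esub> x = inv\<^bsub>W\<^esub> x"
proof -
  interpret W: group W by (rule W)
  interpret P: group P by (rule P_group)
  assume x: "x \<in> carrier P"
  have "inv\<^bsub>W\<^esub> x \<otimes>\<^bsub>P\<^esub> x = \<one>\<^bsub>P\<^esub>"
    unfolding one_P mult_P using W.l_inv[OF carrier_PD(1)[OF x]] .
  then show ?thesis using P.inv_equality[OF _ x] subgroup.m_inv_closed[OF P_subgroup x] by simp
qed

lemma proj: "i \<in> I \<Longrightarrow> x \<in> carrier P \<Longrightarrow> y \<in> carrier P \<Longrightarrow> (x \<otimes>\<^bsub>P\<^esub> y) i = x i \<otimes>\<^bsub>A i\<^esub> y i"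
    "i \<in> I \<Longrightarrow> \<one>\<^bsub>P\<^esub> i = \<one>\<^bsub>A i\<^esub>" "i \<in> I \<Longrightarrow> x \<in> carrier P \<Longrightarrow> (inv\<^bsub>P\<^esub> x) i = inv\<^bsub>A i\<^esub> (x i)"
  using carrier_PD(1) by (auto simp: mult_P one_P inv_P A_group)

lemma \<iota>_P: "\<iota> x \<in> carrier P"
  by (rule subsetD[OF gens_P generate.incl[OF rangeI]])

lemma gens_eq: "generate P (range \<iota>) = gens"
proof -
  have r: "range \<iota> \<subseteq> carrier P" using \<iota>_P by auto
  have "y \<in> gens" if "y \<in> generate P (range \<iota>)" for y
    using that
  proof induction
    case one
    then show ?case unfolding one_P by (rule generate.one)
  next
    case (inv h)
    then show ?case using r inv_P[of h] generate.inv[of h "range \<iota>" W] by (simp add: subset_iff)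
  next
    case (eng h1 h2)
    then show ?case unfolding mult_P by (intro generate.eng)
  qed (rule generate.incl)
  moreover have "y \<in> generate P (range \<iota>)" if "y \<in> gens" for y
    using that
  proof induction
    case one
    then show ?case unfolding one_P[symmetric] by (rule generate.one)
  next
    case (inv h)
    then show ?case using r inv_P[of h] generate.inv[of h "range \<iota>" P] by (simp add: subset_iff)
  next
    case (eng h1 h2)
    then show ?case unfolding mult_P[symmetric] by (intro generate.eng)
  qed (rule generate.incl)
  ultimately show ?thesis by blast
qed

text \<open>For finite \<open>J\<close> these are the basic neighbourhoods of the product topology;
  around 1 they are the kernels of projections to finitely many coordinates.\<close>

definition near :: "'i set \<Rightarrow> ('i \<Rightarrow> nat) \<Rightarrow> ('i \<Rightarrow> nat) set" where
  "near J x = {z \<in> carrier P. \<forall>j\<in>J. z j = x j}"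

lemma topspace_P: "topspace (gtop P) = carrier P"
  unfolding top_P using carrier_PD(1) by auto

lemma open_near:
  assumes "finite J" "J \<subseteq> I" "x \<in> carrier P"
  shows "openin (gtop P) (near J x)"
proof -
  let ?U = "\<lambda>i. if i \<in> J then {x i} else carrier (A i)"
  have "openin (product_topology (\<lambda>i. discrete_topology (carrier (A i))) I) (Pi\<^sub>E I ?U)"
  proof (subst openin_PiE_gen, rule disjI2, intro conjI ballI)
    have "{i \<in> I. ?U i \<noteq> topspace (discrete_topology (carrier (A i)))} \<subseteq> J" by auto
    then show "finite {i \<in> I. ?U i \<noteq> topspace (discrete_topology (carrier (A i)))}"
      using assms(1) finite_subset by blast
  qed (use carrier_PD(2)[OF assms(3)] in auto)
  moreover have "near J x = Pi\<^sub>E I ?U \<inter> carrier P"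
  proof
    show "near J x \<subseteq> Pi\<^sub>E I ?U \<inter> carrier P"
      using carrier_PD(1) by (auto simp: near_def PiE_iff extensional_def)
    show "Pi\<^sub>E I ?U \<inter> carrier P \<subseteq> near J x"
      using assms(2) by (auto simp: near_def PiE_iff subset_iff split: if_splits)
  qed
  ultimately show ?thesis unfolding top_P openin_subtopology by blast
qed

lemma near_base:
  assumes U: "openin (gtop P) U" "x \<in> U"
  shows "\<exists>J. finite J \<and> J \<subseteq> I \<and> near J x \<subseteq> U"
proof -
  obtain V where V: "openin (product_topology (\<lambda>i. discrete_topology (carrier (A i))) I) V" "U = V \<inter> carrier P"
    using U(1) unfolding top_P openin_subtopology by auto
  obtain S where S: "finite {i \<in> I. S i \<noteq> carrier (A i)}" "x \<in> Pi\<^sub>E I S" "Pi\<^sub>E I S \<subseteq> V"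
    using V U(2) unfolding openin_product_topology_alt by force
  let ?J = "{i \<in> I. S i \<noteq> carrier (A i)}"
  have "z \<in> Pi\<^sub>E I S" if z: "z \<in> near ?J x" for z
  proof -
    have zP: "z \<in> carrier P" using z by (simp add: near_def)
    have "z i \<in> S i" if i: "i \<in> I" for i
      using S(2) z carrier_PD(2)[OF zP i] i by (cases "S i = carrier (A i)") (auto simp: near_def PiE_iff)
    then show ?thesis using carrier_PD(1)[OF zP] by (auto simp: PiE_iff)
  qed
  then have "near ?J x \<subseteq> V" using S(3) by (meson subset_eq)
  then have "near ?J x \<subseteq> U" using V(2) by (auto simp: near_def)
  then show ?thesis using S(1) by blast
qed

lemma near_normal:
  assumes "J \<subseteq> I"
  shows "near J \<one>\<^bsub>P\<^esub> \<lhd> P" and "x \<in> carrier P \<Longrightarrow> near J \<one>\<^bsub>P\<^esub> #>\<^bsub>P\<^esub> x = near J x"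
proof -
  interpret P: group P by (rule P_group)
  have mem: "z \<in> near J \<one>\<^bsub>P\<^esub> \<longleftrightarrow> z \<in> carrier P \<and> (\<forall>j\<in>J. z j = \<one>\<^bsub>A j\<^esub>)" for z
    using assms by (auto simp: near_def proj subset_iff)
  have Ag: "group (A j)" "j \<in> I" if "j \<in> J" for j using that assms A_group by auto
  show "near J \<one>\<^bsub>P\<^esub> \<lhd> P"
    unfolding P.normal_inv_iff
  proof (intro conjI ballI)
    show "subgroup (near J \<one>\<^bsub>P\<^esub>) P"
    proof (rule P.subgroupI)
      show "near J \<one>\<^bsub>P\<^esub> \<noteq> {}" using mem[of "\<one>\<^bsub>P\<^esub>"] Ag proj(2) by auto
      show "inv\<^bsub>P\<^esub> a \<in> near J \<one>\<^bsub>P\<^esub>" if "a \<in> near J \<one>\<^bsub>P\<^esub>" for a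
        using that Ag unfolding mem by (auto simp: proj group.is_monoid monoid.inv_one)
      show "a \<otimes>\<^bsub>P\<^esub> b \<in> near J \<one>\<^bsub>P\<^esub>" if "a \<in> near J \<one>\<^bsub>P\<^esub>" "b \<in> near J \<one>\<^bsub>P\<^esub>" for a b
        using that Ag unfolding mem by (auto simp: proj group.is_monoid)
    qed (auto simp: mem)
    show "x \<otimes>\<^bsub>P\<^esub> h \<otimes>\<^bsub>P\<^esub> inv\<^bsub>P\<^esub> x \<in> near J \<one>\<^bsub>P\<^esub>" if "x \<in> carrier P" "h \<in> near J \<one>\<^bsub>P\<^esub>" for x h
      using that Ag carrier_PD(2)[OF that(1)] unfolding mem
      by (auto simp: proj group.is_monoid group.r_inv monoid.r_one)
  qed
  assume x: "x \<in> carrier P"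
  show "near J \<one>\<^bsub>P\<^esub> #>\<^bsub>P\<^esub> x = near J x"
  proof -
    have "z \<otimes>\<^bsub>P\<^esub> inv\<^bsub>P\<^esub> x \<in> near J \<one>\<^bsub>P\<^esub> \<longleftrightarrow> z \<in> near J x" if z: "z \<in> carrier P" for z
    proof -
      have "z j \<otimes>\<^bsub>A j\<^esub> inv\<^bsub>A j\<^esub> (x j) = \<one>\<^bsub>A j\<^esub> \<longleftrightarrow> z j = x j" if "j \<in> J" for j
        using group.mult_inv_eq_one_iff[OF Ag(1)] carrier_PD(2)[OF z] carrier_PD(2)[OF x] Ag(2) that by simp
      then show ?thesis using x z Ag unfolding mem by (auto simp: proj near_def)
    qed
    moreover have "near J \<one>\<^bsub>P\<^esub> \<subseteq> carrier P" by (auto simp: near_def)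
    moreover have "near J x \<subseteq> carrier P" by (auto simp: near_def)
    ultimately show ?thesis using x by (subst P.r_coset_eq_vimage) auto
  qed
qed

lemma closed_P: "closedin (product_topology (\<lambda>i. discrete_topology (carrier (A i))) I) (carrier P)"
proof -
  let ?T = "product_topology (\<lambda>i. discrete_topology (carrier (A i))) I"
  have "openin ?T (topspace ?T - carrier P)"
  proof (subst openin_subopen, rule ballI)
    fix x assume x: "x \<in> topspace ?T - carrier P"
    then have xW: "x \<in> carrier W" by simp
    then obtain J where J: "finite J" "J \<subseteq> I" "\<not> (\<exists>y\<in>gens. \<forall>j\<in>J. x j = y j)"
      using x unfolding carrier_P by auto
    let ?U = "\<lambda>i. if i \<in> J then {x i} else carrier (A i)"
    have "openin ?T (Pi\<^sub>E I ?U)"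
    proof (subst openin_PiE_gen, rule disjI2, intro conjI ballI)
      have "{i \<in> I. ?U i \<noteq> topspace (discrete_topology (carrier (A i)))} \<subseteq> J" by auto
      then show "finite {i \<in> I. ?U i \<noteq> topspace (discrete_topology (carrier (A i)))}"
        using J(1) finite_subset by blast
    qed (use xW in auto)
    moreover have "x \<in> Pi\<^sub>E I ?U" using xW by (auto simp: PiE_iff)
    moreover have "Pi\<^sub>E I ?U \<subseteq> topspace ?T - carrier P"
    proof
      fix z assume z: "z \<in> Pi\<^sub>E I ?U"
      have zx: "z j = x j" if "j \<in> J" for j using z that J(2) by (auto simp: PiE_iff subset_iff split: if_splits)
      have "z \<in> topspace ?T" using z xW by (auto simp: PiE_iff split: if_splits)
      moreover have "z \<notin> carrier P" using carrier_PD(3)[OF _ J(1,2)] J(3) zx by metis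
      ultimately show "z \<in> topspace ?T - carrier P" by simp
    qed
    ultimately show "\<exists>U. openin ?T U \<and> x \<in> U \<and> U \<subseteq> topspace ?T - carrier P" by blast
  qed
  then show ?thesis using carrier_PD(1) by (auto simp: closedin_def)
qed

lemma P_profinite: "profinite P"
proof (rule profiniteI, rule profinite_group_of_base[OF P_group topspace_P])
  interpret P: group P by (rule P_group)
  let ?T = "product_topology (\<lambda>i. discrete_topology (carrier (A i))) I"
  have "compact_space ?T"
    using A_finite by (auto simp: compact_space_product_topology compact_space_discrete_topology)
  then show "compact_space (gtop P)"
    unfolding top_P using closedin_compact_space[OF _ closed_P] by (simp add: compact_space_subtopology)
  have one: "\<one>\<^bsub>P\<^esub> \<in> carrier P" by simp
  show "\<exists>N. N \<lhd> P \<and> openin (gtop P) N \<and> N #>\<^bsub>P\<^esub> x \<subseteq> U" if U: "openin (gtop P) U" "x \<in> U" for U x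
  proof -
    have x: "x \<in> carrier P" using openin_subset[OF U(1)] U(2) topspace_P by auto
    obtain J where J: "finite J" "J \<subseteq> I" "near J x \<subseteq> U" using near_base[OF U] by auto
    then show ?thesis using near_normal[OF J(2)] x open_near[OF J(1,2) one] by metis
  qed
  show "openin (gtop P) (N #>\<^bsub>P\<^esub> x)" if N: "N \<lhd> P" "openin (gtop P) N" "x \<in> carrier P" for N x
  proof (subst openin_subopen, rule ballI)
    fix z assume z: "z \<in> N #>\<^bsub>P\<^esub> x"
    note Nn = P.normalD[OF N(1)]
    have zP: "z \<in> carrier P" using z P.mem_rcos_iff[OF Nn(1) N(3)] by simp
    obtain J where J: "finite J" "J \<subseteq> I" "near J \<one>\<^bsub>P\<^esub> \<subseteq> N" using near_base[OF N(2) Nn(3)] by auto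
    have "near J z \<subseteq> N #>\<^bsub>P\<^esub> z"
      using near_normal(2)[OF J(2) zP] J(3) by (auto simp: r_coset_def)
    also have "N #>\<^bsub>P\<^esub> z = N #>\<^bsub>P\<^esub> x" using P.repr_independence[OF z N(3) Nn(1)] by simp
    finally show "\<exists>T. openin (gtop P) T \<and> z \<in> T \<and> T \<subseteq> N #>\<^bsub>P\<^esub> x"
      using open_near[OF J(1,2) zP] zP by (intro exI[of _ "near J z"]) (auto simp: near_def)
  qed
  show "\<exists>N. N \<lhd> P \<and> openin (gtop P) N \<and> x \<notin> N" if x: "x \<in> carrier P" "x \<noteq> \<one>\<^bsub>P\<^esub>" for x
  proof -
    have "\<exists>i\<in>I. x i \<noteq> \<one>\<^bsub>P\<^esub> i"
    proof (rule ccontr)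
      assume neg: "\<not> ?thesis"
      have "x \<in> (\<Pi>\<^sub>E i\<in>I. carrier (A i))" "\<one>\<^bsub>P\<^esub> \<in> (\<Pi>\<^sub>E i\<in>I. carrier (A i))"
        using carrier_PD(1)[OF x(1)] carrier_PD(1)[OF one] by simp_all
      then have "x = \<one>\<^bsub>P\<^esub>" by (rule PiE_ext) (use neg in auto)
      then show False using x(2) by simp
    qed
    then obtain i where i: "i \<in> I" "x i \<noteq> \<one>\<^bsub>P\<^esub> i" by auto
    then show ?thesis
      using near_normal(1)[of "{i}"] open_near[of "{i}", OF _ _ one] by (intro exI[of _ "near {i} \<one>\<^bsub>P\<^esub>"]) (auto simp: near_def)
  qed
qed

text \<open>The open kernel contains a basic neighbourhood of 1. Since elements of
  \<open>gens\<close> realise every finite pattern of coordinates found in \<open>P\<close>, maps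
  with open kernel are thereby governed by the generators.\<close>

lemma hom_near:
  assumes \<phi>: "group_hom P B \<phi>" and o: "openin (gtop P) (\<phi> -` {\<one>\<^bsub>B\<^esub>} \<inter> carrier P)"
  shows "\<exists>J. finite J \<and> J \<subseteq> I \<and> (\<forall>x\<in>carrier P. \<forall>y\<in>carrier P. (\<forall>j\<in>J. x j = y j) \<longrightarrow> \<phi> x = \<phi> y)"
proof -
  interpret group_hom P B \<phi> by fact
  obtain J where J: "finite J" "J \<subseteq> I" "near J \<one>\<^bsub>P\<^esub> \<subseteq> \<phi> -` {\<one>\<^bsub>B\<^esub>} \<inter> carrier P"
    using near_base[OF o, of "\<one>\<^bsub>P\<^esub>"] by auto
  have "\<phi> x = \<phi> y" if "x \<in> carrier P" "y \<in> carrier P" "\<forall>j\<in>J. x j = y j" for x y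
  proof -
    have "x \<in> near J y" using that by (simp add: near_def)
    then have "x \<otimes>\<^bsub>P\<^esub> inv\<^bsub>P\<^esub> y \<in> near J \<one>\<^bsub>P\<^esub>"
      using near_normal(2)[OF J(2) that(2)]
        G.mem_rcos_iff[OF G.normalD(1)[OF near_normal(1)[OF J(2)]] that(2), of x] by simp
    then have "\<phi> (x \<otimes>\<^bsub>P\<^esub> inv\<^bsub>P\<^esub> y) = \<one>\<^bsub>B\<^esub>" using J(3) by auto
    then show ?thesis using that H.mult_inv_eq_one_iff by simp
  qed
  then show ?thesis using J by blast
qed

lemma hom_image_gens:
  assumes \<phi>: "group_hom P B \<phi>" and o: "openin (gtop P) (\<phi> -` {\<one>\<^bsub>B\<^esub>} \<inter> carrier P)" and x: "x \<in> carrier P"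
  shows "\<exists>y\<in>gens. \<phi> x = \<phi> y"
proof -
  obtain J where J: "finite J" "J \<subseteq> I" "\<And>x y. x \<in> carrier P \<Longrightarrow> y \<in> carrier P \<Longrightarrow> \<forall>j\<in>J. x j = y j \<Longrightarrow> \<phi> x = \<phi> y"
    using hom_near[OF \<phi> o] by blast
  obtain y where y: "y \<in> gens" "\<forall>j\<in>J. x j = y j" using carrier_PD(3)[OF x J(1,2)] by auto
  then show ?thesis using J(3)[OF x subsetD[OF gens_P y(1)]] by auto
qed

lemma hom_image:
  assumes \<phi>: "group_hom P B \<phi>" and o: "openin (gtop P) (\<phi> -` {\<one>\<^bsub>B\<^esub>} \<inter> carrier P)"
  shows "\<phi> ` carrier P = generate B (range (\<lambda>x. \<phi> (\<iota> x)))"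
proof -
  interpret group_hom P B \<phi> by fact
  have "\<phi> ` carrier P = \<phi> ` gens" using hom_image_gens[OF \<phi> o] gens_P by blast
  also have "\<dots> = \<phi> ` generate P (range \<iota>)" by (simp add: gens_eq)
  also have "\<dots> = generate B (\<phi> ` range \<iota>)" using generate_img[of "range \<iota>"] \<iota>_P by auto
  finally show ?thesis by (simp add: image_image)
qed

lemma hom_unique:
  assumes \<phi>: "group_hom P B \<phi>" "openin (gtop P) (\<phi> -` {\<one>\<^bsub>B\<^esub>} \<inter> carrier P)"
    and \<psi>: "group_hom P B \<psi>" "openin (gtop P) (\<psi> -` {\<one>\<^bsub>B\<^esub>} \<inter> carrier P)"
    and eq: "\<And>x. \<phi> (\<iota> x) = \<psi> (\<iota> x)" and x: "x \<in> carrier P"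
  shows "\<phi> x = \<psi> x"
proof -
  interpret \<phi>: group_hom P B \<phi> by fact
  interpret \<psi>: group_hom P B \<psi> by fact
  have gen: "\<phi> y = \<psi> y" if "y \<in> generate P (range \<iota>)" for y
    using that
  proof induction
    case (eng h1 h2)
    then have "h1 \<in> carrier P" "h2 \<in> carrier P" using gens_eq gens_P by auto
    then show ?case using eng by simp
  qed (use eq \<iota>_P in auto)
  obtain J where J: "finite J" "J \<subseteq> I" "\<And>x y. x \<in> carrier P \<Longrightarrow> y \<in> carrier P \<Longrightarrow> \<forall>j\<in>J. x j = y j \<Longrightarrow> \<phi> x = \<phi> y"
    using hom_near[OF \<phi>] by blast
  obtain J' where J': "finite J'" "J' \<subseteq> I" "\<And>x y. x \<in> carrier P \<Longrightarrow> y \<in> carrier P \<Longrightarrow> \<forall>j\<in>J'. x j = y j \<Longrightarrow> \<psi> x = \<psi> y"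
    using hom_near[OF \<psi>] by blast
  obtain y where y: "y \<in> gens" "\<forall>j\<in>J \<union> J'. x j = y j" using carrier_PD(3)[OF x, of "J \<union> J'"] J J' by auto
  then have "\<phi> x = \<phi> y" "\<psi> x = \<psi> y" using J(3)[OF x subsetD[OF gens_P y(1)]] J'(3)[OF x subsetD[OF gens_P y(1)]] by auto
  then show ?thesis using gen[of y] y gens_eq by simp
qed

lemma proj_hom:
  assumes i: "i \<in> I" and m: "group_hom (A i) B m" and inj: "inj_on m (carrier (A i))"
  shows "group_hom P B (\<lambda>x. m (x i))" "openin (gtop P) ((\<lambda>x. m (x i)) -` {\<one>\<^bsub>B\<^esub>} \<inter> carrier P)"
proof -
  interpret P: group P by (rule P_group)
  interpret m: group_hom "A i" B m by fact
  show "group_hom P B (\<lambda>x. m (x i))"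
    unfolding group_hom_def group_hom_axioms_def hom_def
    using P_group m.H.group_axioms carrier_PD(2)[OF _ i] i by (auto simp: proj)
  have "(\<lambda>x. m (x i)) -` {\<one>\<^bsub>B\<^esub>} \<inter> carrier P = near {i} \<one>\<^bsub>P\<^esub>"
    using carrier_PD(2)[OF _ i] i proj(2)[OF i] m.inj_on_one_iff inj by (auto simp: near_def)
  then show "openin (gtop P) ((\<lambda>x. m (x i)) -` {\<one>\<^bsub>B\<^esub>} \<inter> carrier P)"
    using open_near[of "{i}" "\<one>\<^bsub>P\<^esub>"] i P.one_closed by simp
qed

end

lemma one_open_normal:
  assumes "profinite A" "finite (carrier A)"
  shows "{\<one>\<^bsub>A\<^esub>} \<in> open_normal A"
proof -
  interpret A: profinite A by fact
  show ?thesis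
    using A.one_is_normal finite_profinite_discrete(1)[OF assms, of "{\<one>\<^bsub>A\<^esub>}"] by (simp add: open_normal_def)
qed

lemma vimage_open_normal_of_kernel:
  assumes "profinite P" "group_hom P B \<phi>" "openin (gtop P) (\<phi> -` {\<one>\<^bsub>B\<^esub>} \<inter> carrier P)" "M \<lhd> B"
  shows "\<phi> -` M \<inter> carrier P \<in> open_normal P"
proof -
  interpret P: profinite P by fact
  interpret group_hom P B \<phi> by fact
  have "\<one>\<^bsub>P\<^esub> \<in> \<phi> -` {\<one>\<^bsub>B\<^esub>} \<inter> carrier P" using hom_one P.one_closed by simp
  then have "\<phi> -` {\<one>\<^bsub>B\<^esub>} \<inter> carrier P \<noteq> {}" by blast
  then show ?thesis
    using P.open_normalI[OF vimage_normal[OF assms(2,4)] assms(3)] H.normalD(3)[OF assms(4)] by auto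
qed

lemma sorted_morphism_kernel_open:
  assumes "profinite P" "profinite B" "finite (carrier B)" "sorted_morphism P F B FB \<phi>"
  shows "group_hom P B \<phi>" "openin (gtop P) (\<phi> -` {\<one>\<^bsub>B\<^esub>} \<inter> carrier P)"
proof -
  interpret P: profinite P by fact
  interpret B: profinite B by fact
  note D = sorted_morphismD[OF assms(4)]
  show "group_hom P B \<phi>" using D(1) by unfold_locales
  show "openin (gtop P) (\<phi> -` {\<one>\<^bsub>B\<^esub>} \<inter> carrier P)"
    using vimage_open_normal[OF assms(1,2) D(1,2) one_open_normal[OF assms(2,3)]] by (simp add: open_normal_def)
qed

section \<open>Criteria for SEP and for covers\<close>

context generated_product
begin

text \<open>Solutions are found among the coordinate projections: it suffices that some index
  carries a tuple of generators of \<open>A'\<close> lying over the images under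
  \<open>\<phi>\<close>. The map \<open>\<alpha>\<close> is handed to the criterion because in
  finite rank it bounds the number of generators of \<open>A'\<close>. The sorting condition is
  automatic for the largest data.\<close>

lemma SEP_P:
  assumes L: "\<And>(A' :: nat tgroup) (B :: nat tgroup) \<pi> \<alpha> \<phi>.
    profinite A' \<Longrightarrow> finite (carrier A') \<Longrightarrow> profinite B \<Longrightarrow> finite (carrier B) \<Longrightarrow>
    group_hom A' B \<pi> \<Longrightarrow> \<pi> ` carrier A' = carrier B \<Longrightarrow>
    group_hom P A' \<alpha> \<Longrightarrow> openin (gtop P) (\<alpha> -` {\<one>\<^bsub>A'\<^esub>} \<inter> carrier P) \<Longrightarrow> \<alpha> ` carrier P = carrier A' \<Longrightarrow>
    group_hom P B \<phi> \<Longrightarrow> openin (gtop P) (\<phi> -` {\<one>\<^bsub>B\<^esub>} \<inter> carrier P) \<Longrightarrow> \<phi> ` carrier P = carrier B \<Longrightarrow>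
    \<exists>i\<in>I. \<exists>m\<in>iso (A i) A'. (\<forall>x. \<pi> (m (\<iota> x i)) = \<phi> (\<iota> x)) \<and>
      generate A' (range (\<lambda>x. m (\<iota> x i))) = carrier A'"
  shows "SEP Jsub P (\<lambda>_. sort_seqs)"
proof -
  have "\<exists>\<psi>. sorted_morphism P (\<lambda>_. sort_seqs) A' FA \<psi> \<and> (\<forall>x\<in>carrier P. \<pi> (\<psi> x) = \<phi> x)"
    if A': "sorted_profinite Jsub A' FA" "finite (carrier A')" and B: "sorted_profinite Jsub B FB" "finite (carrier B)"
      and \<pi>: "sorted_morphism A' FA B FB \<pi>" and \<alpha>: "sorted_morphism P (\<lambda>_. sort_seqs) A' FA \<alpha>"
      and \<phi>: "sorted_morphism P (\<lambda>_. sort_seqs) B FB \<phi>"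
    for A' B :: "nat tgroup" and FA FB \<pi> \<alpha> \<phi>
  proof -
    interpret A': profinite A' using sorted_profiniteD(1)[OF A'(1)] .
    interpret B: profinite B using sorted_profiniteD(1)[OF B(1)] .
    note \<alpha>D = sorted_morphism_kernel_open[OF P_profinite A'.profinite_axioms A'(2) \<alpha>]
    note \<phi>D = sorted_morphism_kernel_open[OF P_profinite B.profinite_axioms B(2) \<phi>]
    interpret \<pi>: group_hom A' B \<pi> using sorted_morphismD(1)[OF \<pi>] by unfold_locales
    obtain i m where i: "i \<in> I" and m: "m \<in> iso (A i) A'" and m\<phi>: "\<And>x. \<pi> (m (\<iota> x i)) = \<phi> (\<iota> x)"
      and gen: "generate A' (range (\<lambda>x. m (\<iota> x i))) = carrier A'"
      using L[OF A'.profinite_axioms A'(2) B.profinite_axioms B(2) \<pi>.group_hom_axioms sorted_morphismD(3)[OF \<pi>]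
        \<alpha>D sorted_morphismD(3)[OF \<alpha>] \<phi>D sorted_morphismD(3)[OF \<phi>]] by auto
    have mh: "group_hom (A i) A' m" "inj_on m (carrier (A i))"
      using m A_group[OF i] A'.group_axioms by (auto simp: group_hom_def group_hom_axioms_def iso_def bij_betw_def)
    define \<psi> where "\<psi> x = m (x i)" for x
    note \<psi> = proj_hom[OF i mh, folded \<psi>_def]
    interpret \<psi>: group_hom P A' \<psi> by (rule \<psi>(1))
    have \<psi>im: "\<psi> ` carrier P = carrier A'" using hom_image[OF \<psi>] gen by (simp add: \<psi>_def)
    have sm: "sorted_morphism P (\<lambda>_. sort_seqs) A' FA \<psi>"
      unfolding sorted_morphism_iff[OF P_profinite A'.profinite_axioms]
    proof (intro conjI ballI)
      fix M assume M: "M \<in> open_normal A'"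
      show "\<psi> -` M \<inter> carrier P \<in> open_normal P"
        using vimage_open_normal_of_kernel[OF P_profinite \<psi> A'.open_normalD(1)[OF M]] .
      show "FA M \<subseteq> sort_seqs" using sorting_onD(2)[OF sorted_profiniteD(2)[OF A'(1)] M] .
    qed (use \<psi>.homh \<psi>im in auto)
    have "sorted_morphism P (\<lambda>_. sort_seqs) B FB (\<lambda>x. \<pi> (\<psi> x))"
      using sorted_morphism_comp[OF sm \<pi> A'.profinite_axioms B.profinite_axioms] .
    note \<pi>\<psi> = sorted_morphism_kernel_open[OF P_profinite B.profinite_axioms B(2) this]
    have "\<pi> (\<psi> x) = \<phi> x" if "x \<in> carrier P" for x
      using hom_unique[OF \<pi>\<psi> \<phi>D _ that] m\<phi> by (simp add: \<psi>_def)
    then show ?thesis using sm by blast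
  qed
  then show ?thesis unfolding SEP_def SIm_def by blast
qed

text \<open>Every finite quotient of \<open>G\<close> occurs as a coordinate, so \<open>x\<close> in
  \<open>P\<close> prescribes a coset of each open normal subgroup. Compactness of \<open>G\<close>
  provides a point in all of them, unique as open normal subgroups separate points. The image is
  closed and contains a dense subgroup.\<close>

lemma ex_cover:
  fixes G :: "'b tgroup"
  assumes G: "profinite G" and h: "\<And>x. h x \<in> carrier G"
    and dense: "gtop G closure_of (generate G (range h)) = carrier G"
    and idx: "\<And>N. N \<in> open_normal G \<Longrightarrow> \<exists>i\<in>I. \<exists>c. group_hom G (A i) c \<and>
      (\<forall>g\<in>carrier G. c g = \<one>\<^bsub>A i\<^esub> \<longleftrightarrow> g \<in> N) \<and> (\<forall>x. c (h x) = \<iota> x i)"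
    and F: "\<And>N. N \<in> open_normal G \<Longrightarrow> F N \<subseteq> sort_seqs"
  shows "\<exists>p. sorted_morphism P (\<lambda>_. sort_seqs) G F p \<and> (\<forall>x. p (\<iota> x) = h x)"
proof -
  interpret G: profinite G by fact
  interpret P: profinite P by (rule P_profinite)
  have "\<exists>i c. \<forall>N\<in>open_normal G. i N \<in> I \<and> group_hom G (A (i N)) (c N) \<and>
      (\<forall>g\<in>carrier G. c N g = \<one>\<^bsub>A (i N)\<^esub> \<longleftrightarrow> g \<in> N) \<and> (\<forall>x. c N (h x) = \<iota> x (i N))"
    using idx by metis
  then obtain i c where ic: "\<forall>N\<in>open_normal G. i N \<in> I \<and> group_hom G (A (i N)) (c N) \<and>
      (\<forall>g\<in>carrier G. c N g = \<one>\<^bsub>A (i N)\<^esub> \<longleftrightarrow> g \<in> N) \<and> (\<forall>x. c N (h x) = \<iota> x (i N))"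
    by (elim exE)
  have i: "\<And>N. N \<in> open_normal G \<Longrightarrow> i N \<in> I"
    and c: "\<And>N. N \<in> open_normal G \<Longrightarrow> group_hom G (A (i N)) (c N)"
    and ker: "\<And>N g. N \<in> open_normal G \<Longrightarrow> g \<in> carrier G \<Longrightarrow> c N g = \<one>\<^bsub>A (i N)\<^esub> \<longleftrightarrow> g \<in> N"
    and ch: "\<And>N x. N \<in> open_normal G \<Longrightarrow> c N (h x) = \<iota> x (i N)"
    using ic by simp_all
  have ceq: "c N g = c N g' \<longleftrightarrow> g \<otimes>\<^bsub>G\<^esub> inv\<^bsub>G\<^esub> g' \<in> N"
    if N: "N \<in> open_normal G" and g: "g \<in> carrier G" "g' \<in> carrier G" for N g g'
  proof -
    interpret c: group_hom G "A (i N)" "c N" using c[OF N] .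
    show ?thesis
      using ker[OF N, of "g \<otimes>\<^bsub>G\<^esub> inv\<^bsub>G\<^esub> g'"] g c.H.mult_inv_eq_one_iff[of "c N g" "c N g'"] by simp
  qed
  \<comment> \<open>The graph of the future map \<open>p\<close>: the coordinates of
    \<open>x\<close> are the images of \<open>g\<close> in the finite quotients.\<close>
  define R where "R x g \<longleftrightarrow> g \<in> carrier G \<and> (\<forall>N\<in>open_normal G. c N g = x (i N))" for x g
  have gensR: "\<exists>g. R y g" if "y \<in> generate P (range \<iota>)" for y
    using that
  proof induction
    case one
    have "R \<one>\<^bsub>P\<^esub> \<one>\<^bsub>G\<^esub>" unfolding R_def using group_hom.hom_one[OF c] proj(2)[OF i] by simp
    then show ?case by blast
  next
    case (incl y)
    then obtain x where "y = \<iota> x" by auto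
    then have "R y (h x)" unfolding R_def using h ch by simp
    then show ?case by blast
  next
    case (inv y)
    then obtain x where x: "y = \<iota> x" by auto
    have "R (inv\<^bsub>P\<^esub> y) (inv\<^bsub>G\<^esub> h x)"
      unfolding R_def x using h ch group_hom.hom_inv[OF c] proj(3)[OF i \<iota>_P] by simp
    then show ?case by blast
  next
    case (eng y z)
    then obtain g g' where g: "R y g" "R z g'" by auto
    have "y \<in> carrier P" "z \<in> carrier P" using eng gens_eq gens_P by auto
    then have "R (y \<otimes>\<^bsub>P\<^esub> z) (g \<otimes>\<^bsub>G\<^esub> g')"
      using g unfolding R_def by (simp add: group_hom.hom_mult[OF c] proj(1)[OF i])
    then show ?case by blast
  qed
  have Runique: "g = g'" if "R x g" "R x g'" for x g g'
  proof (rule ccontr)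
    assume "g \<noteq> g'"
    have gg: "g \<in> carrier G" "g' \<in> carrier G" using that by (auto simp: R_def)
    then have "g \<otimes>\<^bsub>G\<^esub> inv\<^bsub>G\<^esub> g' \<noteq> \<one>\<^bsub>G\<^esub>" using \<open>g \<noteq> g'\<close> G.mult_inv_eq_one_iff by simp
    then obtain N where "N \<in> open_normal G" "g \<otimes>\<^bsub>G\<^esub> inv\<^bsub>G\<^esub> g' \<notin> N"
      using G.open_normal_over_separates[OF G.one_is_normal G.one_closed_set, of "g \<otimes>\<^bsub>G\<^esub> inv\<^bsub>G\<^esub> g'"] gg
      by (auto simp: open_normal_over_def)
    then show False using ceq[of N g g'] gg that by (simp add: R_def)
  qed
  have Rex: "\<exists>g. R x g" if x: "x \<in> carrier P" for x
  proof -
    let ?S = "\<lambda>N. {g \<in> carrier G. c N g = x (i N)}"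
    have near: "\<exists>g. g \<in> carrier G \<and> (\<forall>N\<in>\<N>. c N g = x (i N))" if fin: "finite \<N>" "\<N> \<subseteq> open_normal G" for \<N>
    proof -
      obtain y where y: "y \<in> gens" "\<forall>j\<in>i ` \<N>. x j = y j"
        using carrier_PD(3)[OF x, of "i ` \<N>"] fin i by (auto simp: subset_iff)
      obtain g where "R y g" using gensR[of y, unfolded gens_eq, OF y(1)] by (rule exE)
      then show ?thesis using y(2) fin(2) by (auto simp: R_def subset_iff)
    qed
    have Scoset: "?S N = N #>\<^bsub>G\<^esub> g" if N: "N \<in> open_normal G" and g: "g \<in> carrier G" "c N g = x (i N)" for N g
      using ceq[OF N _ g(1)] g G.mem_rcos_iff[OF G.normalD(1)[OF G.open_normalD(1)[OF N]] g(1)] by auto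
    have "\<Inter>(?S ` open_normal G) \<noteq> {}"
    proof
      assume empty: "\<Inter>(?S ` open_normal G) = {}"
      have "\<exists>D\<in>?S ` open_normal G. D \<subseteq> {}"
      proof (rule compact_space_directed[OF G.compact])
        show "?S ` open_normal G \<noteq> {}" using G.carrier_open_normal by auto
        show "closedin (gtop G) D" if D: "D \<in> ?S ` open_normal G" for D
        proof -
          obtain N where N: "N \<in> open_normal G" "D = ?S N" using D by auto
          obtain g where g: "g \<in> carrier G" "c N g = x (i N)" using near[of "{N}"] N by auto
          show ?thesis unfolding N(2) Scoset[OF N(1) g]
            using G.closed_rcos[OF G.open_normalD(3)[OF N(1)] g(1)] .
        qed
        show "\<exists>C\<in>?S ` open_normal G. C \<subseteq> D \<inter> D'" if DD: "D \<in> ?S ` open_normal G" "D' \<in> ?S ` open_normal G" for D D'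
        proof -
          obtain N N' where N: "N \<in> open_normal G" "N' \<in> open_normal G" "D = ?S N" "D' = ?S N'" using DD by blast
          have NN: "N \<inter> N' \<in> open_normal G" using G.Int_open_normal N by auto
          \<comment> \<open>Approximating at \<open>N\<close>, \<open>N'\<close> and
            \<open>N \<inter> N'\<close> at once makes all three sets cosets of the same element, so
            the third lies in the other two.\<close>
          obtain g where g: "g \<in> carrier G" "c N g = x (i N)" "c N' g = x (i N')" "c (N \<inter> N') g = x (i (N \<inter> N'))"
            using near[of "{N, N', N \<inter> N'}"] N NN by auto
          have "?S (N \<inter> N') \<subseteq> D \<inter> D'"
            unfolding N(3,4) Scoset[OF NN g(1,4)] Scoset[OF N(1) g(1,2)] Scoset[OF N(2) g(1,3)]
            by (auto simp: r_coset_def)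
          then show ?thesis using NN by blast
        qed
      qed (use empty in auto)
      then obtain N where N: "N \<in> open_normal G" "?S N = {}" by auto
      then show False using near[of "{N}"] by auto
    qed
    then obtain g where "g \<in> \<Inter>(?S ` open_normal G)" by auto
    then have "R x g" unfolding R_def using G.carrier_open_normal by auto
    then show ?thesis by blast
  qed
  define p where "p x = (THE g. R x g)" for x
  have p: "R x (p x)" if "x \<in> carrier P" for x
    unfolding p_def using Rex[OF that] Runique by (metis theI)
  have peq: "p x = g" if "R x g" for x g unfolding p_def using that Runique by blast
  have pc: "p x \<in> carrier G" "\<And>N. N \<in> open_normal G \<Longrightarrow> c N (p x) = x (i N)" if "x \<in> carrier P" for x
    using p[OF that] by (auto simp: R_def)
  have ph: "p \<in> hom P G"
  proof (rule homI)
    fix x y assume xy: "x \<in> carrier P" "y \<in> carrier P"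
    have "R (x \<otimes>\<^bsub>P\<^esub> y) (p x \<otimes>\<^bsub>G\<^esub> p y)"
      unfolding R_def using xy pc by (simp add: group_hom.hom_mult[OF c] proj(1)[OF i])
    then show "p (x \<otimes>\<^bsub>P\<^esub> y) = p x \<otimes>\<^bsub>G\<^esub> p y" by (rule peq)
  qed (use pc in auto)
  interpret p: group_hom P G p using ph by unfold_locales
  have p\<iota>: "p (\<iota> x) = h x" for x
    by (rule peq) (use h ch in \<open>simp add: R_def\<close>)
  have pv: "p -` N \<inter> carrier P \<in> open_normal P" if N: "N \<in> open_normal G" for N
  proof -
    have "p -` N \<inter> carrier P = near {i N} \<one>\<^bsub>P\<^esub>"
    proof -
      have "p x \<in> N \<longleftrightarrow> x (i N) = \<one>\<^bsub>A (i N)\<^esub>" if x: "x \<in> carrier P" for x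
        using ker[OF N pc(1)[OF x]] pc(2)[OF x N] by simp
      then show ?thesis using proj(2)[OF i[OF N]] by (auto simp: near_def)
    qed
    then have "openin (gtop P) (p -` N \<inter> carrier P)"
      using open_near[of "{i N}" "\<one>\<^bsub>P\<^esub>"] i[OF N] P.one_closed by simp
    then show ?thesis using vimage_normal[OF p.group_hom_axioms G.open_normalD(1)[OF N]] by (simp add: open_normal_def)
  qed
  have cont: "continuous_map (gtop P) (gtop G) p"
    using continuous_homI[OF P_profinite G ph] pv by (simp add: open_normal_def)
  have im: "p ` carrier P = carrier G"
  proof
    show "carrier G \<subseteq> p ` carrier P"
    proof -
      have "compactin (gtop G) (p ` carrier P)"
        using image_compactin[OF _ cont, of "carrier P"] P.compact by (simp add: compact_space_def)
      then have "closedin (gtop G) (p ` carrier P)" using G.Hausdorff compactin_imp_closedin by blast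
      moreover have "generate G (range h) \<subseteq> p ` carrier P"
      proof (rule G.generate_subgroup_incl)
        show "range h \<subseteq> p ` carrier P" using p\<iota> \<iota>_P by (metis image_subsetI imageI)
        show "subgroup (p ` carrier P) G" using p.img_is_subgroup .
      qed
      ultimately show ?thesis using closure_of_minimal[of "generate G (range h)" "p ` carrier P" "gtop G"] dense by simp
    qed
  qed auto
  have "sorted_morphism P (\<lambda>_. sort_seqs) G F p"
    unfolding sorted_morphism_iff[OF P_profinite G] using ph im pv F by blast
  then show ?thesis using p\<iota> by blast
qed

end

section \<open>Lifting generators of finite groups\<close>

lemma card_fibre_eq_kernel:
  assumes "group_hom A B \<pi>" "subgroup C A" "c0 \<in> C"
  shows "card {c \<in> C. \<pi> c = \<pi> c0} = card {c \<in> C. \<pi> c = \<one>\<^bsub>B\<^esub>}"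
proof -
  interpret group_hom A B \<pi> by fact
  have C: "C \<subseteq> carrier A" using subgroup.subset[OF assms(2)] .
  have "bij_betw (\<lambda>c. c \<otimes>\<^bsub>A\<^esub> c0) {c \<in> C. \<pi> c = \<one>\<^bsub>B\<^esub>} {c \<in> C. \<pi> c = \<pi> c0}"
  proof (rule bij_betw_byWitness[where f' = "\<lambda>c. c \<otimes>\<^bsub>A\<^esub> inv\<^bsub>A\<^esub> c0"])
  qed (use C assms(3) subgroup.m_closed[OF assms(2)] subgroup.m_inv_closed[OF assms(2)] in
      \<open>auto simp: subset_iff G.m_assoc\<close>)
  then show ?thesis by (rule bij_betw_same_card[symmetric])
qed

text \<open>
  By induction on \<open>C\<close>: the number of all lifts of \<open>b\<close> to \<open>C\<close> does not depend on \<open>b\<close>, and those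
  that do not generate \<open>C\<close> generate a smaller subgroup over \<open>B\<close>.
\<close>

lemma card_generating_lifts:
  fixes n :: nat
  assumes \<pi>: "group_hom A B \<pi>" and fin: "finite (carrier A)"
    and b: "\<And>j. j < n \<Longrightarrow> b j \<in> carrier B" "generate B (b ` {..<n}) = carrier B"
    and b': "\<And>j. j < n \<Longrightarrow> b' j \<in> carrier B" "generate B (b' ` {..<n}) = carrier B"
    and C: "subgroup C A" "\<pi> ` C = carrier B"
  defines "lifts \<equiv> \<lambda>C b. {a \<in> {..<n} \<rightarrow>\<^sub>E C. (\<forall>j<n. \<pi> (a j) = b j) \<and> generate A (a ` {..<n}) = C}"
  shows "card (lifts C b) = card (lifts C b')"
  using C
proof (induction "card C" arbitrary: C rule: less_induct)
  case less
  interpret group_hom A B \<pi> by fact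
  have Cc: "C \<subseteq> carrier A" using subgroup.subset[OF less.prems(1)] .
  have finC: "finite C" using Cc fin finite_subset by auto
  let ?all = "\<lambda>b. {a \<in> {..<n} \<rightarrow>\<^sub>E C. \<forall>j<n. \<pi> (a j) = b j}"
  \<comment> \<open>The subgroups of \<open>C\<close> that map onto \<open>B\<close>: every lift of
    a generating tuple of \<open>B\<close> generates exactly one of them.\<close>
  define D where "D = {D. subgroup D A \<and> D \<subseteq> C \<and> \<pi> ` D = carrier B}"
  have finD: "finite D" using finC finite_subset[of D "Pow C"] by (auto simp: D_def)
  have CD: "C \<in> D" using less.prems by (simp add: D_def)
  have split: "card (?all b) = (\<Sum>D\<in>D. card (lifts D b))"
    if b: "\<And>j. j < n \<Longrightarrow> b j \<in> carrier B" "generate B (b ` {..<n}) = carrier B" for b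
  proof -
    have "?all b = (\<Union>D\<in>D. lifts D b)"
    proof
      show "?all b \<subseteq> (\<Union>D\<in>D. lifts D b)"
      proof
        fix a assume a: "a \<in> ?all b"
        let ?E = "generate A (a ` {..<n})"
        have aC: "a ` {..<n} \<subseteq> C" using a by auto
        then have aA: "a ` {..<n} \<subseteq> carrier A" using Cc by auto
        have "\<pi> ` ?E = generate B (\<pi> ` a ` {..<n})" using generate_img[OF aA] by simp
        also have "\<pi> ` a ` {..<n} = b ` {..<n}" using a by (auto simp: image_image)
        finally have "\<pi> ` ?E = carrier B" using b(2) by simp
        moreover have "?E \<subseteq> C" using G.generate_subgroup_incl[OF aC less.prems(1)] .
        ultimately have "?E \<in> D" using G.generate_is_subgroup[OF aA] by (simp add: D_def)
        moreover have "a \<in> lifts ?E b"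
          using a generate.incl[of _ "a ` {..<n}" A] by (auto simp: lifts_def PiE_iff)
        ultimately show "a \<in> (\<Union>D\<in>D. lifts D b)" by blast
      qed
      show "(\<Union>D\<in>D. lifts D b) \<subseteq> ?all b" by (auto simp: lifts_def D_def PiE_iff)
    qed
    moreover have "card (\<Union>D\<in>D. lifts D b) = (\<Sum>D\<in>D. card (lifts D b))"
    proof (rule card_UN_disjoint[OF finD])
      have "finite ({..<n} \<rightarrow>\<^sub>E E)" if "E \<in> D" for E
        using that finite_subset[OF _ finC] by (intro finite_PiE) (auto simp: D_def)
      then show "\<forall>E\<in>D. finite (lifts E b)" by (auto simp: lifts_def)
      show "\<forall>E\<in>D. \<forall>E'\<in>D. E \<noteq> E' \<longrightarrow> lifts E b \<inter> lifts E' b = {}" by (auto simp: lifts_def)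
    qed
    ultimately show ?thesis by simp
  qed
  \<comment> \<open>All fibres over \<open>B\<close> have the size of the kernel, so this count is
    the same for \<open>b\<close> and \<open>b'\<close>.\<close>
  have all: "card (?all b) = card {c \<in> C. \<pi> c = \<one>\<^bsub>B\<^esub>} ^ n"
    if b: "\<And>j. j < n \<Longrightarrow> b j \<in> carrier B" for b
  proof -
    have "?all b = (\<Pi>\<^sub>E j\<in>{..<n}. {c \<in> C. \<pi> c = b j})" unfolding PiE_def Pi_def by auto
    then have "card (?all b) = (\<Prod>j<n. card {c \<in> C. \<pi> c = b j})" by (simp add: card_PiE)
    also have "\<dots> = (\<Prod>j<n. card {c \<in> C. \<pi> c = \<one>\<^bsub>B\<^esub>})"
    proof (rule prod.cong[OF refl])
      fix j assume "j \<in> {..<n}"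
      then have "b j \<in> \<pi> ` C" using b unfolding less.prems(2) by simp
      then obtain c0 where "c0 \<in> C" "b j = \<pi> c0" by auto
      then show "card {c \<in> C. \<pi> c = b j} = card {c \<in> C. \<pi> c = \<one>\<^bsub>B\<^esub>}"
        using card_fibre_eq_kernel[OF \<pi> less.prems(1)] by simp
    qed
    finally show ?thesis by simp
  qed
  have "card (lifts E b) = card (lifts E b')" if E: "E \<in> D - {C}" for E
  proof -
    have "card E < card C" using E finC by (intro psubset_card_mono) (auto simp: D_def)
    then show ?thesis using less.hyps[of E] E by (simp add: D_def)
  qed
  then have "(\<Sum>E\<in>D - {C}. card (lifts E b)) = (\<Sum>E\<in>D - {C}. card (lifts E b'))" by simp
  moreover have "(\<Sum>E\<in>D. card (lifts E b)) = (\<Sum>E\<in>D. card (lifts E b'))"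
    using split[OF b] split[OF b'] all[OF b(1)] all[OF b'(1)] by simp
  ultimately show ?case
    using sum.remove[OF finD CD, of "\<lambda>E. card (lifts E b)"] sum.remove[OF finD CD, of "\<lambda>E. card (lifts E b')"] by simp
qed

text \<open>\<open>a0\<close> is a generating lift of its own image in \<open>B\<close>, so that
  tuple has at least one generating lift, and \<open>b\<close> has equally many.\<close>

lemma gaschuetz_lemma:
  fixes n :: nat
  assumes \<pi>: "group_hom A B \<pi>" "\<pi> ` carrier A = carrier B" and fin: "finite (carrier A)"
    and a0: "\<And>j. j < n \<Longrightarrow> a0 j \<in> carrier A" "generate A (a0 ` {..<n}) = carrier A"
    and b: "\<And>j. j < n \<Longrightarrow> b j \<in> carrier B" "generate B (b ` {..<n}) = carrier B"
  shows "\<exists>a. (\<forall>j<n. a j \<in> carrier A \<and> \<pi> (a j) = b j) \<and> generate A (a ` {..<n}) = carrier A"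
proof -
  interpret group_hom A B \<pi> by fact
  define lifts where "lifts C b = {a \<in> {..<n} \<rightarrow>\<^sub>E C. (\<forall>j<n. \<pi> (a j) = b j) \<and> generate A (a ` {..<n}) = C}" for C b
  let ?b' = "\<lambda>j. \<pi> (a0 j)"
  have "generate B (?b' ` {..<n}) = \<pi> ` generate A (a0 ` {..<n})"
    using generate_img[of "a0 ` {..<n}"] a0(1) by (auto simp: image_image)
  then have b': "generate B (?b' ` {..<n}) = carrier B" using a0(2) \<pi>(2) by simp
  have "card (lifts (carrier A) b) = card (lifts (carrier A) ?b')"
    unfolding lifts_def using a0(1)
    by (intro card_generating_lifts[OF \<pi>(1) fin b _ b' G.subgroup_self \<pi>(2)]) auto
  moreover have "restrict a0 {..<n} \<in> lifts (carrier A) ?b'"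
    using a0 by (auto simp: lifts_def)
  moreover have "finite (lifts (carrier A) ?b')"
    using fin finite_PiE[of "{..<n}" "\<lambda>_. carrier A"] by (auto simp: lifts_def)
  ultimately have "lifts (carrier A) b \<noteq> {}" by (metis card.empty card_gt_0_iff empty_iff less_irrefl)
  then obtain a where "a \<in> lifts (carrier A) b" by auto
  then show ?thesis by (intro exI[of _ a]) (auto simp: lifts_def)
qed

section \<open>Free profinite groups\<close>

lemma tab_group_simps [simp]:
  "carrier (tab_group T) = {..<length T}" "\<one>\<^bsub>tab_group T\<^esub> = 0"
  by (simp_all add: tab_group_def)

lemma tab_group_pos: "group (tab_group T) \<Longrightarrow> 0 < length T"
  using monoid.one_closed[of "tab_group T"] group.is_monoid by fastforce

lemma ex_tab_quotient:
  assumes "profinite G" "N \<in> open_normal G"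
  shows "\<exists>T c. group (tab_group T) \<and> group_hom G (tab_group T) c \<and> (\<forall>g\<in>carrier G. c g = 0 \<longleftrightarrow> g \<in> N)"
proof -
  interpret G: profinite G by fact
  note Nn = G.open_normalD[OF assms(2)]
  interpret N: normal N G by (rule Nn(1))
  have Ns: "subgroup N G" using G.normalD(1)[OF Nn(1)] .
  have fin: "finite (carrier (G Mod N))" using G.finite_rcosets[OF Ns Nn(2)] by (simp add: FactGroup_def)
  obtain T k where T: "group (tab_group T)" and k: "k \<in> iso (G Mod N) (tab_group T)"
    using ex_tab_group_iso[OF N.factorgroup_is_group fin] by auto
  have kh: "group_hom (G Mod N) (tab_group T) k"
    using k T N.factorgroup_is_group by (simp add: group_hom_def group_hom_axioms_def iso_def)
  then interpret k: group_hom "G Mod N" "tab_group T" k .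
  define c where "c g = k (N #>\<^bsub>G\<^esub> g)" for g
  have "c \<in> hom G (tab_group T)"
    using hom_compose[OF N.r_coset_hom_Mod k.homh] by (simp add: c_def[abs_def] o_def)
  then have "group_hom G (tab_group T) c"
    using T G.group_axioms by (simp add: group_hom_def group_hom_axioms_def)
  moreover have "c g = 0 \<longleftrightarrow> g \<in> N" if g: "g \<in> carrier G" for g
  proof -
    have inj: "inj_on k (carrier (G Mod N))" using k by (simp add: iso_def bij_betw_def)
    have mem: "N #>\<^bsub>G\<^esub> g \<in> carrier (G Mod N)" "N \<in> carrier (G Mod N)"
      using g N.subgroup_in_rcosets[OF G.group_axioms] by (auto simp: FactGroup_def RCOSETS_def)
    have "k N = 0" using k.hom_one by simp
    then have "c g = 0 \<longleftrightarrow> N #>\<^bsub>G\<^esub> g = N" using inj_onD[OF inj _ mem] by (auto simp: c_def)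
    also have "\<dots> \<longleftrightarrow> g \<in> N" using G.rcos_eq_iff[OF Ns g G.one_closed] g N.subset by simp
    finally show ?thesis .
  qed
  ultimately show ?thesis using T by blast
qed

lemma group_hom_generates:
  assumes "group_hom A B \<pi>" "X \<subseteq> carrier A" "generate B (\<pi> ` X) = carrier B"
    and ker: "\<And>a. a \<in> carrier A \<Longrightarrow> \<pi> a = \<one>\<^bsub>B\<^esub> \<Longrightarrow> a \<in> generate A X"
  shows "generate A X = carrier A"
proof -
  interpret group_hom A B \<pi> by fact
  have s: "subgroup (generate A X) A" using G.generate_is_subgroup[OF assms(2)] .
  have "a \<in> generate A X" if a: "a \<in> carrier A" for a
  proof -
    have im: "\<pi> ` generate A X = carrier B" using generate_img[OF assms(2)] assms(3) by simp
    have "\<pi> a \<in> \<pi> ` generate A X" unfolding im using a by simp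
    then obtain d where d: "d \<in> generate A X" "\<pi> a = \<pi> d" by auto
    have dA: "d \<in> carrier A" using d(1) subgroup.subset[OF s] by auto
    have "a \<otimes>\<^bsub>A\<^esub> inv\<^bsub>A\<^esub> d \<in> generate A X" using a dA d(2) by (intro ker) auto
    then have "a \<otimes>\<^bsub>A\<^esub> inv\<^bsub>A\<^esub> d \<otimes>\<^bsub>A\<^esub> d \<in> generate A X" using d(1) by (rule subgroup.m_closed[OF s])
    then show ?thesis using a dA by (simp add: G.m_assoc)
  qed
  then show ?thesis using subgroup.subset[OF s] by auto
qed

text \<open>
  The free profinite group on \<open>'a + nat\<close> whose generators from \<open>nat\<close> converge to 1. An index
  \<open>(T, f, l)\<close> stands for the map from the generators to the finite group with table \<open>T\<close> that is
  \<open>f\<close> on \<open>'a\<close> and the list \<open>l\<close>, followed by the neutral element 0, on \<open>nat\<close>. Convergence to 1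
  keeps the index set as small as \<open>'a cover_type\<close> requires even when \<open>'a\<close> is finite.
\<close>

definition free_index :: "(nat list list \<times> ('a \<Rightarrow> nat) \<times> nat list) set" where
  "free_index = {(T, f, l). group (tab_group T) \<and> (\<forall>a. f a < length T) \<and> set l \<subseteq> {..<length T}}"

definition free_gen :: "'a + nat \<Rightarrow> nat list list \<times> ('a \<Rightarrow> nat) \<times> nat list \<Rightarrow> nat" where
  "free_gen x = (\<lambda>(T, f, l)\<in>free_index. case x of Inl a \<Rightarrow> f a | Inr n \<Rightarrow> if n < length l then l ! n else 0)"

lemma free_gen_apply:
  assumes "(T, f, l) \<in> free_index"
  shows "free_gen (Inl a) (T, f, l) = f a" "free_gen (Inr n) (T, f, l) = (if n < length l then l ! n else 0)"
  using assms by (auto simp: free_gen_def)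

interpretation free: generated_product "free_index :: (nat list list \<times> ('a \<Rightarrow> nat) \<times> nat list) set"
  "\<lambda>i. tab_group (fst i)" free_gen
proof (rule generated_product.intro)
  fix x :: "'a + nat"
  show "free_gen x \<in> (\<Pi>\<^sub>E i\<in>free_index. carrier (tab_group (fst i)))"
  proof (rule PiE_I)
    fix i :: "nat list list \<times> ('a \<Rightarrow> nat) \<times> nat list"
    assume i: "i \<in> free_index"
    obtain T f l where Tfl: "i = (T, f, l)" by (cases i)
    have *: "group (tab_group T)" "\<And>a. f a < length T" "set l \<subseteq> {..<length T}"
      using i unfolding Tfl free_index_def by auto
    then have "l ! n < length T" if "n < length l" for n using nth_mem[OF that] by auto
    then show "free_gen x i \<in> carrier (tab_group (fst i))"
      using * tab_group_pos[OF *(1)] i unfolding Tfl by (cases x) (simp_all add: free_gen_apply)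
  qed (auto simp: free_gen_def)
qed (auto simp: free_index_def)

lemma free_profinite: "profinite free.P"
  by (rule free.P_profinite)

text \<open>\<open>\<phi>\<close> depends on finitely many coordinates, hence kills
  \<open>Inr n\<close> for \<open>n \<ge> n0\<close>. The other generators are lifted by a
  set-theoretic section of \<open>\<pi>\<close>; those from \<open>n0\<close> on first run through
  the kernel and then become trivial. The images contain the kernel and map onto generators of
  \<open>B\<close>, so they generate \<open>A\<close>.\<close>

lemma SEP_free: "SEP Jsub free.P (\<lambda>_. sort_seqs)"
proof (rule free.SEP_P)
  fix A B :: "nat tgroup" and \<pi> \<alpha> \<phi>
  assume A: "profinite A" "finite (carrier A)" and B: "profinite B" "finite (carrier B)"
    and \<pi>: "group_hom A B \<pi>" "\<pi> ` carrier A = carrier B"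
    and \<phi>: "group_hom free.P B \<phi>" "openin (gtop free.P) (\<phi> -` {\<one>\<^bsub>B\<^esub>} \<inter> carrier free.P)" "\<phi> ` carrier free.P = carrier B"
  interpret A: profinite A by fact
  interpret \<pi>: group_hom A B \<pi> by fact
  interpret \<phi>: group_hom free.P B \<phi> by fact
  define h where "h x = \<phi> (free_gen x)" for x
  have hB: "h x \<in> carrier B" for x unfolding h_def using free.\<iota>_P by (rule \<phi>.hom_closed)
  obtain J where J: "finite J" "J \<subseteq> free_index"
    "\<And>x y. x \<in> carrier free.P \<Longrightarrow> y \<in> carrier free.P \<Longrightarrow> \<forall>j\<in>J. x j = y j \<Longrightarrow> \<phi> x = \<phi> y"
    using free.hom_near[OF \<phi>(1,2)] by blast
  \<comment> \<open>A bound for the lists of the finitely many indices in \<open>J\<close>: from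
    there on, \<open>free_gen (Inr n)\<close> is 0 at all of them.\<close>
  define n0 where "n0 = Max (insert 0 ((\<lambda>i. length (snd (snd i))) ` J))"
  have n0: "length (snd (snd j)) \<le> n0" if "j \<in> J" for j
    unfolding n0_def using J(1) that by (intro Max_ge) auto
  have h1: "h (Inr n) = \<one>\<^bsub>B\<^esub>" if n: "n \<ge> n0" for n
  proof -
    have "free_gen (Inr n) j = \<one>\<^bsub>free.P\<^esub> j" if j: "j \<in> J" for j
    proof -
      obtain T f l where Tfl: "j = (T, f, l)" by (cases j)
      have "j \<in> free_index" using j J(2) by auto
      then show ?thesis using free.proj(2)[of j] n0[OF j] n unfolding Tfl by (simp add: free_gen_apply)
    qed
    then have "h (Inr n) = \<phi> \<one>\<^bsub>free.P\<^esub>" unfolding h_def by (intro J(3)) (use free.\<iota>_P in auto)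
    then show ?thesis by simp
  qed
  obtain ks where ks: "set ks = {a \<in> carrier A. \<pi> a = \<one>\<^bsub>B\<^esub>}" using finite_list[of "{a \<in> carrier A. \<pi> a = \<one>\<^bsub>B\<^esub>}"] A(2) by auto
  define s where "s b = (SOME a. a \<in> carrier A \<and> \<pi> a = b)" for b
  have s: "s b \<in> carrier A" "\<pi> (s b) = b" if "b \<in> carrier B" for b
  proof -
    have "\<exists>a. a \<in> carrier A \<and> \<pi> a = b" using that \<pi>(2) by (metis imageE)
    from someI_ex[OF this] show "s b \<in> carrier A" "\<pi> (s b) = b" unfolding s_def by auto
  qed
  obtain T k where T: "group (tab_group T)" and k: "k \<in> iso A (tab_group T)"
    using ex_tab_group_iso[OF A.group_axioms A(2)] by auto
  have kT: "k a < length T" if "a \<in> carrier A" for a using k that by (auto simp: iso_def hom_def)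
  have kinj: "inj_on k (carrier A)" using k by (simp add: iso_def bij_betw_def)
  let ?f = "\<lambda>a. k (s (h (Inl a)))"
  let ?l = "map (\<lambda>n. k (s (h (Inr n)))) [0..<n0] @ map k ks"
  let ?i = "(T, ?f, ?l)"
  have i: "?i \<in> free_index"
    unfolding free_index_def using T kT s(1) hB ks by auto
  define m where "m = inv_into (carrier A) k"
  have m: "m \<in> iso (tab_group T) A" unfolding m_def using A.iso_set_sym[OF k] .
  have mk: "m (k a) = a" if "a \<in> carrier A" for a using that kinj by (simp add: m_def)
  have m0: "m 0 = \<one>\<^bsub>A\<^esub>"
  proof -
    have "group_hom (tab_group T) A m" using m T A.group_axioms by (simp add: group_hom_def group_hom_axioms_def iso_def)
    then show ?thesis using group_hom.hom_one by fastforce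
  qed
  define g where "g x = m (free_gen x ?i)" for x
  have gL: "g (Inl a) = s (h (Inl a))" for a
    unfolding g_def free_gen_apply[OF i] using mk s(1) hB by simp
  have gR: "g (Inr n) = (if n < n0 then s (h (Inr n)) else if n < n0 + length ks then ks ! (n - n0) else \<one>\<^bsub>A\<^esub>)" for n
  proof -
    have "ks ! r \<in> carrier A" if "r < length ks" for r using nth_mem[OF that] ks by auto
    then show ?thesis
      unfolding g_def free_gen_apply[OF i] using mk s(1) hB m0 by (simp add: nth_append)
  qed
  have gh: "\<pi> (g x) = h x" for x
  proof (cases x)
    case (Inl a)
    then show ?thesis using gL s(2) hB by simp
  next
    case (Inr n)
    have "\<pi> (ks ! r) = \<one>\<^bsub>B\<^esub>" if "r < length ks" for r using nth_mem[OF that] ks by auto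
    then show ?thesis using Inr gR s(2) hB h1 by simp
  qed
  have gA: "range g \<subseteq> carrier A"
  proof
    fix a assume "a \<in> range g"
    then obtain x where x: "a = g x" by auto
    have "ks ! r \<in> carrier A" if "r < length ks" for r using nth_mem[OF that] ks by auto
    then show "a \<in> carrier A" unfolding x using gL gR s(1) hB by (cases x) auto
  qed
  have "generate A (range g) = carrier A"
  proof (rule group_hom_generates[OF \<pi>(1) gA])
    have "\<pi> ` range g = range h" using gh by (auto simp: image_iff)
    then show "generate B (\<pi> ` range g) = carrier B"
      using free.hom_image[OF \<phi>(1,2)] \<phi>(3) by (simp add: h_def)
    fix a assume "a \<in> carrier A" "\<pi> a = \<one>\<^bsub>B\<^esub>"
    then have "a \<in> set ks" using ks by simp
    then obtain r where r: "r < length ks" "a = ks ! r" by (auto simp: in_set_conv_nth)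
    then have "a = g (Inr (n0 + r))" using gR by simp
    then show "a \<in> generate A (range g)" by (simp add: generate.incl)
  qed
  then show "\<exists>i\<in>free_index. \<exists>m\<in>iso (tab_group (fst i)) A. (\<forall>x. \<pi> (m (free_gen x i)) = \<phi> (free_gen x)) \<and>
      generate A (range (\<lambda>x. m (free_gen x i))) = carrier A"
    using i m gh by (intro bexI[of _ ?i] bexI[of _ m]) (auto simp: g_def h_def)
qed

lemma ex_free_cover:
  fixes G :: "'a tgroup"
  assumes "sorted_profinite Jsub G F"
  shows "\<exists>p. sorted_morphism (free.P :: (nat list list \<times> ('a \<Rightarrow> nat) \<times> nat list \<Rightarrow> nat) tgroup) (\<lambda>_. sort_seqs) G F p"
proof -
  note GD = sorted_profiniteD[OF assms]
  interpret G: profinite G by (rule GD(1))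
  \<comment> \<open>Elements of \<open>G\<close> label generators that go to themselves, and the
    generators from \<open>nat\<close> go to 1; hence the empty list in the index below.\<close>
  define h where "h x = (case x of Inl a \<Rightarrow> if a \<in> carrier G then a else \<one>\<^bsub>G\<^esub> | Inr n \<Rightarrow> \<one>\<^bsub>G\<^esub>)" for x :: "'a + nat"
  have hG: "h x \<in> carrier G" for x by (cases x) (auto simp: h_def)
  have "\<exists>p. sorted_morphism free.P (\<lambda>_. sort_seqs) G F p \<and> (\<forall>x. p (free_gen x) = h x)"
  proof (rule free.ex_cover[OF GD(1) hG])
    have "carrier G \<subseteq> range h"
    proof
      fix g assume "g \<in> carrier G"
      then have "g = h (Inl g)" by (simp add: h_def)
      then show "g \<in> range h" by blast
    qed
    then have "range h = carrier G" using hG by auto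
    moreover have "generate G (carrier G) = carrier G"
      using G.generate_incl[of "carrier G"] generate.incl[of _ "carrier G" G] by auto
    ultimately show "gtop G closure_of generate G (range h) = carrier G"
      using closure_of_topspace[of "gtop G"] by simp
    fix N assume N: "N \<in> open_normal G"
    show "F N \<subseteq> sort_seqs" using sorting_onD(2)[OF GD(2) N] .
    obtain T c where T: "group (tab_group T)" and c: "group_hom G (tab_group T) c"
      and ker: "\<forall>g\<in>carrier G. c g = 0 \<longleftrightarrow> g \<in> N"
      using ex_tab_quotient[OF GD(1) N] by auto
    interpret c: group_hom G "tab_group T" c by fact
    let ?i = "(T, \<lambda>a. c (h (Inl a)), [])"
    have i: "?i \<in> free_index" unfolding free_index_def using T c.hom_closed[OF hG] by auto
    have ch: "c (h x) = free_gen x ?i" for x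
      using c.hom_one by (cases x) (simp_all add: free_gen_apply[OF i], simp add: h_def)
    show "\<exists>i\<in>free_index. \<exists>c. group_hom G (tab_group (fst i)) c \<and>
        (\<forall>g\<in>carrier G. c g = \<one>\<^bsub>tab_group (fst i)\<^esub> \<longleftrightarrow> g \<in> N) \<and> (\<forall>x. c (h x) = free_gen x i)"
      by (intro bexI[OF _ i] exI[of _ c] conjI allI ch) (use c ker in simp_all)
  qed
  then show ?thesis by blast
qed

section \<open>Size of the free profinite group\<close>

text \<open>For finite \<open>'a\<close> there are only countably many functions, and the summand
  \<open>nat\<close> has room for them. For infinite \<open>'a\<close> a function is a subset of the
  product of \<open>'a\<close> and \<open>nat\<close>, which injects into \<open>'a\<close>.\<close>

lemma ex_inj_fun_cover_type: "\<exists>e :: ('a \<Rightarrow> nat) \<Rightarrow> 'a set + nat. inj e"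
proof (cases "finite (UNIV :: 'a set)")
  case True
  have "countable ((UNIV :: 'a set) \<rightarrow>\<^sub>E (UNIV :: nat set))" using True by (intro countable_PiE) auto
  then have c: "countable (UNIV :: ('a \<Rightarrow> nat) set)" by simp
  have "inj (\<lambda>f :: 'a \<Rightarrow> nat. Inr (to_nat_on UNIV f) :: 'a set + nat)"
    using inj_on_to_nat_on[OF c] by (auto simp: inj_on_def)
  then show ?thesis by blast
next
  case False
  have "(card_of (UNIV :: nat set), card_of (UNIV :: 'a set)) \<in> ordLeq" using False infinite_iff_card_of_nat by blast
  then have "(card_of ((UNIV :: 'a set) \<times> (UNIV :: nat set)), card_of (UNIV :: 'a set)) \<in> ordLeq"
    using card_of_Times_infinite[OF False, of "UNIV :: nat set"] ordIso_imp_ordLeq by blast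
  then obtain g :: "'a \<times> nat \<Rightarrow> 'a" where g: "inj g"
    unfolding card_of_ordLeq[symmetric] by auto
  have "inj (\<lambda>f :: 'a \<Rightarrow> nat. Inl (g ` {(a, f a) | a. True}) :: 'a set + nat)"
  proof (rule injI)
    fix f f' :: "'a \<Rightarrow> nat"
    assume "(Inl (g ` {(a, f a) | a. True}) :: 'a set + nat) = Inl (g ` {(a, f' a) | a. True})"
    then have "{(a, f a) | a. True} = {(a, f' a) | a. True}" using inj_image_eq_iff[OF g] by auto
    then show "f = f'" by auto
  qed
  then show ?thesis by blast
qed

text \<open>An element of the product is coded by its graph, a set of pairs of an index and a value,
  so it remains to code such pairs in \<open>'a set + nat\<close>.\<close>

lemma ex_inj_free_cover_type:
  "\<exists>e :: (nat list list \<times> ('a \<Rightarrow> nat) \<times> nat list \<Rightarrow> nat) \<Rightarrow> 'a cover_type. inj_on e (carrier free.P)"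
proof -
  obtain e0 :: "('a \<Rightarrow> nat) \<Rightarrow> 'a set + nat" where e0: "inj e0" using ex_inj_fun_cover_type by auto
  \<comment> \<open>The countable data \<open>(T, l, v)\<close> are merged into every value of
    \<open>f\<close>; they can be read off again at any point of the non-empty type
    \<open>'a\<close>.\<close>
  define e1 :: "(nat list list \<times> ('a \<Rightarrow> nat) \<times> nat list) \<times> nat \<Rightarrow> 'a set + nat"
    where "e1 = (\<lambda>((T, f, l), v). e0 (\<lambda>a. prod_encode (f a, to_nat (T, l, v))))"
  have e1: "inj e1"
  proof (rule injI)
    fix x y assume eq: "e1 x = e1 y"
    obtain T f l v where x: "x = ((T, f, l), v)" by (metis prod.collapse)
    obtain T' f' l' v' where y: "y = ((T', f', l'), v')" by (metis prod.collapse)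
    have "(\<lambda>a. prod_encode (f a, to_nat (T, l, v))) = (\<lambda>a. prod_encode (f' a, to_nat (T', l', v')))"
      using eq injD[OF e0] unfolding x y e1_def by simp
    then have "f a = f' a" "to_nat (T, l, v) = to_nat (T', l', v')" for a
      by (simp_all add: fun_eq_iff)
    then show "x = y" unfolding x y by (simp add: fun_eq_iff)
  qed
  have "inj_on (\<lambda>x. (\<lambda>i. e1 (i, x i)) ` free_index) (carrier free.P)"
  proof (rule inj_onI)
    fix x y :: "nat list list \<times> ('a \<Rightarrow> nat) \<times> nat list \<Rightarrow> nat"
    assume x: "x \<in> carrier free.P" and y: "y \<in> carrier free.P"
      and eq: "(\<lambda>i. e1 (i, x i)) ` free_index = (\<lambda>i. e1 (i, y i)) ` free_index"
    have "x \<in> (\<Pi>\<^sub>E i\<in>free_index. carrier (tab_group (fst i)))" "y \<in> (\<Pi>\<^sub>E i\<in>free_index. carrier (tab_group (fst i)))"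
      using free.carrier_PD(1)[OF x] free.carrier_PD(1)[OF y] by simp_all
    then show "x = y"
    proof (rule PiE_ext)
      fix i :: "nat list list \<times> ('a \<Rightarrow> nat) \<times> nat list"
      assume i: "i \<in> free_index"
      then have "e1 (i, x i) \<in> (\<lambda>i. e1 (i, y i)) ` free_index" using eq by blast
      then obtain j where "e1 (i, x i) = e1 (j, y j)" by auto
      then have "(i, x i) = (j, y j)" by (rule injD[OF e1])
      then show "x i = y i" by auto
    qed
  qed
  then show ?thesis by blast
qed

section \<open>Free profinite groups of finite rank\<close>

definition fg_index :: "nat \<Rightarrow> (nat list list \<times> nat list) set" where
  "fg_index n = {(T, l). group (tab_group T) \<and> set l \<subseteq> {..<length T} \<and> length l = n}"

text \<open>Generators are numbered by all of \<open>nat\<close>, those from \<open>n\<close> on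
  being trivial, because their type cannot depend on \<open>n\<close>.\<close>

definition fg_gen :: "nat \<Rightarrow> nat \<Rightarrow> nat list list \<times> nat list \<Rightarrow> nat" where
  "fg_gen n j = (\<lambda>(T, l)\<in>fg_index n. if j < n then l ! j else 0)"

lemma fg_gen_apply: "(T, l) \<in> fg_index n \<Longrightarrow> fg_gen n j (T, l) = (if j < n then l ! j else 0)"
  by (auto simp: fg_gen_def)

lemma generated_product_fg: "generated_product (fg_index n) (\<lambda>i. tab_group (fst i)) (fg_gen n)"
proof (rule generated_product.intro)
  fix j
  show "fg_gen n j \<in> (\<Pi>\<^sub>E i\<in>fg_index n. carrier (tab_group (fst i)))"
  proof (rule PiE_I)
    fix i assume i: "i \<in> fg_index n"
    obtain T l where Tl: "i = (T, l)" by (cases i)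
    have *: "group (tab_group T)" "set l \<subseteq> {..<length T}" "length l = n"
      using i unfolding Tl fg_index_def by auto
    then have "l ! j < length T" if "j < n" using subsetD[OF *(2) nth_mem[of j l]] that by simp
    then show "fg_gen n j i \<in> carrier (tab_group (fst i))"
      using * tab_group_pos[OF *(1)] i unfolding Tl by (simp add: fg_gen_apply)
  qed (auto simp: fg_gen_def)
qed (auto simp: fg_index_def)

abbreviation free_fg :: "nat \<Rightarrow> (nat list list \<times> nat list \<Rightarrow> nat) tgroup" where
  "free_fg n \<equiv> closure_group (fg_index n) (\<lambda>i. tab_group (fst i)) (fg_gen n)"

lemma generate_range_upto:
  fixes n :: nat
  assumes "group A" "\<And>j. x j \<in> carrier A" "\<And>j. j \<ge> n \<Longrightarrow> x j = \<one>\<^bsub>A\<^esub>"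
  shows "generate A (range x) = generate A (x ` {..<n})"
proof
  interpret group A by fact
  have c: "x ` {..<n} \<subseteq> carrier A" "range x \<subseteq> carrier A" using assms(2) by auto
  show "generate A (range x) \<subseteq> generate A (x ` {..<n})"
  proof (rule generate_subgroup_incl)
    show "range x \<subseteq> generate A (x ` {..<n})"
    proof
      fix a assume "a \<in> range x"
      then obtain j where "a = x j" by auto
      then show "a \<in> generate A (x ` {..<n})"
        using assms(3)[of j] generate.one[of A] generate.incl[of "x j" "x ` {..<n}" A] by (cases "j < n") auto
    qed
  qed (use generate_is_subgroup[OF c(1)] in auto)
  show "generate A (x ` {..<n}) \<subseteq> generate A (range x)" by (rule mono_generate) auto
qed

text \<open>\<open>\<alpha>\<close> sends the \<open>n\<close> generators to generators of
  \<open>A\<close>, as \<open>gaschuetz_lemma\<close> requires; the resulting tuple over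
  \<open>B\<close> is an index of the product.\<close>

lemma SEP_free_fg: "SEP Jsub (free_fg n) (\<lambda>_. sort_seqs)"
proof -
  interpret fg: generated_product "fg_index n" "\<lambda>i. tab_group (fst i)" "fg_gen n" by (rule generated_product_fg)
  have gen1: "fg_gen n j = \<one>\<^bsub>fg.P\<^esub>" if "j \<ge> n" for j
    using that by (auto simp: fg_gen_def fg.one_P fun_eq_iff restrict_def)
  show ?thesis
  proof (rule fg.SEP_P)
    fix A B :: "nat tgroup" and \<pi> \<alpha> \<phi>
    assume A: "profinite A" "finite (carrier A)" and B: "profinite B" "finite (carrier B)"
      and \<pi>: "group_hom A B \<pi>" "\<pi> ` carrier A = carrier B"
      and \<alpha>: "group_hom fg.P A \<alpha>" "openin (gtop fg.P) (\<alpha> -` {\<one>\<^bsub>A\<^esub>} \<inter> carrier fg.P)" "\<alpha> ` carrier fg.P = carrier A"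
      and \<phi>: "group_hom fg.P B \<phi>" "openin (gtop fg.P) (\<phi> -` {\<one>\<^bsub>B\<^esub>} \<inter> carrier fg.P)" "\<phi> ` carrier fg.P = carrier B"
    interpret A: profinite A by fact
    interpret \<pi>: group_hom A B \<pi> by fact
    interpret \<alpha>: group_hom fg.P A \<alpha> by fact
    interpret \<phi>: group_hom fg.P B \<phi> by fact
    have \<alpha>A: "\<alpha> (fg_gen n j) \<in> carrier A" and \<phi>B: "\<phi> (fg_gen n j) \<in> carrier B" for j
      using fg.\<iota>_P by auto
    have ga: "generate A ((\<lambda>j. \<alpha> (fg_gen n j)) ` {..<n}) = carrier A"
      using generate_range_upto[OF A.group_axioms \<alpha>A, of n] fg.hom_image[OF \<alpha>(1,2)] \<alpha>(3) gen1 by simp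
    have gb: "generate B ((\<lambda>j. \<phi> (fg_gen n j)) ` {..<n}) = carrier B"
      using generate_range_upto[OF \<pi>.H.group_axioms \<phi>B, of n] fg.hom_image[OF \<phi>(1,2)] \<phi>(3) gen1 by simp
    obtain a where a: "\<And>j. j < n \<Longrightarrow> a j \<in> carrier A \<and> \<pi> (a j) = \<phi> (fg_gen n j)" "generate A (a ` {..<n}) = carrier A"
      using gaschuetz_lemma[OF \<pi> A(2) _ ga _ gb] \<alpha>A \<phi>B by blast
    obtain T k where T: "group (tab_group T)" and k: "k \<in> iso A (tab_group T)"
      using ex_tab_group_iso[OF A.group_axioms A(2)] by auto
    have kT: "k a < length T" if "a \<in> carrier A" for a using k that by (auto simp: iso_def hom_def)
    have kinj: "inj_on k (carrier A)" using k by (simp add: iso_def bij_betw_def)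
    let ?i = "(T, map (\<lambda>j. k (a j)) [0..<n])"
    have i: "?i \<in> fg_index n" unfolding fg_index_def using T kT a(1) by auto
    define m where "m = inv_into (carrier A) k"
    have m: "m \<in> iso (tab_group T) A" unfolding m_def using A.iso_set_sym[OF k] .
    have mk: "m (k a) = a" if "a \<in> carrier A" for a using that kinj by (simp add: m_def)
    have m0: "m 0 = \<one>\<^bsub>A\<^esub>"
    proof -
      have "group_hom (tab_group T) A m" using m T A.group_axioms by (simp add: group_hom_def group_hom_axioms_def iso_def)
      then show ?thesis using group_hom.hom_one by fastforce
    qed
    define g where "g j = m (fg_gen n j ?i)" for j
    have g: "g j = (if j < n then a j else \<one>\<^bsub>A\<^esub>)" for j
      unfolding g_def fg_gen_apply[OF i] using a(1) mk m0 by simp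
    have "generate A (range g) = generate A (g ` {..<n})"
      by (rule generate_range_upto[OF A.group_axioms]) (use g a(1) in auto)
    also have "g ` {..<n} = a ` {..<n}" using g by auto
    finally have "generate A (range g) = carrier A" using a(2) by simp
    moreover have "\<pi> (g j) = \<phi> (fg_gen n j)" for j using g a(1) gen1[of j] by (cases "j < n") auto
    ultimately show "\<exists>i\<in>fg_index n. \<exists>m\<in>iso (tab_group (fst i)) A. (\<forall>x. \<pi> (m (fg_gen n x i)) = \<phi> (fg_gen n x)) \<and>
        generate A (range (\<lambda>x. m (fg_gen n x i))) = carrier A"
      using i m by (intro bexI[of _ ?i] bexI[of _ m]) (auto simp: g_def)
  qed
qed

lemma ex_free_fg_cover:
  fixes G :: "'a tgroup"
  assumes "sorted_profinite Jsub G F" "topologically_fg G"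
  shows "\<exists>n p. sorted_morphism (free_fg n) (\<lambda>_. sort_seqs) G F p"
proof -
  note GD = sorted_profiniteD[OF assms(1)]
  interpret G: profinite G by (rule GD(1))
  obtain S where S: "finite S" "S \<subseteq> carrier G" "gtop G closure_of generate G S = carrier G"
    using assms(2) by (auto simp: topologically_fg_def)
  obtain xs where xs: "set xs = S" using finite_list[OF S(1)] by auto
  define n where "n = length xs"
  interpret fg: generated_product "fg_index n" "\<lambda>i. tab_group (fst i)" "fg_gen n" by (rule generated_product_fg)
  define h where "h j = (if j < n then xs ! j else \<one>\<^bsub>G\<^esub>)" for j
  have hG: "h j \<in> carrier G" for j using xs S(2) nth_mem[of j xs] by (auto simp: h_def n_def)
  have "\<exists>p. sorted_morphism fg.P (\<lambda>_. sort_seqs) G F p \<and> (\<forall>x. p (fg_gen n x) = h x)"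
  proof (rule fg.ex_cover[OF GD(1) hG])
    have "h ` {..<n} = S" using xs by (auto simp: h_def n_def set_conv_nth)
    moreover have "generate G (range h) = generate G (h ` {..<n})"
      by (rule generate_range_upto[OF G.group_axioms hG]) (simp add: h_def)
    ultimately show "gtop G closure_of generate G (range h) = carrier G" using S(3) by simp
    fix N assume N: "N \<in> open_normal G"
    show "F N \<subseteq> sort_seqs" using sorting_onD(2)[OF GD(2) N] .
    obtain T c where T: "group (tab_group T)" and c: "group_hom G (tab_group T) c"
      and ker: "\<forall>g\<in>carrier G. c g = 0 \<longleftrightarrow> g \<in> N"
      using ex_tab_quotient[OF GD(1) N] by auto
    interpret c: group_hom G "tab_group T" c by fact
    let ?i = "(T, map (\<lambda>j. c (h j)) [0..<n])"
    have i: "?i \<in> fg_index n" unfolding fg_index_def using T c.hom_closed[OF hG] by auto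
    have ch: "c (h j) = fg_gen n j ?i" for j
    proof -
      have "h j = \<one>\<^bsub>G\<^esub>" if "\<not> j < n" using that by (simp add: h_def)
      then show ?thesis unfolding fg_gen_apply[OF i] using c.hom_one by (cases "j < n") simp_all
    qed
    show "\<exists>i\<in>fg_index n. \<exists>c. group_hom G (tab_group (fst i)) c \<and>
        (\<forall>g\<in>carrier G. c g = \<one>\<^bsub>tab_group (fst i)\<^esub> \<longleftrightarrow> g \<in> N) \<and> (\<forall>x. c (h x) = fg_gen n x i)"
      by (intro bexI[OF _ i] exI[of _ c] conjI allI ch) (use c ker in simp_all)
  qed
  then show ?thesis by blast
qed

section \<open>The universal cover\<close>

lemma composite_morphism_rel:
  fixes P :: "'p tgroup" and E :: "'c tgroup" and H :: "'b tgroup"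
  assumes "profinite P" "profinite E" "profinite H" and rs: "rel_sorting Jsub P K \<Phi>"
    and q: "rel_lift E FE P K \<Phi> q" and f: "rel_morphism P K \<Phi> H FH f"
  shows "\<exists>g. sorted_morphism E FE H FH g \<and> (\<forall>e\<in>carrier E. \<forall>x\<in>q e. g e = f x)"
  using lift.sorted_morphism_along[OF rel_liftD[OF q assms(1,2) rs] f assms(3)] by blast

text \<open>The bottom of the tower is \<open>G\<close> itself, seen as the quotient of
  \<open>P\<close> by the kernel of \<open>p\<close>. A morphism \<open>r\<close> to
  \<open>G\<close> becomes a lift by taking fibres of \<open>p\<close>.\<close>

lemma cover_rel_sorting:
  fixes P :: "'p tgroup" and G :: "'a tgroup"
  assumes P: "profinite P" and G: "sorted_profinite Jsub G F" and p: "sorted_morphism P F' G F p"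
  defines "K \<equiv> p -` {\<one>\<^bsub>G\<^esub>} \<inter> carrier P"
  defines "\<Phi> \<equiv> \<lambda>N. if N \<in> open_normal_over P K then F (p ` N) else {}"
  shows "rel_sorting Jsub P K \<Phi>" "rel_morphism P K \<Phi> G F p"
    "\<And>(E :: 'c tgroup) FE r. sorted_profinite Jsub E FE \<Longrightarrow> sorted_morphism E FE G F r \<Longrightarrow>
       rel_lift E FE P K \<Phi> (\<lambda>e. {x \<in> carrier P. p x = r e})"
proof -
  interpret P: profinite P by fact
  note GD = sorted_profiniteD[OF G]
  interpret G: profinite G by (rule GD(1))
  note pD = sorted_morphismD[OF p]
  interpret p: group_hom P G p using pD(1) by unfold_locales
  have Kn: "K \<lhd> P" unfolding K_def using vimage_normal[OF p.group_hom_axioms G.one_is_normal] .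
  have "closedin (gtop P) {x \<in> topspace (gtop P). p x \<in> {\<one>\<^bsub>G\<^esub>}}"
    using closedin_continuous_map_preimage[OF pD(2) G.one_closed_set] .
  moreover have "{x \<in> topspace (gtop P). p x \<in> {\<one>\<^bsub>G\<^esub>}} = K" by (auto simp: K_def)
  ultimately have Kc: "closedin (gtop P) K" by simp
  have im: "p ` N \<in> open_normal G" if "N \<in> open_normal_over P K" for N
    using image_open_normal[OF P G.profinite_axioms pD(1,2,3)] that by (simp add: open_normal_over_def)
  have vi: "x \<in> N" if N: "N \<in> open_normal_over P K" and x: "x \<in> carrier P" "p x \<in> p ` N" for N x
  proof -
    obtain n where n: "n \<in> N" "p x = p n" using x(2) by auto
    have Nn: "N \<lhd> P" "K \<subseteq> N" using N by (auto simp: open_normal_over_def open_normal_def)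
    have nP: "n \<in> carrier P" using n(1) P.normalD(2)[OF Nn(1)] by auto
    have "x \<otimes>\<^bsub>P\<^esub> inv\<^bsub>P\<^esub> n \<in> K" using x(1) nP n(2) by (simp add: K_def)
    then have "x \<otimes>\<^bsub>P\<^esub> inv\<^bsub>P\<^esub> n \<otimes>\<^bsub>P\<^esub> n \<in> N" by (rule P.normalD(4)[OF Nn(1) subsetD[OF Nn(2)] n(1)])
    then show ?thesis using x(1) nP by (simp add: P.m_assoc)
  qed
  have vim: "p -` (p ` N) \<inter> carrier P = N" if N: "N \<in> open_normal_over P K" for N
  proof
    show "p -` (p ` N) \<inter> carrier P \<subseteq> N" using vi[OF N] by auto
    show "N \<subseteq> p -` (p ` N) \<inter> carrier P"
      using P.normalD(2) N by (auto simp: open_normal_over_def open_normal_def)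
  qed
  have "sorting_on Jsub (open_normal_over P K) (carrier P) (index P) (\<lambda>N. F (p ` N))"
  proof (rule sorting_on_pull[OF GD(2)])
    fix N assume N: "N \<in> open_normal_over P K"
    show "p ` N \<in> open_normal G" using im[OF N] .
    show "index G (p ` N) = index P N"
      using card_rcosets_vimage[OF p.group_hom_axioms pD(3), of "p ` N"] im[OF N]
      unfolding vim[OF N] by (simp add: open_normal_def normal_imp_subgroup)
    fix M assume M: "M \<in> open_normal_over P K"
    \<comment> \<open>Images commute with intersections here because both subgroups are unions of
      fibres of \<open>p\<close>.\<close>
    show "p ` (N \<inter> M) = p ` N \<inter> p ` M"
    proof
      show "p ` N \<inter> p ` M \<subseteq> p ` (N \<inter> M)"
      proof
        fix y assume y: "y \<in> p ` N \<inter> p ` M"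
        then obtain x where x: "x \<in> N" "y = p x" by auto
        then have xP: "x \<in> carrier P" using vim[OF N] by auto
        then have "x \<in> M" using y x vi[OF M xP] by auto
        then show "y \<in> p ` (N \<inter> M)" using x by auto
      qed
    qed auto
  qed (use pD(3) in auto)
  then have "sorting_on Jsub (open_normal_over P K) (carrier P) (index P) \<Phi>"
    by (rule sorting_on_cong[OF _ P.carrier_open_normal_over[OF Kn] _ P.open_normal_over_Int])
      (simp_all add: \<Phi>_def)
  then show "rel_sorting Jsub P K \<Phi>"
    unfolding rel_sorting_def using Kn Kc by (simp add: \<Phi>_def)
  have v: "p -` M \<inter> carrier P \<in> open_normal_over P K" "p ` (p -` M \<inter> carrier P) = M" if M: "M \<in> open_normal G" for M
  proof -
    note Mn = G.normalD[OF G.open_normalD(1)[OF M]]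
    show "p -` M \<inter> carrier P \<in> open_normal_over P K"
      using vimage_open_normal[OF P G.profinite_axioms pD(1,2) M] Mn(3)
      by (auto simp: open_normal_over_def K_def)
    show "p ` (p -` M \<inter> carrier P) = M" using Mn(2) unfolding pD(3)[symmetric] by blast
  qed
  show "rel_morphism P K \<Phi> G F p"
    unfolding rel_morphism_def using pD(1,3) v
    by (auto simp: K_def \<Phi>_def open_normal_over_def)
  fix E :: "'c tgroup" and FE r
  assume E: "sorted_profinite Jsub E FE" and r: "sorted_morphism E FE G F r"
  interpret E: profinite E using sorted_profiniteD(1)[OF E] .
  note rD = sorted_morphismD[OF r]
  have onto: "\<exists>x\<in>carrier P. p x = g" if "g \<in> carrier G" for g using that pD(3) by (metis imageE)
  show "rel_lift E FE P K \<Phi> (\<lambda>e. {x \<in> carrier P. p x = r e})"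
    unfolding rel_lift_def
  proof (intro conjI ballI)
    show "\<exists>x\<in>carrier P. {x \<in> carrier P. p x = r e} = K #>\<^bsub>P\<^esub> x" if e: "e \<in> carrier E" for e
    proof -
      obtain x where x: "x \<in> carrier P" "p x = r e" using onto[OF rD(4)[OF e]] by auto
      have "p y = r e \<longleftrightarrow> y \<otimes>\<^bsub>P\<^esub> inv\<^bsub>P\<^esub> x \<in> K" if y: "y \<in> carrier P" for y
        using y x G.mult_inv_eq_one_iff[OF p.hom_closed[OF y] p.hom_closed[OF x(1)]] by (simp add: K_def)
      then have "{x \<in> carrier P. p x = r e} = K #>\<^bsub>P\<^esub> x"
        using P.mem_rcos_iff[OF P.normalD(1)[OF Kn] x(1)] by auto
      then show ?thesis using x by blast
    qed
    show "x \<otimes>\<^bsub>P\<^esub> x' \<in> {x \<in> carrier P. p x = r (e \<otimes>\<^bsub>E\<^esub> e')}"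
      if "e \<in> carrier E" "e' \<in> carrier E" "x \<in> {x \<in> carrier P. p x = r e}" "x' \<in> {x \<in> carrier P. p x = r e'}" for e e' x x'
      using that rD(5)[OF that(1,2)] by auto
    show "\<exists>e\<in>carrier E. x \<in> {x \<in> carrier P. p x = r e}" if x: "x \<in> carrier P" for x
    proof -
      have "p x \<in> r ` carrier E" using p.hom_closed[OF x] rD(3) by simp
      then show ?thesis using x by auto
    qed
    fix N assume N: "N \<in> open_normal_over P K"
    have eq: "{e \<in> carrier E. {x \<in> carrier P. p x = r e} \<subseteq> N} = r -` (p ` N) \<inter> carrier E"
    proof -
      have "{x \<in> carrier P. p x = r e} \<subseteq> N \<longleftrightarrow> r e \<in> p ` N" if e: "e \<in> carrier E" for e
      proof -
        obtain x where x: "x \<in> carrier P" "p x = r e" using onto[OF rD(4)[OF e]] by auto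
        show ?thesis
        proof
          assume "{x \<in> carrier P. p x = r e} \<subseteq> N"
          then show "r e \<in> p ` N" using x by (metis (mono_tags, lifting) image_eqI mem_Collect_eq subsetD)
        next
          assume "r e \<in> p ` N"
          then show "{x \<in> carrier P. p x = r e} \<subseteq> N" using vi[OF N] by auto
        qed
      qed
      then show ?thesis by auto
    qed
    show "{e \<in> carrier E. {x \<in> carrier P. p x = r e} \<subseteq> N} \<in> open_normal E"
      unfolding eq using vimage_open_normal[OF E.profinite_axioms G.profinite_axioms rD(1,2) im[OF N]] .
    show "\<Phi> N \<subseteq> FE {e \<in> carrier E. {x \<in> carrier P. p x = r e} \<subseteq> N}"
      unfolding eq using rD(6)[OF im[OF N]] N by (simp add: \<Phi>_def)
  qed
qed

text \<open>Cosets are labelled by chosen representatives, moved to another type by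
  \<open>e\<close>; the last quotient of the tower gets its carrier in \<open>'a cover_type\<close>
  in this way.\<close>

lemma ex_coset_map_inj:
  fixes P :: "'p tgroup" and e :: "'p \<Rightarrow> 'b"
  assumes "profinite P" "K \<lhd> P" "closedin (gtop P) K" and e: "inj_on e (carrier P)"
  shows "\<exists>c :: 'p \<Rightarrow> 'b. coset_map P K c"
proof -
  interpret P: profinite P by fact
  note Ks = P.normalD(1)[OF assms(2)]
  define s where "s a = (SOME b. b \<in> K #>\<^bsub>P\<^esub> a)" for a
  have s: "s a \<in> K #>\<^bsub>P\<^esub> a" "s a \<in> carrier P" if "a \<in> carrier P" for a
  proof -
    show *: "s a \<in> K #>\<^bsub>P\<^esub> a" unfolding s_def using P.rcos_self[OF that Ks] by (rule someI)
    then show "s a \<in> carrier P" using P.mem_rcos_iff[OF Ks that] by simp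
  qed
  have "e (s x) = e (s y) \<longleftrightarrow> x \<otimes>\<^bsub>P\<^esub> inv\<^bsub>P\<^esub> y \<in> K" if xy: "x \<in> carrier P" "y \<in> carrier P" for x y
  proof -
    have "e (s x) = e (s y) \<longleftrightarrow> s x = s y" using inj_onD[OF e _ s(2)[OF xy(1)] s(2)[OF xy(2)]] by auto
    also have "\<dots> \<longleftrightarrow> K #>\<^bsub>P\<^esub> x = K #>\<^bsub>P\<^esub> y"
      using s(1)[OF xy(1)] s(1)[OF xy(2)] P.repr_independence[OF _ xy(1) Ks] P.repr_independence[OF _ xy(2) Ks]
      unfolding s_def by metis
    finally show ?thesis using P.rcos_eq_iff[OF Ks xy] by simp
  qed
  then have "coset_map P K (\<lambda>x. e (s x))" using assms by (simp add: coset_map_def coset_map_axioms_def)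
  then show ?thesis by blast
qed

lemma (in coset_map) SEP_quo:
  assumes "rel_SEP Jsub G K \<Phi>"
  shows "SEP Jsub (quo G p) (\<lambda>M. \<Phi> (p -` M \<inter> carrier G))"
proof -
  let ?F = "\<lambda>M. \<Phi> (p -` M \<inter> carrier G)"
  have "\<exists>\<psi>. sorted_morphism (quo G p) ?F A FA \<psi> \<and> (\<forall>x\<in>carrier (quo G p). \<pi> (\<psi> x) = \<phi> x)"
    if A: "sorted_profinite Jsub A FA" "finite (carrier A)" and B: "sorted_profinite Jsub B FB" "finite (carrier B)"
      and \<pi>: "sorted_morphism A FA B FB \<pi>" and \<alpha>: "sorted_morphism (quo G p) ?F A FA \<alpha>"
      and \<phi>: "sorted_morphism (quo G p) ?F B FB \<phi>"
    for A B :: "nat tgroup" and FA FB \<pi> \<alpha> \<phi>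
  proof -
    note Ap = sorted_profiniteD(1)[OF A(1)] and Bp = sorted_profiniteD(1)[OF B(1)]
    have "embedding_problem Jsub G K \<Phi> A FA B FB \<pi> (\<lambda>x. \<phi> (p x))"
      unfolding embedding_problem_def
      using A B \<pi> sorted_morphism_quo[OF \<phi> Bp] sorted_morphism_quo[OF \<alpha> Ap] by blast
    then have "solvable G K \<Phi> A FA \<pi> (\<lambda>x. \<phi> (p x))" using assms unfolding rel_SEP_def by simp
    then obtain \<psi> where \<psi>: "rel_morphism G K \<Phi> A FA \<psi>" "\<And>x. x \<in> carrier G \<Longrightarrow> \<pi> (\<psi> x) = \<phi> (p x)"
      unfolding solvable_def by auto
    note f = rel_morphism_quo[OF \<psi>(1) Ap]
    then show ?thesis using \<psi>(2) by (intro exI[of _ "\<lambda>a. \<psi> (inv_into (carrier G) p a)"]) (auto simp: quo_carrier)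
  qed
  then show ?thesis unfolding SEP_def SIm_def by blast
qed

lemma (in coset_map) rel_morphism_self:
  "rel_morphism G K \<Phi> (quo G p) (\<lambda>M. \<Phi> (p -` M \<inter> carrier G)) p"
  unfolding rel_morphism_def
proof (intro conjI ballI)
  interpret h: group_hom G "quo G p" p by (rule quo_hom)
  show "p \<in> hom G (quo G p)" by (rule h.homh)
  show "p ` carrier G = carrier (quo G p)" by (simp add: quo_carrier)
  show "p x = \<one>\<^bsub>quo G p\<^esub>" if "x \<in> K" for x
  proof -
    have "x \<in> carrier G" using that subsetD[OF normalD(2)[OF K_normal]] by simp
    then show ?thesis unfolding quo_one using that p_eq_one by (simp del: h.hom_one)
  qed
  show "p -` M \<inter> carrier G \<in> open_normal G" if "M \<in> open_normal (quo G p)" for M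
    using vimage_open_normal_over[OF that] by (simp add: open_normal_over_def)
qed simp

text \<open>\<open>P\<close>, the tower and \<open>c\<close> are independent of the type
  \<open>'c\<close> of competing covers, so the same cover is universal in every type.\<close>

lemma (in tower) universal_quo:
  fixes G :: "'b tgroup" and c :: "'a \<Rightarrow> 'd" and p :: "'a \<Rightarrow> 'b"
  assumes G: "sorted_profinite Jsub G F" and p: "sorted_morphism P (\<lambda>_. sort_seqs) G F p"
  defines "K \<equiv> p -` {\<one>\<^bsub>G\<^esub>} \<inter> carrier P"
  defines "a \<equiv> (K, \<lambda>N. if N \<in> open_normal_over P K then F (p ` N) else {})"
  assumes c: "coset_map P (fst (fixp_above a)) c"
  shows "universal_SEP_cover TYPE('c) Jsub G F (quo P c)
    (\<lambda>M. snd (fixp_above a) (c -` M \<inter> carrier P)) (\<lambda>b. p (inv_into (carrier P) c b))"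
proof -
  let ?x = "fixp_above a"
  let ?H = "quo P c" and ?FH = "\<lambda>M. snd (fixp_above a) (c -` M \<inter> carrier P)" and ?f = "\<lambda>b. p (inv_into (carrier P) c b)"
  note R = cover_rel_sorting[OF profinite_axioms G p, folded K_def]
  note GD = sorted_profiniteD[OF G]
  interpret c: coset_map P "fst ?x" c by (rule c)
  have a: "a \<in> Field (tower_le Jsub P)" using R(1) by (simp add: Field_tower_le a_def)
  have rs: "rel_sorting Jsub P (fst ?x) (snd ?x)" using fixp_above_Field[OF a] by (simp add: Field_tower_le)
  have "(a, ?x) \<in> tower_le Jsub P" using iterates_above_ge[OF fixp_iterates_above a] .
  then have le: "fst ?x \<subseteq> fst a" "\<And>N. snd a N \<subseteq> snd ?x N" by (auto simp: tower_le_def)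
  \<comment> \<open>Going up the tower shrinks the kernel and enlarges the data, so \<open>p\<close>
    remains a morphism.\<close>
  have rm: "rel_morphism P (fst ?x) (snd ?x) G F p"
  proof -
    have "rel_morphism P (fst a) (snd a) G F p" using R(2) by (simp add: a_def)
    then show ?thesis using le unfolding rel_morphism_def by (meson subset_iff)
  qed
  have cover: "SEP_cover Jsub G F ?H ?FH ?f"
    unfolding SEP_cover_def
    using c.quo_sorted[OF rel_sortingD(3)[OF rs]] c.SEP_quo[OF fixp_rel_SEP[OF a]] c.rel_morphism_quo(1)[OF rm GD(1)]
    by simp
  have "\<exists>g. sorted_morphism E FE ?H ?FH g \<and> (\<forall>x\<in>carrier E. ?f (g x) = r x)"
    if E: "SEP_cover Jsub G F E FE r" for E :: "'c tgroup" and FE r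
  proof -
    have ED: "sorted_profinite Jsub E FE" "SEP Jsub E FE" "sorted_morphism E FE G F r"
      using E by (auto simp: SEP_cover_def)
    note Ep = sorted_profiniteD(1)[OF ED(1)]
    have "rel_lift E FE P (fst a) (snd a) (\<lambda>e. {x \<in> carrier P. p x = r e})"
      using R(3)[OF ED(1,3)] by (simp add: a_def)
    then obtain q where q: "rel_lift E FE P (fst ?x) (snd ?x) q" "\<forall>e\<in>carrier E. q e \<subseteq> {x \<in> carrier P. p x = r e}"
      using fixp_lift[OF a ED(1,2)] by blast
    interpret L: lift P E "fst ?x" FE "snd ?x" q using rel_liftD[OF q(1) profinite_axioms Ep rs] .
    obtain g where g: "sorted_morphism E FE ?H ?FH g" "\<forall>e\<in>carrier E. \<forall>x\<in>q e. g e = c x"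
      using composite_morphism_rel[OF profinite_axioms Ep profiniteI[OF c.quo_profinite] rs q(1) c.rel_morphism_self]
      by auto
    have "?f (g e) = r e" if e: "e \<in> carrier E" for e
    proof -
      obtain x where x: "x \<in> q e" using L.q_ex[OF e] by auto
      then have "x \<in> carrier P" "p x = r e" "g e = c x" using q(2) g(2) e by auto
      then show ?thesis using c.rel_morphism_quo(2)[OF rm GD(1)] by simp
    qed
    then show ?thesis using g(1) by blast
  qed
  then show ?thesis unfolding universal_SEP_cover_def using cover by blast
qed

section \<open>Finitely many subgroups of each index, and uniqueness\<close>

lemma (in generated_product) gens_dense:
  assumes U: "U \<in> open_normal P" and z: "z \<in> carrier P"
  shows "\<exists>y\<in>generate P (range \<iota>). z \<otimes>\<^bsub>P\<^esub> inv\<^bsub>P\<^esub> y \<in> U"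
proof -
  interpret P: profinite P by (rule P_profinite)
  note Un = P.open_normalD[OF U]
  note Us = P.normalD[OF Un(1)]
  obtain J where J: "finite J" "J \<subseteq> I" "near J z \<subseteq> U #>\<^bsub>P\<^esub> z"
    using near_base[OF P.open_rcos[OF Un(2) z] P.rcos_self[OF z Us(1)]] by auto
  obtain y where y: "y \<in> gens" "\<forall>j\<in>J. z j = y j" using carrier_PD(3)[OF z J(1,2)] by auto
  have yP: "y \<in> carrier P" using y(1) gens_P by auto
  then have "y \<in> U #>\<^bsub>P\<^esub> z" using J(3) y(2) by (auto simp: near_def)
  then have "inv\<^bsub>P\<^esub> (y \<otimes>\<^bsub>P\<^esub> inv\<^bsub>P\<^esub> z) \<in> U" using P.mem_rcos_iff[OF Us(1) z] by (intro Us(5)) simp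
  then have "z \<otimes>\<^bsub>P\<^esub> inv\<^bsub>P\<^esub> y \<in> U" using yP z by (simp add: P.inv_mult_group)
  then show ?thesis using y(1) gens_eq by blast
qed

text \<open>
  An open normal subgroup of index \<open>m\<close> is determined by the action of finitely many generators on
  a set of \<open>m\<close> cosets.
\<close>

lemma (in profinite) finite_open_normal_index:
  assumes S: "finite S" "S \<subseteq> carrier G"
    and dense: "\<And>N x. N \<in> open_normal G \<Longrightarrow> x \<in> carrier G \<Longrightarrow> \<exists>y\<in>generate G S. x \<otimes> inv y \<in> N"
  shows "finite {N \<in> open_normal G. index G N = m}" (is "finite ?X")
proof -
  have "\<exists>b. \<forall>N\<in>?X. bij_betw (b N) (rcosets N) {0..<m}"
  proof (rule bchoice, rule ballI)
    fix N assume N: "N \<in> ?X"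
    then have "finite (rcosets N)" using finite_rcosets[of N] by (auto simp: open_normal_def normal_imp_subgroup)
    then show "\<exists>b. bij_betw b (rcosets N) {0..<m}" using ex_bij_betw_finite_nat[of "rcosets N"] N by auto
  qed
  then obtain b where b: "\<And>N. N \<in> ?X \<Longrightarrow> bij_betw (b N) (rcosets N) {0..<m}" by auto
  \<comment> \<open>The number of the coset of \<open>x\<close> under a numbering of the cosets of
    \<open>N\<close> below \<open>m\<close>.\<close>
  define \<beta> where "\<beta> N x = b N (N #> x)" for N x
  have sub: "subgroup N G" if "N \<in> ?X" for N using that by (auto simp: open_normal_def normal_imp_subgroup)
  have \<beta>lt: "\<beta> N x < m" if "N \<in> ?X" "x \<in> carrier G" for N x
  proof -
    have "N #> x \<in> rcosets N" using that(2) by (auto simp: RCOSETS_def)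
    then have "b N (N #> x) \<in> b N ` (rcosets N)" by (rule imageI)
    then show ?thesis using b[OF that(1)] by (simp add: \<beta>_def bij_betw_def)
  qed
  have \<beta>eq: "\<beta> N x = \<beta> N y \<longleftrightarrow> x \<otimes> inv y \<in> N" if N: "N \<in> ?X" and x: "x \<in> carrier G" "y \<in> carrier G" for N x y
  proof -
    have "N #> x \<in> rcosets N" "N #> y \<in> rcosets N" using x by (auto simp: RCOSETS_def)
    then have "\<beta> N x = \<beta> N y \<longleftrightarrow> N #> x = N #> y"
      using b[OF N] by (auto simp: \<beta>_def bij_betw_def inj_on_eq_iff)
    then show ?thesis using rcos_eq_iff[OF sub[OF N] x] by simp
  qed
  have \<beta>onto: "\<exists>x\<in>carrier G. \<beta> N x = i" if N: "N \<in> ?X" and i: "i < m" for N i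
  proof -
    have "i \<in> b N ` (rcosets N)" using b[OF N] i by (simp add: bij_betw_def)
    then show ?thesis by (auto simp: \<beta>_def RCOSETS_def)
  qed
  \<comment> \<open>The action of the generators on numbered cosets; well defined because right
    multiplication permutes the right cosets.\<close>
  define \<tau> where "\<tau> N = (\<lambda>(s, i)\<in>S \<times> {..<m}. \<beta> N ((SOME x. x \<in> carrier G \<and> \<beta> N x = i) \<otimes> s))" for N
  have \<tau>: "\<tau> N (s, \<beta> N x) = \<beta> N (x \<otimes> s)" if N: "N \<in> ?X" and x: "x \<in> carrier G" and s: "s \<in> S" for N x s
  proof -
    let ?y = "SOME y. y \<in> carrier G \<and> \<beta> N y = \<beta> N x"
    have y: "?y \<in> carrier G \<and> \<beta> N ?y = \<beta> N x" using x by (intro someI[of "\<lambda>y. y \<in> carrier G \<and> \<beta> N y = \<beta> N x"]) simp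
    have sG: "s \<in> carrier G" using s S(2) by auto
    have "?y \<otimes> inv x \<in> N" using \<beta>eq[OF N, of ?y x] y x by simp
    moreover have "?y \<otimes> inv x = (?y \<otimes> s) \<otimes> inv (x \<otimes> s)"
      using y x sG by (simp add: inv_mult_group m_assoc inv_cancel)
    ultimately have "\<beta> N (?y \<otimes> s) = \<beta> N (x \<otimes> s)" using \<beta>eq[OF N] y x sG by simp
    then show ?thesis using s \<beta>lt[OF N x] by (simp add: \<tau>_def)
  qed
  let ?pat = "\<lambda>N. (\<beta> N \<one>, \<tau> N)"
  have "inj_on ?pat ?X"
  proof (rule inj_onI)
    fix N N' assume N: "N \<in> ?X" and N': "N' \<in> ?X" and eq: "?pat N = ?pat N'"
    \<comment> \<open>With equal tables the action of every word agrees; with equal numbers for the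
      coset of 1, a word then lies in \<open>N\<close> iff it lies in \<open>N'\<close>.\<close>
    have step: "\<forall>x\<in>carrier G. \<forall>x'\<in>carrier G. \<beta> N x = \<beta> N' x' \<longrightarrow> \<beta> N (x \<otimes> y) = \<beta> N' (x' \<otimes> y)"
      if "y \<in> generate G S" for y
      using that
    proof induction
      case one
      then show ?case by simp
    next
      case (incl s)
      then show ?case using \<tau>[OF N _ incl] \<tau>[OF N' _ incl] eq by (metis prod.inject)
    next
      case (inv s)
      have sG: "s \<in> carrier G" using inv S(2) by auto
      show ?case
      proof (intro ballI impI)
        fix x x' assume x: "x \<in> carrier G" "x' \<in> carrier G" "\<beta> N x = \<beta> N' x'"
        have xs: "x \<otimes> inv s \<in> carrier G" using x sG by simp
        \<comment> \<open>The table records multiplication by \<open>s\<close> only.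
          \<open>z\<close> has the required number for \<open>N'\<close>, and multiplying it by
          \<open>s\<close> identifies its coset.\<close>
        obtain z where z: "z \<in> carrier G" "\<beta> N' z = \<beta> N (x \<otimes> inv s)" using \<beta>onto[OF N' \<beta>lt[OF N xs]] by auto
        have "\<beta> N (x \<otimes> inv s \<otimes> s) = \<beta> N' (z \<otimes> s)"
          using \<tau>[OF N xs inv] \<tau>[OF N' z(1) inv] eq z(2) by (metis prod.inject)
        then have "\<beta> N' (z \<otimes> s) = \<beta> N' x'" using x sG by (simp add: m_assoc)
        then have "z \<otimes> s \<otimes> inv x' \<in> N'" using \<beta>eq[OF N'] x z sG by simp
        moreover have "z \<otimes> s \<otimes> inv x' = z \<otimes> inv (x' \<otimes> inv s)" using x z sG by (simp add: inv_mult_group m_assoc)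
        ultimately have "z \<otimes> inv (x' \<otimes> inv s) \<in> N'" by metis
        then have "\<beta> N' z = \<beta> N' (x' \<otimes> inv s)" using \<beta>eq[OF N' z(1), of "x' \<otimes> inv s"] x sG by blast
        then show "\<beta> N (x \<otimes> inv s) = \<beta> N' (x' \<otimes> inv s)" using z(2) by simp
      qed
    next
      case (eng y z)
      have yz: "y \<in> carrier G" "z \<in> carrier G" using eng(1,2) generate_in_carrier[OF S(2)] by auto
      show ?case
      proof (intro ballI impI)
        fix x x' assume x: "x \<in> carrier G" "x' \<in> carrier G" "\<beta> N x = \<beta> N' x'"
        have "\<beta> N (x \<otimes> y) = \<beta> N' (x' \<otimes> y)" using eng(3) x by blast
        then have "\<beta> N (x \<otimes> y \<otimes> z) = \<beta> N' (x' \<otimes> y \<otimes> z)" using eng(4) x yz by simp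
        then show "\<beta> N (x \<otimes> (y \<otimes> z)) = \<beta> N' (x' \<otimes> (y \<otimes> z))" using x yz by (simp add: m_assoc)
      qed
    qed
    have mem: "y \<in> N \<longleftrightarrow> y \<in> N'" if y: "y \<in> generate G S" for y
    proof -
      have yG: "y \<in> carrier G" using generate_in_carrier[OF S(2) y] .
      have "\<beta> N y = \<beta> N' y" using step[OF y, rule_format, of \<one> \<one>] eq yG by simp
      then have "\<beta> N y = \<beta> N \<one> \<longleftrightarrow> \<beta> N' y = \<beta> N' \<one>" using eq by simp
      then show ?thesis using \<beta>eq[OF N yG, of \<one>] \<beta>eq[OF N' yG, of \<one>] yG by simp
    qed
    \<comment> \<open>Density approximates \<open>x\<close> modulo \<open>N \<inter> N'\<close> by a
      word \<open>y\<close>, which lies in \<open>N\<close> together with \<open>x\<close>, hence in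
      \<open>N'\<close>.\<close>
    have incl: "N \<subseteq> N'" if N: "N \<in> ?X" and N': "N' \<in> ?X" and mem: "\<And>y. y \<in> generate G S \<Longrightarrow> y \<in> N \<longleftrightarrow> y \<in> N'" for N N'
    proof
      fix x assume x: "x \<in> N"
      have xG: "x \<in> carrier G" using x subgroup.subset[OF sub[OF N]] by auto
      have "N \<inter> N' \<in> open_normal G" using N N' Int_open_normal by auto
      then obtain y where y: "y \<in> generate G S" "x \<otimes> inv y \<in> N" "x \<otimes> inv y \<in> N'"
        using dense[OF _ xG, of "N \<inter> N'"] by auto
      have yG: "y \<in> carrier G" using generate_in_carrier[OF S(2) y(1)] .
      have "inv (x \<otimes> inv y) \<otimes> x \<in> N"
        using subgroup.m_closed[OF sub[OF N] subgroup.m_inv_closed[OF sub[OF N] y(2)] x] .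
      then have "y \<in> N" using xG yG by (simp add: inv_mult_group m_assoc)
      then have "y \<in> N'" using mem[OF y(1)] by simp
      then have "x \<otimes> inv y \<otimes> y \<in> N'" using subgroup.m_closed[OF sub[OF N'] y(3)] by simp
      then show "x \<in> N'" using xG yG by (simp add: m_assoc)
    qed
    show "N = N'" using incl[OF N N'] incl[OF N' N] mem by blast
  qed
  moreover have "?pat ` ?X \<subseteq> {..<m} \<times> ((S \<times> {..<m}) \<rightarrow>\<^sub>E {..<m})"
  proof
    fix z assume "z \<in> ?pat ` ?X"
    then obtain N where N: "N \<in> ?X" "z = ?pat N" by blast
    have "\<tau> N (s, i) < m" if si: "s \<in> S" "i < m" for s i
    proof -
      obtain x where x: "x \<in> carrier G" "\<beta> N x = i" using \<beta>onto[OF N(1) si(2)] by auto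
      then show ?thesis using \<tau>[OF N(1) x(1) si(1)] \<beta>lt[OF N(1), of "x \<otimes> s"] si(1) S(2) by auto
    qed
    then show "z \<in> {..<m} \<times> ((S \<times> {..<m}) \<rightarrow>\<^sub>E {..<m})"
      using N \<beta>lt[OF N(1)] by (auto simp: \<tau>_def)
  qed
  moreover have "finite ({..<m} \<times> ((S \<times> {..<m}) \<rightarrow>\<^sub>E {..<m}))"
    using S(1) by (intro finite_cartesian_product finite_PiE) auto
  ultimately show ?thesis using inj_on_finite by blast
qed

text \<open>
  A surjective endomorphism permutes the finitely many open normal subgroups of each index. Hence
  it is injective, and the sorting data, which grow along its orbits, are constant on them.
\<close>

lemma (in profinite) sorted_endomorphism:
  assumes fin: "\<And>m. finite {N \<in> open_normal G. index G N = m}"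
    and \<theta>: "sorted_morphism G F G F \<theta>"
  shows "inj_on \<theta> (carrier G)" "N \<in> open_normal G \<Longrightarrow> F (\<theta> -` N \<inter> carrier G) \<subseteq> F N"
proof -
  note D = sorted_morphismD[OF \<theta>]
  interpret \<theta>: group_hom G G \<theta> using D(1) by unfold_locales
  define T where "T N = \<theta> -` N \<inter> carrier G" for N
  define X where "X m = {N \<in> open_normal G. index G N = m}" for m
  have Ton: "T N \<in> open_normal G" if "N \<in> open_normal G" for N
    unfolding T_def using vimage_open_normal[OF profinite_axioms profinite_axioms D(1,2) that] .
  have TX: "T N \<in> X m" if "N \<in> X m" for N m
    using that Ton card_rcosets_vimage[OF \<theta>.group_hom_axioms D(3), of N]
    by (auto simp: X_def T_def open_normal_def normal_imp_subgroup)
  have \<theta>T: "\<theta> ` T N = N" if "N \<in> open_normal G" for N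
  proof -
    have "N \<subseteq> \<theta> ` carrier G" using normalD(2)[OF open_normalD(1)[OF that]] D(3) by simp
    then show ?thesis unfolding T_def by auto
  qed
  have Tinj: "inj_on T (open_normal G)" by (rule inj_onI) (metis \<theta>T)
  \<comment> \<open>\<open>T\<close> is injective and preserves the finite set of subgroups of the
    index of \<open>N\<close>, so it is onto that set.\<close>
  have Tsurj: "\<exists>M\<in>open_normal G. N = T M" if N: "N \<in> open_normal G" for N
  proof -
    have "inj_on T (X (index G N))" using Tinj by (rule inj_on_subset) (auto simp: X_def)
    moreover have "finite (X (index G N))" using fin by (simp add: X_def)
    ultimately have "T ` X (index G N) = X (index G N)" using TX by (intro endo_inj_surj) auto
    moreover have "N \<in> X (index G N)" using N by (simp add: X_def)
    ultimately obtain M where "M \<in> X (index G N)" "N = T M" by blast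
    then show ?thesis by (auto simp: X_def)
  qed
  show "inj_on \<theta> (carrier G)"
  proof (rule inj_onI, rule ccontr)
    fix x y assume xy: "x \<in> carrier G" "y \<in> carrier G" "\<theta> x = \<theta> y" "x \<noteq> y"
    then have "x \<otimes> inv y \<noteq> \<one>" using mult_inv_eq_one_iff by simp
    then obtain N where N: "N \<in> open_normal G" "x \<otimes> inv y \<notin> N"
      using open_normal_over_separates[OF one_is_normal one_closed_set, of "x \<otimes> inv y"] xy by (auto simp: open_normal_over_def)
    obtain M where M: "M \<in> open_normal G" "N = T M" using Tsurj[OF N(1)] by auto
    \<comment> \<open>Elements of the kernel lie in every \<open>T M\<close>, that is, in every open
      normal subgroup.\<close>
    have "\<theta> (x \<otimes> inv y) = \<one>" using xy by simp
    then have "x \<otimes> inv y \<in> T M" using xy normalD(3)[OF open_normalD(1)[OF M(1)]] by (simp add: T_def)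
    then show False using N M by simp
  qed
  assume N: "N \<in> open_normal G"
  have Tn: "(T ^^ i) N \<in> X (index G N)" for i
    using N TX by (induction i) (auto simp: X_def)
  then have Tno: "(T ^^ i) N \<in> open_normal G" for i by (auto simp: X_def)
  have mono: "F ((T ^^ i) N) \<subseteq> F ((T ^^ (i + k)) N)" for i k
  proof (induction k)
    case (Suc k)
    have "F ((T ^^ (i + k)) N) \<subseteq> F (T ((T ^^ (i + k)) N))" using D(6)[OF Tno] by (simp add: T_def)
    then show ?case using Suc by simp
  qed simp
  \<comment> \<open>The orbit of \<open>N\<close> under the injective map \<open>T\<close> is
    finite, so it returns to \<open>N\<close>. The data only grow along the orbit, so its first step
    adds nothing.\<close>
  have "range (\<lambda>i. (T ^^ i) N) \<subseteq> X (index G N)" using Tn by auto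
  then have "finite (range (\<lambda>i. (T ^^ i) N))" using fin finite_subset unfolding X_def by blast
  then have "\<not> inj (\<lambda>i. (T ^^ i) N)" using range_inj_infinite by blast
  then obtain i j where ij: "i < j" "(T ^^ i) N = (T ^^ j) N"
    unfolding inj_on_def by (metis linorder_neqE_nat)
  have cancel: "(T ^^ k) N = N" if "(T ^^ i) N = (T ^^ (i + k)) N" for i k
    using that
  proof (induction i)
    case (Suc i)
    then have "T ((T ^^ i) N) = T ((T ^^ (i + k)) N)" by simp
    then have "(T ^^ i) N = (T ^^ (i + k)) N" using inj_onD[OF Tinj _ Tno Tno] by blast
    then show ?case by (rule Suc.IH)
  qed simp
  obtain d where d: "j = i + (1 + d)" using less_imp_Suc_add[OF ij(1)] by auto
  have "(T ^^ (1 + d)) N = N" using cancel[of i "1 + d"] ij(2) unfolding d by simp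
  then have "F ((T ^^ 1) N) \<subseteq> F N" using mono[of 1 d] by metis
  then show "F (\<theta> -` N \<inter> carrier G) \<subseteq> F N" by (simp add: T_def)
qed

text \<open>The composite \<open>\<theta>\<close> of \<open>q'\<close> and \<open>q\<close> is
  injective and \<open>q'\<close> is onto, so \<open>q\<close> is injective. Its inverse respects
  the sorting because the data of \<open>H\<close> do not grow under preimages by
  \<open>\<theta>\<close>.\<close>

lemma sorted_isomorphism_of_mutual:
  fixes H :: "'a tgroup" and H' :: "'b tgroup"
  assumes H: "profinite H" and H': "profinite H'"
    and fin: "\<And>m. finite {N \<in> open_normal H. index H N = m}"
    and q: "sorted_morphism H' FH' H FH q" and q': "sorted_morphism H FH H' FH' q'"
  shows "sorted_isomorphism H' FH' H FH q"
proof -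
  interpret H: profinite H by fact
  interpret H': profinite H' by fact
  define \<theta> where "\<theta> x = q (q' x)" for x
  have \<theta>: "sorted_morphism H FH H FH \<theta>" unfolding \<theta>_def using sorted_morphism_comp[OF q' q H' H] .
  note E = H.sorted_endomorphism[OF fin \<theta>]
  note qD = sorted_morphismD[OF q] and q'D = sorted_morphismD[OF q']
  have qinj: "inj_on q (carrier H')"
  proof (rule inj_onI)
    fix x y assume xy: "x \<in> carrier H'" "y \<in> carrier H'" "q x = q y"
    obtain a b where ab: "a \<in> carrier H" "b \<in> carrier H" "q' a = x" "q' b = y" using xy q'D(3) by (metis imageE)
    then have "\<theta> a = \<theta> b" using xy by (simp add: \<theta>_def)
    then show "x = y" using inj_onD[OF E(1) _ ab(1,2)] ab by auto
  qed
  define g where "g = inv_into (carrier H') q"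
  have gq: "g (q x) = x" if "x \<in> carrier H'" for x using that qinj by (simp add: g_def)
  have g: "g y \<in> carrier H'" "q (g y) = y" if "y \<in> carrier H" for y
    using that qD(3) by (auto simp: g_def inv_into_into f_inv_into_f)
  have "sorted_morphism H FH H' FH' g"
    unfolding sorted_morphism_iff[OF H H']
  proof (intro conjI ballI)
    show "g \<in> hom H H'"
    proof (rule homI)
      fix x y assume xy: "x \<in> carrier H" "y \<in> carrier H"
      have "q (g x \<otimes>\<^bsub>H'\<^esub> g y) = x \<otimes>\<^bsub>H\<^esub> y" using xy g qD(5) by simp
      then show "g (x \<otimes>\<^bsub>H\<^esub> y) = g x \<otimes>\<^bsub>H'\<^esub> g y" using gq[of "g x \<otimes>\<^bsub>H'\<^esub> g y"] xy g by simp
    qed (rule g)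
    show "g ` carrier H = carrier H'"
    proof
      show "carrier H' \<subseteq> g ` carrier H" using gq qD(4) by (metis imageI subsetI)
    qed (use g in auto)
    fix M assume M: "M \<in> open_normal H'"
    have Mc: "M \<subseteq> carrier H'" using H'.normalD(2)[OF H'.open_normalD(1)[OF M]] .
    have eq: "g -` M \<inter> carrier H = q ` M"
    proof
      show "g -` M \<inter> carrier H \<subseteq> q ` M"
      proof
        fix x assume "x \<in> g -` M \<inter> carrier H"
        then have "x = q (g x)" "g x \<in> M" using g by auto
        then show "x \<in> q ` M" by (rule image_eqI)
      qed
      show "q ` M \<subseteq> g -` M \<inter> carrier H" using Mc gq qD(4) by auto
    qed
    have qM: "q ` M \<in> open_normal H" using image_open_normal[OF H' H qD(1,2,3) M] .
    show "g -` M \<inter> carrier H \<in> open_normal H" unfolding eq by (rule qM)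
    have "FH' M \<subseteq> FH (q' -` M \<inter> carrier H)" using q'D(6)[OF M] .
    \<comment> \<open>Injectivity of \<open>q\<close> turns membership of \<open>q' x\<close> in
      \<open>M\<close> into membership of \<open>\<theta> x\<close> in the image of
      \<open>M\<close>.\<close>
    also have "q' -` M \<inter> carrier H = \<theta> -` (q ` M) \<inter> carrier H"
    proof (rule Set.set_eqI)
      fix x show "x \<in> q' -` M \<inter> carrier H \<longleftrightarrow> x \<in> \<theta> -` (q ` M) \<inter> carrier H"
        by (cases "x \<in> carrier H") (simp_all add: \<theta>_def inj_on_image_mem_iff[OF qinj q'D(4) Mc])
    qed
    also have "FH \<dots> \<subseteq> FH (q ` M)" using E(2)[OF qM] .
    finally show "FH' M \<subseteq> FH (g -` M \<inter> carrier H)" unfolding eq .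
  qed
  then show ?thesis unfolding sorted_isomorphism_def using q gq g by blast
qed

text \<open>The finitely many images of the generators generate a dense subgroup, since density
  passes through the surjection \<open>q\<close>.\<close>

lemma finite_index_of_fg_cover:
  fixes H :: "'a tgroup"
  assumes H: "profinite H" and q: "sorted_morphism (free_fg n) F H FH q"
  shows "finite {N \<in> open_normal H. index H N = m}"
proof -
  interpret H: profinite H by fact
  interpret fg: generated_product "fg_index n" "\<lambda>i. tab_group (fst i)" "fg_gen n" by (rule generated_product_fg)
  note qD = sorted_morphismD[OF q]
  interpret q: group_hom fg.P H q
    using qD(1) fg.P_group H.group_axioms by (simp add: group_hom_def group_hom_axioms_def)
  have r: "range (fg_gen n) \<subseteq> carrier fg.P" using fg.\<iota>_P by auto
  show ?thesis
  proof (rule H.finite_open_normal_index)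
    have const: "fg_gen n j = fg_gen n n" if "j \<ge> n" for j using that by (auto simp: fg_gen_def fun_eq_iff restrict_def)
    have "fg_gen n j \<in> fg_gen n ` {..n}" for j
    proof (cases "j \<le> n")
      case False
      then have "j \<ge> n" by simp
      then show ?thesis unfolding const[OF \<open>j \<ge> n\<close>] by (intro imageI) simp
    qed (simp add: imageI)
    then have "range (fg_gen n) \<subseteq> fg_gen n ` {..n}" by (rule image_subsetI)
    then have "finite (range (fg_gen n))" by (rule finite_subset) simp
    then show "finite (q ` range (fg_gen n))" by (rule finite_imageI)
    show "q ` range (fg_gen n) \<subseteq> carrier H" using r by auto
    fix N x assume N: "N \<in> open_normal H" and x: "x \<in> carrier H"
    have "x \<in> q ` carrier fg.P" unfolding qD(3) by (rule x)
    then obtain z where z: "z \<in> carrier fg.P" "x = q z" by (rule imageE)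
    have "q -` N \<inter> carrier fg.P \<in> open_normal fg.P" using vimage_open_normal[OF fg.P_profinite H qD(1,2) N] .
    from fg.gens_dense[OF this z(1)]
    obtain y where y: "y \<in> generate fg.P (range (fg_gen n))" "z \<otimes>\<^bsub>fg.P\<^esub> inv\<^bsub>fg.P\<^esub> y \<in> q -` N \<inter> carrier fg.P"
      by (rule bexE)
    have yP: "y \<in> carrier fg.P" using y(1) fg.gens_eq fg.gens_P by auto
    have "q y \<in> generate H (q ` range (fg_gen n))" using q.generate_img[OF r] y(1) by blast
    moreover have "x \<otimes>\<^bsub>H\<^esub> inv\<^bsub>H\<^esub> (q y) \<in> N" using y(2) z yP by simp
    ultimately show "\<exists>y\<in>generate H (q ` range (fg_gen n)). x \<otimes>\<^bsub>H\<^esub> inv\<^bsub>H\<^esub> y \<in> N" by blast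
  qed
qed

text \<open>Used to pass from universality in \<open>'a cover_type\<close> to universality in other
  types: the former provides the morphism from \<open>H0\<close>, and composing with it carries over
  all factorisations through \<open>H0\<close>.\<close>

lemma universal_SEP_cover_of_morphism:
  fixes H0 :: "'h tgroup" and H :: "'b tgroup" and G :: "'a tgroup"
  assumes U: "universal_SEP_cover TYPE('d) Jsub G F H0 F0 f0" and cover: "SEP_cover Jsub G F H FH p"
    and q: "sorted_morphism H0 F0 H FH q" "\<forall>x\<in>carrier H0. p (q x) = f0 x"
  shows "universal_SEP_cover TYPE('d) Jsub G F H FH p"
proof -
  have pro: "profinite H0" "profinite H"
    using U cover by (auto simp: universal_SEP_cover_def SEP_cover_def sorted_profinite_def profiniteI)
  have "\<exists>g. sorted_morphism E FE H FH g \<and> (\<forall>x\<in>carrier E. p (g x) = r x)"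
    if E: "SEP_cover Jsub G F E FE r" for E :: "'d tgroup" and FE r
  proof -
    obtain g where g: "sorted_morphism E FE H0 F0 g" "\<forall>x\<in>carrier E. f0 (g x) = r x"
      using U E unfolding universal_SEP_cover_def by blast
    have "sorted_morphism E FE H FH (\<lambda>x. q (g x))" using sorted_morphism_comp[OF g(1) q(1) pro] .
    moreover have "p (q (g x)) = r x" if "x \<in> carrier E" for x
      using q(2) g(2) sorted_morphismD(4)[OF g(1) that] that by simp
    ultimately show ?thesis by blast
  qed
  then show ?thesis using cover by (simp add: universal_SEP_cover_def)
qed

text \<open>\<open>'a cover_type\<close> serves to name the universal cover; the arbitrary type
  \<open>'c\<close> expresses that covers of every size factor through it. The first assumption
  gives \<open>Jsub\<close> its codomain, the non-empty lists.\<close>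

theorem theorem3p13:
  fixes Jsub :: "nat \<Rightarrow> 'j list \<Rightarrow> 'j list"
    and G :: "'a tgroup" and F :: "'a set \<Rightarrow> 'j list set"
  assumes "\<And>k J. k \<ge> 1 \<Longrightarrow> J \<in> sort_seqs \<Longrightarrow> Jsub k J \<in> sort_seqs"
    and "sorted_profinite Jsub G F"
  shows
    "(\<exists>(H :: 'a cover_type tgroup) FH p.
        universal_SEP_cover TYPE('a cover_type) Jsub G F H FH p) \<and>
     (\<forall>(H :: 'a cover_type tgroup) FH p.
        universal_SEP_cover TYPE('a cover_type) Jsub G F H FH p \<longrightarrow>
          universal_SEP_cover TYPE('c) Jsub G F H FH p \<and>
          (topologically_fg G \<longrightarrow>
            (\<forall>(H' :: 'c tgroup) FH' p'.
               universal_SEP_cover TYPE('a cover_type) Jsub G F H' FH' p' \<longrightarrow>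
               (\<exists>q. sorted_isomorphism H' FH' H FH q \<and>
                    (\<forall>x\<in>carrier H'. p' x = p (q x))))))"
proof -
  have Jok: "\<forall>k\<ge>1. \<forall>J\<in>sort_seqs. Jsub k J \<in> sort_seqs" using assms(1) by blast
  note G = assms(2)
  obtain P :: "(nat list list \<times> ('a \<Rightarrow> nat) \<times> nat list \<Rightarrow> nat) tgroup" and e p0 where P: "profinite P" "SEP Jsub P (\<lambda>_. sort_seqs)"
    and p0: "sorted_morphism P (\<lambda>_. sort_seqs) G F p0"
    and e: "inj_on (e :: _ \<Rightarrow> 'a cover_type) (carrier P)"
    using free_profinite SEP_free ex_free_cover[OF G] ex_inj_free_cover_type by blast
  interpret T: tower P Jsub using P Jok by (simp add: tower_def tower_axioms_def)
  define a where "a = (p0 -` {\<one>\<^bsub>G\<^esub>} \<inter> carrier P,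
    \<lambda>N. if N \<in> open_normal_over P (p0 -` {\<one>\<^bsub>G\<^esub>} \<inter> carrier P) then F (p0 ` N) else {})"
  have "a \<in> Field (tower_le Jsub P)"
    using cover_rel_sorting(1)[OF P(1) G p0] by (simp add: Field_tower_le a_def)
  then have rs: "rel_sorting Jsub P (fst (T.fixp_above a)) (snd (T.fixp_above a))"
    using T.fixp_above_Field by (simp add: Field_tower_le)
  obtain c :: "_ \<Rightarrow> 'a cover_type" where c: "coset_map P (fst (T.fixp_above a)) c"
    using ex_coset_map_inj[OF P(1) rel_sortingD(1,2)[OF rs] e] by auto
  define H0 where "H0 = quo P c"
  define F0 where "F0 = (\<lambda>M. snd (T.fixp_above a) (c -` M \<inter> carrier P))"
  define f0 where "f0 = (\<lambda>b. p0 (inv_into (carrier P) c b))"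
  \<comment> \<open>Three types of competitors occur: \<open>'a cover_type\<close> for existence,
    \<open>'c\<close> for arbitrary covers, and the type of \<open>free_fg n\<close> for finiteness
    in the finitely generated case.\<close>
  have U1: "universal_SEP_cover TYPE('a cover_type) Jsub G F H0 F0 f0"
    unfolding H0_def F0_def f0_def a_def
    using T.universal_quo[OF G p0 c[unfolded a_def]] by simp
  have U2: "universal_SEP_cover TYPE('c) Jsub G F H0 F0 f0"
    unfolding H0_def F0_def f0_def a_def
    using T.universal_quo[OF G p0 c[unfolded a_def]] by simp
  have U3: "universal_SEP_cover TYPE(nat list list \<times> nat list \<Rightarrow> nat) Jsub G F H0 F0 f0"
    unfolding H0_def F0_def f0_def a_def
    using T.universal_quo[OF G p0 c[unfolded a_def]] by simp
  show ?thesis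
  proof (intro conjI exI[of _ H0] exI[of _ F0] exI[of _ f0] allI impI)
    show "universal_SEP_cover TYPE('a cover_type) Jsub G F H0 F0 f0" by (rule U1)
    fix H :: "'a cover_type tgroup" and FH p
    assume UH: "universal_SEP_cover TYPE('a cover_type) Jsub G F H FH p"
    then have cover: "SEP_cover Jsub G F H FH p" by (simp add: universal_SEP_cover_def)
    have "SEP_cover Jsub G F H0 F0 f0" using U1 by (simp add: universal_SEP_cover_def)
    \<comment> \<open>\<open>H0\<close> is itself a cover in \<open>'a cover_type\<close>, so
      universality of \<open>H\<close> applies to it; universality of \<open>H\<close> in other
      types comes through \<open>s\<close>.\<close>
    then obtain s where s: "sorted_morphism H0 F0 H FH s" "\<forall>x\<in>carrier H0. p (s x) = f0 x"
      using UH unfolding universal_SEP_cover_def by blast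
    show UHc: "universal_SEP_cover TYPE('c) Jsub G F H FH p"
      using universal_SEP_cover_of_morphism[OF U2 cover s] .
    have UHf: "universal_SEP_cover TYPE(nat list list \<times> nat list \<Rightarrow> nat) Jsub G F H FH p"
      using universal_SEP_cover_of_morphism[OF U3 cover s] .
    fix H' :: "'c tgroup" and FH' p'
    assume fg: "topologically_fg G" and UH': "universal_SEP_cover TYPE('a cover_type) Jsub G F H' FH' p'"
    then have cover': "SEP_cover Jsub G F H' FH' p'" by (simp add: universal_SEP_cover_def)
    have pro: "profinite H" "profinite H'"
      using cover cover' by (auto simp: SEP_cover_def sorted_profinite_def profiniteI)
    obtain q where q: "sorted_morphism H' FH' H FH q" "\<forall>x\<in>carrier H'. p (q x) = p' x"
      using UHc cover' unfolding universal_SEP_cover_def by blast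
    \<comment> \<open>\<open>H\<close> lies in \<open>'a cover_type\<close>, so universality of
      \<open>H'\<close> among covers in that type gives this direction.\<close>
    obtain q' where q': "sorted_morphism H FH H' FH' q'"
      using UH' cover unfolding universal_SEP_cover_def by blast
    obtain n r where r: "sorted_morphism (free_fg n) (\<lambda>_. sort_seqs) G F r"
      using ex_free_fg_cover[OF G fg] by auto
    have "sorted_profinite Jsub (free_fg n) (\<lambda>_. sort_seqs)"
      using generated_product.P_profinite[OF generated_product_fg, of n] sorting_on_all[OF Jok]
      by (simp add: sorted_profinite_def sorting_data_iff profinite.profin)
    then have "SEP_cover Jsub G F (free_fg n) (\<lambda>_. sort_seqs) r"
      using SEP_free_fg r by (simp add: SEP_cover_def)
    then obtain s' where s': "sorted_morphism (free_fg n) (\<lambda>_. sort_seqs) H FH s'"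
      using UHf unfolding universal_SEP_cover_def by blast
    have fin: "finite {N \<in> open_normal H. index H N = m}" for m
      using finite_index_of_fg_cover[OF pro(1) s'] .
    have "sorted_isomorphism H' FH' H FH q"
      using sorted_isomorphism_of_mutual[OF pro fin q(1) q'] .
    then show "\<exists>q. sorted_isomorphism H' FH' H FH q \<and> (\<forall>x\<in>carrier H'. p' x = p (q x))"
      using q(2) by (intro exI[of _ q]) simp
  qed
qed

end
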